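(* Let $A\in L^2_{\rm loc}(\mathbb{R}^+)$ be the coefficient of a Krein system and let $\mathfrak{f}$ be its Schur function. Then $A\in L^2(\mathbb{R}^+)$ if and only if $\mathfrak{f}\in S_0(\mathbb{C}^+)$, i.e. if and only if the boundary values of $\mathfrak{f}$ on $\mathbb{R}$ satisfy $$\int_{-\infty}^\infty\ln(1-|\mathfrak{f}(\lambda)|^2)\,d\lambda>-\infty .$$
   Context: $\mathbb{C}^+$ is the open upper half-plane. For complex-valued $A\in L^2_{\rm loc}(\mathbb{R}^+)$ (i.e. $A\in L^2[0,R]$ for all $R>0$) and $\lambda\in\mathbb{C}$ let $X(r,\lambda)$ solve $X'=\begin{bmatrix}i\lambda&-\overline{A(r)}\\-A(r)&0\end{bmatrix}X$, $X(0,\lambda)=I$, and write its second row as $(\mathfrak{B}(r,\lambda),\mathfrak{A}(r,\lambda))$. The Schur function of the Krein system with coefficient $A$ is $\mathfrak{f}(\lambda)=\lim_{r\to\infty}\mathfrak{B}(r,\lambda)\mathfrak{A}^{-1}(r,\lambda)$, $\lambda\in\mathbb{C}^+$; the limit exists, is analytic in $\mathbb{C}^+$ and satisfies $|\mathfrak{f}|\le1$. The class $S_0(\mathbb{C}^+)$ consists of all functions $f$ analytic in $\mathbb{C}^+$ with $|f|\le1$ whose boundary values satisfy $\int_{\mathbb{R}}\ln(1-|f(\lambda)|^2)d\lambda>-\infty$. *)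

theory Defs
  imports "HOL-Complex_Analysis.Complex_Analysis"
begin

definition upper_half_plane :: "complex set" where
  "upper_half_plane = {z. Im z > 0}"

definition L2_on :: "real set \<Rightarrow> (real \<Rightarrow> complex) \<Rightarrow> bool" where
  "L2_on S A \<longleftrightarrow>
     set_borel_measurable lebesgue S A \<and> set_integrable lebesgue S (\<lambda>r. (cmod (A r))\<^sup>2)"

definition L2_loc :: "(real \<Rightarrow> complex) \<Rightarrow> bool" where
  "L2_loc A \<longleftrightarrow> (\<forall>R>0. L2_on {0..R} A)"

definition krein_matrix :: "(real \<Rightarrow> complex) \<Rightarrow> complex \<Rightarrow> real \<Rightarrow> complex^2^2" where
  "krein_matrix A l r = vector [vector [\<i> * l, - cnj (A r)], vector [- A r, 0]]"

(* X' = krein_matrix A l X, X(0) = I.  For a coefficient that is merely locally square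
   integrable, solutions are understood in the Caratheodory sense (locally absolutely continuous,
   equation satisfied almost everywhere), that is, through the integrated equation. *)
definition krein_solution ::
    "(real \<Rightarrow> complex) \<Rightarrow> complex \<Rightarrow> (real \<Rightarrow> complex^2^2) \<Rightarrow> bool" where
  "krein_solution A l X \<longleftrightarrow>
     continuous_on {0..} X \<and>
     (\<forall>r\<ge>0. ((\<lambda>s. krein_matrix A l s ** X s) has_integral (X r - mat 1)) {0..r})"

(* The second row of X is (B, A) = (X $ 2 $ 1, X $ 2 $ 2), so the quotient is B A^{-1}.
   Values of f outside the upper half-plane are irrelevant. *)
definition is_schur_function :: "(real \<Rightarrow> complex) \<Rightarrow> (complex \<Rightarrow> complex) \<Rightarrow> bool" where
  "is_schur_function A f \<longleftrightarrow>
     (\<forall>l\<in>upper_half_plane. \<exists>X. krein_solution A l X \<and>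
        ((\<lambda>r. X r $ 2 $ 1 * inverse (X r $ 2 $ 2)) \<longlongrightarrow> f l) at_top)"

(* For a bounded analytic f the vertical limit exists at almost every x (Fatou);
   on the remaining null set the value is arbitrary. *)
definition boundary_value :: "(complex \<Rightarrow> complex) \<Rightarrow> real \<Rightarrow> complex" where
  "boundary_value f x = Lim (at_right 0) (\<lambda>y. f (Complex x y))"

(* - ln (1 - |w|^2) with the convention ln 0 = - \<infinity>, whereas the library has ln 0 = 0. *)
definition neg_log_defect :: "complex \<Rightarrow> ennreal" where
  "neg_log_defect w =
     (if cmod w < 1 then ennreal (- ln (1 - (cmod w)\<^sup>2)) else \<infinity>)"

(* The integral of ln (1 - |f|^2) over the real line, an extended real in [- \<infinity>, 0]:
   the integrand is nonpositive, so this is minus a nonnegative integral. *)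
definition log_integral :: "(complex \<Rightarrow> complex) \<Rightarrow> ereal" where
  "log_integral f = - enn2ereal (\<integral>\<^sup>+ x. neg_log_defect (boundary_value f x) \<partial>lebesgue)"

definition S0 :: "(complex \<Rightarrow> complex) set" where
  "S0 = {f. f holomorphic_on upper_half_plane \<and>
            (\<forall>z\<in>upper_half_plane. cmod (f z) \<le> 1) \<and>
            log_integral f > - \<infinity>}"

end

theory Submission
  imports Defs
begin

text \<open>
  For a coefficient truncated at \<open>R\<close> the quotient \<open>u\<close> of the entries of the row
  \<open>e\<^sub>2\<^sup>T X(R) X(s)\<^sup>-\<^sup>1\<close> solves the Riccati equation
  \<open>u' = - i l u + A - conj(A) u\<^sup>2\<close> with \<open>\<bar>u\<bar> \<le> 1\<close>, \<open>u(R) = 0\<close>, and \<open>u(0)\<close> is the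
  approximant of the Schur function. As \<open>R \<rightarrow> \<infinity>\<close> these solutions converge to one with
  \<open>u(0) = f(l)\<close>. Put \<open>L(r) = \<integral>\<^sub>0\<^sup>r conj(A) u\<close>, which is bounded and analytic in \<open>l\<close>. The identity
  \<open>((1 - \<bar>u\<bar>\<^sup>2) exp (2 Re L))' = - 2 Im l \<bar>u\<bar>\<^sup>2 exp (2 Re L)\<close> compares \<open>- 2 Re L\<close> with
  \<open>- ln (1 - \<bar>f\<bar>\<^sup>2)\<close> near the real line, while on the imaginary axis \<open>y L(i y, r)\<close> is
  bounded by, and tends to minus, the integral of \<open>\<bar>A\<bar>\<^sup>2\<close>. The Poisson formula for \<open>Re L\<close> at
  \<open>i y\<close> links the two, and both implications follow from Fatou's lemma.
\<close>

section \<open>Absolutely continuous functions\<close>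

text \<open>The two implications are asymmetric. When \<open>A\<close> is square integrable, the
  truncated solutions vanish at \<open>R\<close>, so the identity bounds - ln (1 - |u(0)|^2) by - 2
  Re L, with bounds uniform in \<open>R\<close>, and the truncation can be removed late, by lower
  semicontinuity. In the converse the length r has to stay fixed while the spectral parameter
  reaches the real line, because the error in the identity is of order r * Im l * exp (2 N). The
  truncated solutions are therefore replaced first by their limit, which need not vanish at r, so Re
  L has no known sign there. Only finiteness is compared, hence one-sided estimates with a lost
  factor 2 suffice. Two obstacles account for the auxiliary theory. \<open>A\<close> is only locally
  square integrable, so all equations are kept in integrated form and the product and exponential
  rules concern indefinite integrals. The boundary values are vertical limits; their existence
  almost everywhere comes from differentiating a Lipschitz primitive along the boundary.\<close>

lemma quadratic_increment_imp_constant: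
  fixes D :: "real \<Rightarrow> 'a::real_normed_vector" and H :: "real \<Rightarrow> real"
  assumes "a \<le> b" and cont: "continuous_on {a..b} H"
    and mono: "\<And>x y. a \<le> x \<Longrightarrow> x \<le> y \<Longrightarrow> y \<le> b \<Longrightarrow> H x \<le> H y"
    and D: "\<And>x y. a \<le> x \<Longrightarrow> x \<le> y \<Longrightarrow> y \<le> b \<Longrightarrow> norm (D y - D x) \<le> C * (H y - H x)\<^sup>2"
  shows "D b = D a"
proof -
  have *: "norm (D y - D x) \<le> C * (H y - H x)\<^sup>2 / 2 ^ n"
    if "a \<le> x" "x \<le> y" "y \<le> b" for x y n
    using that
  proof (induction n arbitrary: x y)
    case 0
    then show ?case using D by simp
  next
    case (Suc n)
    have "continuous_on {x..y} H"
      using cont continuous_on_subset Suc.prems by (metis atLeastatMost_subset_iff)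
    moreover have "H x \<le> (H x + H y) / 2" "(H x + H y) / 2 \<le> H y"
      using mono[of x y] Suc.prems by auto
    \<comment> \<open>Splitting at the midpoint of the values of \<open>H\<close>, not of the
      interval, leaves each half with a quarter of the squared increment. Every bisection thus
      halves the bound on the whole increment of \<open>D\<close>.\<close>
    ultimately obtain m where m: "x \<le> m" "m \<le> y" "H m = (H x + H y) / 2"
      using IVT'[of H x "(H x + H y) / 2" y] Suc.prems by auto
    have "norm (D y - D x) \<le> norm (D y - D m) + norm (D m - D x)"
      using norm_triangle_ineq[of "D y - D m" "D m - D x"] by simp
    also have "\<dots> \<le> C * (H y - H m)\<^sup>2 / 2 ^ n + C * (H m - H x)\<^sup>2 / 2 ^ n"
      using Suc.prems m(1,2) by (intro add_mono Suc.IH) auto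
    also have "\<dots> = C * (H y - H x)\<^sup>2 / 2 ^ Suc n"
      by (simp add: m(3) field_simps power2_eq_square)
    finally show ?case .
  qed
  have "(\<lambda>n. C * (H b - H a)\<^sup>2 / 2 ^ n) \<longlonglongrightarrow> 0"
    by (rule LIMSEQ_divide_realpow_zero) simp
  moreover have "\<forall>n. norm (D b - D a) \<le> C * (H b - H a)\<^sup>2 / 2 ^ n"
    using * assms(1) by auto
  ultimately have "norm (D b - D a) \<le> 0"
    using LIMSEQ_le_const by blast
  then show ?thesis by simp
qed

text \<open>Carrying the density \<open>f\<close> along keeps every differential equation in
  integrated form, so no pointwise derivative of a solution is taken. Absolute integrability is a
  separate conjunct because \<open>has_integral\<close> is the gauge integral, which also admits
  conditionally integrable densities.\<close>

definition ac :: "real \<Rightarrow> (real \<Rightarrow> complex) \<Rightarrow> (real \<Rightarrow> complex) \<Rightarrow> bool" where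
  "ac R F f \<longleftrightarrow> f absolutely_integrable_on {0..R} \<and>
     (\<forall>s\<in>{0..R}. (f has_integral (F s - F 0)) {0..s})"

lemma ac_integrand_integrable: "ac R F f \<Longrightarrow> 0 \<le> a \<Longrightarrow> b \<le> R \<Longrightarrow> f absolutely_integrable_on {a..b}"
  unfolding ac_def by (meson absolutely_integrable_on_subinterval atLeastatMost_subset_iff)

lemma ac_has_integral:
  assumes "ac R F f" "0 \<le> a" "a \<le> b" "b \<le> R"
  shows "(f has_integral (F b - F a)) {a..b}"
proof -
  have b: "(f has_integral (F b - F 0)) {0..b}" and a: "(f has_integral (F a - F 0)) {0..a}"
    using assms by (auto simp: ac_def)
  have "integral {0..a} f + integral {a..b} f = integral {0..b} f"
    by (rule Henstock_Kurzweil_Integration.integral_combine) (use assms b in auto)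
  then have "integral {a..b} f = F b - F a"
    using a b by (simp add: integral_unique algebra_simps)
  moreover have "f integrable_on {a..b}"
    using ac_integrand_integrable[OF assms(1,2,4)] absolutely_integrable_on_def by blast
  ultimately show ?thesis
    using integrable_integral by fastforce
qed

lemma ac_subinterval: "ac R F f \<Longrightarrow> 0 \<le> r \<Longrightarrow> r \<le> R \<Longrightarrow> ac r F f"
  using ac_integrand_integrable[of R F f 0 r] by (auto simp: ac_def)

lemma ac_continuous: assumes "ac R F f" shows "continuous_on {0..R} F"
proof -
  have "continuous_on {0..R} (\<lambda>s. F 0 + integral {0..s} f)"
    using assms by (intro continuous_intros indefinite_integral_continuous_1)
      (auto simp: ac_def absolutely_integrable_on_def)
  moreover have "F s = F 0 + integral {0..s} f" if "s \<in> {0..R}" for s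
  proof -
    have "(f has_integral (F s - F 0)) {0..s}" using assms that by (simp add: ac_def)
    then show ?thesis by (simp add: integral_unique)
  qed
  ultimately show ?thesis
    by (rule continuous_on_eq[OF _ sym])
qed

lemma absolutely_integrable_continuous_mult:
  fixes F f :: "real \<Rightarrow> complex"
  assumes "continuous_on {a..b} F" "f absolutely_integrable_on {a..b}"
  shows "(\<lambda>x. F x * f x) absolutely_integrable_on {a..b}" "(\<lambda>x. f x * F x) absolutely_integrable_on {a..b}"
proof -
  show "(\<lambda>x. F x * f x) absolutely_integrable_on {a..b}"
    using absolutely_integrable_bounded_measurable_product[of "(*)" F "{a..b}" f, OF bilinear_times]
      continuous_imp_measurable_on_sets_lebesgue[OF assms(1)] assms
      compact_imp_bounded[OF compact_continuous_image[OF assms(1)]] by auto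
  then show "(\<lambda>x. f x * F x) absolutely_integrable_on {a..b}"
    by (simp add: mult.commute)
qed

lemma ac_const: "ac R (\<lambda>_. c) (\<lambda>_. 0)"
  by (auto simp: ac_def)

lemma ac_add:
  assumes "ac R F f" "ac R G g"
  shows "ac R (\<lambda>s. F s + G s) (\<lambda>s. f s + g s)"
proof -
  have "((\<lambda>s. f s + g s) has_integral (F s + G s - (F 0 + G 0))) {0..s}" if "s \<in> {0..R}" for s
    using has_integral_add[of f "F s - F 0" "{0..s}" g "G s - G 0"] assms that
    by (simp add: ac_def add_diff_add)
  then show ?thesis
    using assms set_integral_add(1)[of lebesgue "{0..R}" f g] by (simp add: ac_def)
qed

lemma ac_cmult:
  assumes "ac R F f" shows "ac R (\<lambda>s. c * F s) (\<lambda>s. c * f s)"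
proof -
  have "((\<lambda>s. c * f s) has_integral (c * F s - c * F 0)) {0..s}" if "s \<in> {0..R}" for s
    using has_integral_mult_right[of f "F s - F 0" "{0..s}" c] assms that
    by (simp add: ac_def right_diff_distrib)
  then show ?thesis
    using assms set_integrable_mult_right[of c lebesgue "{0..R}" f] by (simp add: ac_def)
qed

lemma ac_minus: "ac R F f \<Longrightarrow> ac R (\<lambda>s. - F s) (\<lambda>s. - f s)"
  using ac_cmult[of R F f "-1"] by simp

lemma ac_diff: "ac R F f \<Longrightarrow> ac R G g \<Longrightarrow> ac R (\<lambda>s. F s - G s) (\<lambda>s. f s - g s)"
  using ac_add[of R F f "\<lambda>s. - G s" "\<lambda>s. - g s"] ac_minus[of R G g] by simp

lemma ac_cnj: assumes "ac R F f" shows "ac R (\<lambda>s. cnj (F s)) (\<lambda>s. cnj (f s))"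
proof -
  have "(\<lambda>s. cnj (f s)) absolutely_integrable_on {0..R}"
    using absolutely_integrable_linear[OF _ bounded_linear_cnj] assms
    by (auto simp: ac_def o_def)
  moreover have "((\<lambda>s. cnj (f s)) has_integral (cnj (F s) - cnj (F 0))) {0..s}" if "s \<in> {0..R}" for s
    using has_integral_linear[of f "F s - F 0" "{0..s}" cnj, OF _ bounded_linear_cnj] assms that
    by (auto simp: ac_def o_def)
  ultimately show ?thesis by (auto simp: ac_def)
qed

lemma ac_of_derivative:
  assumes "\<And>s. s \<in> {0..R} \<Longrightarrow> (F has_vector_derivative f s) (at s within {0..R})"
    and "continuous_on {0..R} f"
  shows "ac R F f"
proof -
  have "(f has_integral (F s - F 0)) {0..s}" if "s \<in> {0..R}" for s
  proof (rule fundamental_theorem_of_calculus)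
    show "0 \<le> s" using that by auto
    fix x assume "x \<in> {0..s}"
    then show "(F has_vector_derivative f x) (at x within {0..s})"
      using assms(1)[of x] that by (auto intro: has_vector_derivative_within_subset)
  qed
  then show ?thesis
    using absolutely_integrable_continuous_real[OF assms(2)] by (auto simp: ac_def)
qed

lemma ac_indefinite_integral:
  assumes "f absolutely_integrable_on {0..R}" shows "ac R (\<lambda>s. integral {0..s} f) f"
proof -
  have "f integrable_on {0..s}" if "s \<le> R" for s
    using assms that integrable_subinterval_real[of f 0 R 0 s] by (auto simp: absolutely_integrable_on_def)
  then show ?thesis
    unfolding ac_def using assms by (auto intro!: integrable_integral)
qed

lemma ac_cong:
  assumes "ac R F f" "\<And>s. s \<in> {0..R} \<Longrightarrow> F s = G s" "\<And>s. s \<in> {0..R} \<Longrightarrow> f s = g s"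
  shows "ac R G g"
proof -
  have "g absolutely_integrable_on {0..R}"
    using assms(1) set_integrable_cong[of lebesgue lebesgue "{0..R}" "{0..R}" f g] assms(3)
    by (simp add: ac_def)
  moreover have "(g has_integral (G s - G 0)) {0..s}" if "s \<in> {0..R}" for s
    using assms that has_integral_eq[of "{0..s}" f g "F s - F 0"] by (auto simp: ac_def)
  ultimately show ?thesis by (auto simp: ac_def)
qed

text \<open>\<open>F\<close> minus the integral of \<open>f\<close> has increments quadratic in
  those of the continuous monotone function obtained by integrating \<open>h\<close>, hence is
  constant. In the product and exponential rules, freezing a factor at an endpoint produces exactly
  such second-order errors, with \<open>h\<close> built from norms of densities.\<close>

lemma ac_intI:
  fixes h :: "real \<Rightarrow> real"
  assumes f: "f absolutely_integrable_on {0..R}"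
    and h: "h integrable_on {0..R}" and h0: "\<And>s. s \<in> {0..R} \<Longrightarrow> 0 \<le> h s"
    and C: "\<And>x y. 0 \<le> x \<Longrightarrow> x \<le> y \<Longrightarrow> y \<le> R \<Longrightarrow>
      norm (F y - F x - integral {x..y} f) \<le> C * (integral {x..y} h)\<^sup>2"
  shows "ac R F f"
proof -
  define H where "H s = integral {0..s} h" for s
  define D where "D s = F s - integral {0..s} f" for s
  have fi: "f integrable_on {0..R}"
    using f by (auto simp: absolutely_integrable_on_def)
  have comb: "integral {0..x} h + integral {x..y} h = integral {0..y} h"
    if "0 \<le> x" "x \<le> y" "y \<le> R" "h integrable_on {0..R}" for x y and h :: "real \<Rightarrow> 'b::euclidean_space"
    using that integrable_subinterval_real[OF that(4), of 0 y]
    by (intro Henstock_Kurzweil_Integration.integral_combine) auto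
  have D0: "D r = D 0" if "0 \<le> r" "r \<le> R" for r
  proof (rule quadratic_increment_imp_constant[of 0 r H D C])
    show "continuous_on {0..r} H"
      unfolding H_def using integrable_subinterval_real[OF h, of 0 r] that
      by (intro indefinite_integral_continuous_1) auto
    show "H x \<le> H y" if xy: "0 \<le> x" "x \<le> y" "y \<le> r" for x y
    proof -
      have "0 \<le> integral {x..y} h"
        using xy \<open>r \<le> R\<close> by (intro integral_nonneg integrable_subinterval_real[OF h] h0) auto
      then show ?thesis
        using comb[of x y, OF _ _ _ h] xy \<open>r \<le> R\<close> by (simp add: H_def)
    qed
    show "norm (D y - D x) \<le> C * (H y - H x)\<^sup>2" if "0 \<le> x" "x \<le> y" "y \<le> r" for x y
    proof -
      have 1: "D y - D x = F y - F x - integral {x..y} f"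
        using comb[of x y, OF _ _ _ fi] that \<open>r \<le> R\<close> by (simp add: D_def algebra_simps)
      have 2: "H y - H x = integral {x..y} h"
        using comb[of x y, OF _ _ _ h] that \<open>r \<le> R\<close> by (simp add: H_def algebra_simps)
      show ?thesis unfolding 1 2 using C that \<open>r \<le> R\<close> by auto
    qed
  qed (use that in auto)
  have *: "F r - F 0 = integral {0..r} f" if "0 \<le> r" "r \<le> R" for r
  proof -
    have "F r - integral {0..r} f = F 0" using D0[OF that] by (simp add: D_def)
    then show ?thesis by (metis add_diff_cancel_left' diff_add_cancel)
  qed
  have "f integrable_on {0..s}" if "s \<le> R" for s
    using integrable_subinterval_real[OF fi, of 0 s] that by auto
  then show ?thesis
    unfolding ac_def using f by (auto simp: * intro!: integrable_integral)
qed

lemma ac_mult: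
  assumes F: "ac R F f" and G: "ac R G g"
  shows "ac R (\<lambda>s. F s * G s) (\<lambda>s. f s * G s + F s * g s)"
proof (rule ac_intI)
  have f: "f absolutely_integrable_on {0..R}" and g: "g absolutely_integrable_on {0..R}"
    using F G by (auto simp: ac_def)
  show fg: "(\<lambda>s. f s * G s + F s * g s) absolutely_integrable_on {0..R}"
    using absolutely_integrable_continuous_mult ac_continuous F G f g by (intro set_integral_add) auto
  show h: "(\<lambda>s. norm (f s) + norm (g s)) integrable_on {0..R}"
    using f g by (intro integrable_add) (auto simp: absolutely_integrable_on_def)
  fix x y assume xy: "0 \<le> x" "x \<le> y" "y \<le> R"
  define N where "N = integral {x..y} (\<lambda>s. norm (f s) + norm (g s))"
  have h': "(\<lambda>s. norm (f s) + norm (g s)) integrable_on {x..y}"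
    using integrable_subinterval_real[OF h, of x y] xy by auto
  have FN: "norm (F t - F s) \<le> N" "norm (G t - G s) \<le> N" if "x \<le> s" "s \<le> t" "t \<le> y" for s t
  proof -
    have *: "norm (P t - P s) \<le> N" if P: "ac R P p" and le: "\<And>s. norm (p s) \<le> norm (f s) + norm (g s)" for P p
    proof -
      have "(p has_integral (P t - P s)) {s..t}"
        using ac_has_integral[OF P] xy \<open>x \<le> s\<close> \<open>s \<le> t\<close> \<open>t \<le> y\<close> by auto
      then have "norm (P t - P s) \<le> integral {s..t} (\<lambda>s. norm (f s) + norm (g s))"
        using integral_norm_bound_integral[of p "{s..t}" "\<lambda>s. norm (f s) + norm (g s)"] le
          integrable_subinterval_real[OF h', of s t] \<open>x \<le> s\<close> \<open>s \<le> t\<close> \<open>t \<le> y\<close>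
        by (auto simp: integral_unique)
      also have "\<dots> \<le> N"
        unfolding N_def using \<open>x \<le> s\<close> \<open>s \<le> t\<close> \<open>t \<le> y\<close> h' integrable_subinterval_real[OF h', of s t]
        by (intro integral_subset_le) auto
      finally show ?thesis .
    qed
    show "norm (F t - F s) \<le> N" "norm (G t - G s) \<le> N" using *[OF F] *[OF G] by auto
  qed
  \<comment> \<open>The increment of the product splits exactly as (F y - F x) * G y + F x * (G y -
    G x). Comparison with the claimed density then leaves only an increment times a density in each
    term.\<close>
  have 1: "((\<lambda>s. f s * G y) has_integral ((F y - F x) * G y)) {x..y}"
    using has_integral_mult_left[OF ac_has_integral[OF F xy]] .
  have 2: "((\<lambda>s. F x * g s) has_integral (F x * (G y - G x))) {x..y}"
    using has_integral_mult_right[OF ac_has_integral[OF G xy]] .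
  have fgi: "(\<lambda>s. f s * G s + F s * g s) integrable_on {x..y}"
    using absolutely_integrable_on_subinterval[OF fg, of x y] xy by (auto simp: absolutely_integrable_on_def)
  have 3: "((\<lambda>s. f s * (G y - G s) + (F x - F s) * g s) has_integral
     (F y * G y - F x * G x - integral {x..y} (\<lambda>s. f s * G s + F s * g s))) {x..y}"
    using has_integral_diff[OF has_integral_add[OF 1 2] integrable_integral[OF fgi]]
    by (simp add: algebra_simps)
  have "norm (F y * G y - F x * G x - integral {x..y} (\<lambda>s. f s * G s + F s * g s))
    \<le> integral {x..y} (\<lambda>s. N * (norm (f s) + norm (g s)))"
  proof (rule integral_norm_bound_integral[OF has_integral_integrable[OF 3], unfolded integral_unique[OF 3]])
    show "(\<lambda>s. N * (norm (f s) + norm (g s))) integrable_on {x..y}"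
      using h' by (intro integrable_on_mult_right)
    fix s assume s: "s \<in> {x..y}"
    have "norm (f s * (G y - G s) + (F x - F s) * g s) \<le> norm (f s) * norm (G y - G s) + norm (F s - F x) * norm (g s)"
      using norm_triangle_ineq[of "f s * (G y - G s)" "(F x - F s) * g s"]
      by (simp add: norm_mult norm_minus_commute)
    also have "\<dots> \<le> norm (f s) * N + N * norm (g s)"
      using FN[of s y] FN[of x s] s by (intro add_mono mult_mono) (auto intro: order_trans[OF norm_ge_zero])
    finally show "norm (f s * (G y - G s) + (F x - F s) * g s) \<le> N * (norm (f s) + norm (g s))"
      by (simp add: algebra_simps)
  qed
  also have "\<dots> = 1 * (integral {x..y} (\<lambda>s. norm (f s) + norm (g s)))\<^sup>2"
    by (simp add: N_def power2_eq_square)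
  finally show "norm (F y * G y - F x * G x - integral {x..y} (\<lambda>s. f s * G s + F s * g s))
    \<le> 1 * (integral {x..y} (\<lambda>s. norm (f s) + norm (g s)))\<^sup>2" .
qed (auto)

lemma ac_exp:
  assumes F: "ac R F f"
  shows "ac R (\<lambda>s. exp (F s)) (\<lambda>s. f s * exp (F s))"
proof -
  have f: "f absolutely_integrable_on {0..R}" using F by (auto simp: ac_def)
  have cE: "continuous_on {0..R} (\<lambda>s. exp (F s))"
    using ac_continuous[OF F] by (intro continuous_intros)
  have fE: "(\<lambda>s. f s * exp (F s)) absolutely_integrable_on {0..R}"
    using absolutely_integrable_continuous_mult(2)[OF cE f] .
  have "bounded (F ` {0..R})"
    using ac_continuous[OF F] by (intro compact_imp_bounded compact_continuous_image) auto
  then obtain M where M: "\<And>s. s \<in> {0..R} \<Longrightarrow> cmod (F s) \<le> M"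
    unfolding bounded_iff by blast
  have h: "(\<lambda>s. cmod (f s)) integrable_on {0..R}" using f by (auto simp: absolutely_integrable_on_def)
  show ?thesis
  proof (rule ac_intI[OF fE h])
    fix x y assume xy: "0 \<le> x" "x \<le> y" "y \<le> R"
    define N where "N = integral {x..y} (\<lambda>s. cmod (f s))"
    have hxy: "(\<lambda>s. cmod (f s)) integrable_on {x..y}"
      using integrable_subinterval_real[OF h, of x y] xy by auto
    have FN: "cmod (F t - F x) \<le> N" if "x \<le> t" "t \<le> y" for t
    proof -
      have hxt: "(\<lambda>s. cmod (f s)) integrable_on {x..t}"
        using integrable_subinterval_real[OF hxy, of x t] that by auto
      have I: "(f has_integral (F t - F x)) {x..t}"
        using ac_has_integral[OF F] xy that by auto
      have "cmod (F t - F x) \<le> integral {x..t} (\<lambda>s. cmod (f s))"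
        using integral_norm_bound_integral[OF has_integral_integrable[OF I] hxt] integral_unique[OF I]
        by auto
      also have "\<dots> \<le> N"
        unfolding N_def using that hxy hxt by (intro integral_subset_le) auto
      finally show ?thesis .
    qed
    have FM: "\<bar>Re (F t - F x)\<bar> \<le> 2 * M" "cmod (exp (F x)) \<le> exp M" if "x \<le> t" "t \<le> y" for t
    proof -
      have "\<bar>Re (F t - F x)\<bar> \<le> cmod (F t - F x)" by (rule abs_Re_le_cmod)
      also have "\<dots> \<le> cmod (F t) + cmod (F x)" by (rule norm_triangle_ineq4)
      finally show "\<bar>Re (F t - F x)\<bar> \<le> 2 * M" using M[of t] M[of x] xy that by auto
      show "cmod (exp (F x)) \<le> exp M"
        using M[of x] xy complex_Re_le_cmod[of "F x"] by (auto intro: order_trans)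
    qed
    have fEi: "(\<lambda>s. f s * exp (F s)) integrable_on {x..y}"
      using absolutely_integrable_on_subinterval[OF fE, of x y] xy by (auto simp: absolutely_integrable_on_def)
    have 1: "((\<lambda>s. f s * exp (F x)) has_integral ((F y - F x) * exp (F x))) {x..y}"
      using has_integral_mult_left[OF ac_has_integral[OF F xy]] .
    have 3: "((\<lambda>s. f s * exp (F s) - f s * exp (F x)) has_integral
        (integral {x..y} (\<lambda>s. f s * exp (F s)) - (F y - F x) * exp (F x))) {x..y}"
      using has_integral_diff[OF integrable_integral[OF fEi] 1] .
    have le: "cmod (exp (F t) - exp (F x)) \<le> exp (3 * M) * N" if "x \<le> t" "t \<le> y" for t
    proof -
      have "exp (F t) - exp (F x) = exp (F x) * (exp (F t - F x) - 1)"
        by (simp add: exp_diff algebra_simps)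
      then have "cmod (exp (F t) - exp (F x)) = cmod (exp (F x)) * cmod (exp (F t - F x) - 1)"
        by (simp add: norm_mult)
      also have "\<dots> \<le> exp M * (exp (2 * M) * N)"
      proof (intro mult_mono FM(2))
        have "cmod (exp (F t - F x) - 1) \<le> exp \<bar>Re (F t - F x)\<bar> * cmod (F t - F x)"
          using Taylor_exp[of "F t - F x" 0] by simp
        also have "\<dots> \<le> exp (2 * M) * N"
          using FM(1)[OF that] FN[OF that] by (intro mult_mono) auto
        finally show "cmod (exp (F t - F x) - 1) \<le> exp (2 * M) * N" .
      qed (use that in auto)
      also have "\<dots> = exp (3 * M) * N" by (simp add: exp_add[symmetric])
      finally show ?thesis .
    qed
    have "cmod (integral {x..y} (\<lambda>s. f s * exp (F s)) - (F y - F x) * exp (F x))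
       \<le> integral {x..y} (\<lambda>s. exp (3 * M) * N * cmod (f s))"
    proof (rule integral_norm_bound_integral[OF has_integral_integrable[OF 3], unfolded integral_unique[OF 3]])
      show "(\<lambda>s. exp (3 * M) * N * cmod (f s)) integrable_on {x..y}"
        using hxy by (intro integrable_on_mult_right)
      fix t assume t: "t \<in> {x..y}"
      have "cmod (f t * exp (F t) - f t * exp (F x)) = cmod (f t) * cmod (exp (F t) - exp (F x))"
        by (simp add: norm_mult right_diff_distrib[symmetric])
      then show "cmod (f t * exp (F t) - f t * exp (F x)) \<le> exp (3 * M) * N * cmod (f t)"
        using mult_left_mono[OF le[of t], of "cmod (f t)"] t by (simp add: mult_ac)
    qed
    then have A: "cmod (integral {x..y} (\<lambda>s. f s * exp (F s)) - (F y - F x) * exp (F x)) \<le> exp (3 * M) * N\<^sup>2"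
      by (simp add: N_def power2_eq_square)
    \<comment> \<open>The second of two quadratic errors: \<open>A\<close> came from freezing the
      exponential under the integral, \<open>B\<close> comes from linearising its increment. Their
      sum gives the factor 2 in the final constant.\<close>
    have "exp (F y) - exp (F x) - (F y - F x) * exp (F x) = exp (F x) * (exp (F y - F x) - 1 - (F y - F x))"
      by (simp add: exp_diff algebra_simps)
    then have "cmod (exp (F y) - exp (F x) - (F y - F x) * exp (F x))
        = cmod (exp (F x)) * cmod (exp (F y - F x) - 1 - (F y - F x))"
      by (simp add: norm_mult)
    also have "\<dots> \<le> exp M * (exp (2 * M) * N\<^sup>2)"
    proof (intro mult_mono FM(2))
      have "cmod (exp (F y - F x) - 1 - (F y - F x)) \<le> exp \<bar>Re (F y - F x)\<bar> * (cmod (F y - F x))\<^sup>2"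
        using Taylor_exp[of "F y - F x" 1] by (simp add: power2_eq_square algebra_simps)
      also have "\<dots> \<le> exp (2 * M) * N\<^sup>2"
        using FM(1)[of y] FN[of y] xy by (intro mult_mono power_mono) auto
      finally show "cmod (exp (F y - F x) - 1 - (F y - F x)) \<le> exp (2 * M) * N\<^sup>2" .
    qed (use xy in auto)
    also have "\<dots> = exp (3 * M) * N\<^sup>2" by (simp add: exp_add[symmetric])
    finally have B: "cmod (exp (F y) - exp (F x) - (F y - F x) * exp (F x)) \<le> exp (3 * M) * N\<^sup>2" .
    have "cmod (exp (F y) - exp (F x) - integral {x..y} (\<lambda>s. f s * exp (F s))) \<le>
        cmod (exp (F y) - exp (F x) - (F y - F x) * exp (F x))
        + cmod (integral {x..y} (\<lambda>s. f s * exp (F s)) - (F y - F x) * exp (F x))"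
      by (rule order_trans[OF _ norm_triangle_ineq4]) (simp add: algebra_simps)
    also have "\<dots> \<le> (2 * exp (3 * M)) * N\<^sup>2" using A B by simp
    finally show "cmod (exp (F y) - exp (F x) - integral {x..y} (\<lambda>s. f s * exp (F s)))
      \<le> (2 * exp (3 * M)) * (integral {x..y} (\<lambda>s. cmod (f s)))\<^sup>2" unfolding N_def .
  qed auto
qed

lemma ac_has_integral_Re:
  assumes "ac R F f" "0 \<le> a" "a \<le> b" "b \<le> R"
  shows "((\<lambda>t. Re (f t)) has_integral (Re (F b) - Re (F a))) {a..b}"
  using has_integral_linear[OF ac_has_integral[OF assms] bounded_linear_Re] by (simp add: o_def)

lemma ac_Re_antimono:
  assumes "ac R F f" "0 \<le> a" "a \<le> b" "b \<le> R" "\<And>t. t \<in> {a..b} \<Longrightarrow> Re (f t) \<le> 0"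
  shows "Re (F b) \<le> Re (F a)"
proof -
  have "Re (F b) - Re (F a) \<le> 0"
    using has_integral_le[OF ac_has_integral_Re[OF assms(1-4)] has_integral_0] assms(5) by auto
  then show ?thesis by simp
qed

lemma ac_eq_of_zero:
  assumes "ac R F f" "0 \<le> a" "a \<le> b" "b \<le> R" "\<And>t. t \<in> {a..b} \<Longrightarrow> f t = 0"
  shows "F b = F a"
proof -
  have "(f has_integral 0) {a..b}"
    using assms(5) by (rule has_integral_is_0)
  then have "F b - F a = 0"
    using has_integral_unique[OF ac_has_integral[OF assms(1-4)]] by blast
  then show ?thesis by simp
qed

lemma ac_exp_linear: "ac R (\<lambda>s. exp (c * of_real s)) (\<lambda>s. c * exp (c * of_real s))"
proof (rule ac_of_derivative)
  show "((\<lambda>s. exp (c * complex_of_real s)) has_vector_derivative c * exp (c * complex_of_real s)) (at s within {0..R})" for s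
    by (auto intro!: derivative_eq_intros has_vector_derivative_real_field)
qed (intro continuous_intros)

section \<open>From the Krein system to the Riccati equation\<close>

lemma L2_on_imp_absolutely_integrable:
  assumes "L2_on {a..b} A" shows "A absolutely_integrable_on {a..b}"
proof (rule set_integrable_bound)
  show "set_borel_measurable lebesgue {a..b} A"
    using assms by (auto simp: L2_on_def)
  have "(\<lambda>r. 1 :: real) absolutely_integrable_on {a..b}"
    by (intro absolutely_integrable_continuous_real continuous_intros)
  then show "set_integrable lebesgue {a..b} (\<lambda>r. 1 + (cmod (A r))\<^sup>2)"
    using assms by (auto simp: L2_on_def intro: set_integral_add)
  have "cmod (A x) \<le> 1 + (cmod (A x))\<^sup>2" for x
    using zero_le_power2[of "cmod (A x) - 1"] zero_le_power2[of "cmod (A x)"]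
    by (simp add: power2_diff) (use norm_ge_zero[of "A x"] in linarith)
  then show "AE x in lebesgue. x \<in> {a..b} \<longrightarrow> cmod (A x) \<le> norm (1 + (cmod (A x))\<^sup>2)"
    by (auto simp: abs_of_nonneg add_nonneg_nonneg)
qed

lemma krein_solution_components:
  fixes X :: "real \<Rightarrow> complex^2^2"
  assumes X: "krein_solution A l X" and A: "A absolutely_integrable_on {0..R}" and "0 \<le> R"
  shows "ac R (\<lambda>s. X s $ 1 $ 1) (\<lambda>s. \<i> * l * X s $ 1 $ 1 - cnj (A s) * X s $ 2 $ 1)"
    and "ac R (\<lambda>s. X s $ 1 $ 2) (\<lambda>s. \<i> * l * X s $ 1 $ 2 - cnj (A s) * X s $ 2 $ 2)"
    and "ac R (\<lambda>s. X s $ 2 $ 1) (\<lambda>s. - A s * X s $ 1 $ 1)"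
    and "ac R (\<lambda>s. X s $ 2 $ 2) (\<lambda>s. - A s * X s $ 1 $ 2)"
    and "X 0 = mat 1"
proof -
  have hi: "((\<lambda>s. krein_matrix A l s ** X s) has_integral (X r - mat 1)) {0..r}" if "0 \<le> r" for r
    using X that by (auto simp: krein_solution_def)
  \<comment> \<open>The initial condition is contained in the integrated equation at r = 0, where
    the integral over a degenerate interval vanishes.\<close>
  show X0: "X 0 = mat 1"
    using has_integral_unique[OF hi[of 0, simplified]] has_integral_refl(2) by force
  have comp: "((\<lambda>s. (krein_matrix A l s ** X s) $ i $ j) has_integral (X r $ i $ j - X 0 $ i $ j)) {0..r}"
    if "0 \<le> r" for r i j
    using has_integral_linear[OF hi[OF that], of "\<lambda>M. M $ i $ j"] X0
      bounded_linear_compose[OF bounded_linear_vec_nth[of j] bounded_linear_vec_nth[of i]]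
    by (simp add: o_def)
  have cX: "continuous_on {0..R} (\<lambda>s. X s $ i $ j)" for i j
    using X by (auto simp: krein_solution_def intro!: continuous_intros intro: continuous_on_subset)
  have cA: "(\<lambda>s. cnj (A s)) absolutely_integrable_on {0..R}"
    using absolutely_integrable_linear[OF A bounded_linear_cnj] by (simp add: o_def)
  have m: "(krein_matrix A l s ** X s) $ 1 $ j = \<i> * l * X s $ 1 $ j - cnj (A s) * X s $ 2 $ j"
    "(krein_matrix A l s ** X s) $ 2 $ j = - A s * X s $ 1 $ j" for s j
    by (simp_all add: matrix_matrix_mult_def krein_matrix_def sum_2)
  have i1: "(\<lambda>s. \<i> * l * X s $ 1 $ j - cnj (A s) * X s $ 2 $ j) absolutely_integrable_on {0..R}" for j
    by (intro set_integral_diff absolutely_integrable_continuous_mult cX cA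
        absolutely_integrable_continuous_real continuous_intros)
  have i2: "(\<lambda>s. - A s * X s $ 1 $ j) absolutely_integrable_on {0..R}" for j
    using absolutely_integrable_continuous_mult(2)[OF cX[of 1 j] A]
      set_integrable_mult_right[of "-1" lebesgue "{0..R}" "\<lambda>s. A s * X s $ 1 $ j"] by (simp add: mult_ac)
  show "ac R (\<lambda>s. X s $ 1 $ 1) (\<lambda>s. \<i> * l * X s $ 1 $ 1 - cnj (A s) * X s $ 2 $ 1)"
    and "ac R (\<lambda>s. X s $ 1 $ 2) (\<lambda>s. \<i> * l * X s $ 1 $ 2 - cnj (A s) * X s $ 2 $ 2)"
    and "ac R (\<lambda>s. X s $ 2 $ 1) (\<lambda>s. - A s * X s $ 1 $ 1)"
    and "ac R (\<lambda>s. X s $ 2 $ 2) (\<lambda>s. - A s * X s $ 1 $ 2)"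
    using comp[of _ 1 1] comp[of _ 1 2] comp[of _ 2 1] comp[of _ 2 2] i1 i2 by (auto simp: ac_def m)
qed

text \<open>The bound by 1 is built in because it dominates every later integrand. The terminal
  condition \<open>u R = 0\<close> is kept outside: it is lost under restriction to a shorter
  interval and in the limit of ever longer truncations.\<close>

definition riccati :: "(real \<Rightarrow> complex) \<Rightarrow> complex \<Rightarrow> real \<Rightarrow> (real \<Rightarrow> complex) \<Rightarrow> bool" where
  "riccati A l R u \<longleftrightarrow> ac R u (\<lambda>s. - \<i> * l * u s + A s - cnj (A s) * (u s)\<^sup>2) \<and>
     (\<forall>s\<in>{0..R}. cmod (u s) \<le> 1)"

text \<open>Here \<open>(w1, w2)\<close> is the second row of \<open>X(R) X(s)\<^sup>-\<^sup>1\<close>: it is \<open>(0, 1)\<close> at \<open>R\<close> and the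
  second row of \<open>X(R)\<close> at \<open>0\<close>.\<close>

lemma riccati_of_krein_solution:
  fixes X :: "real \<Rightarrow> complex^2^2"
  assumes X: "krein_solution A l X" and A: "A absolutely_integrable_on {0..R}"
    and R: "0 \<le> R" and l: "0 < Im l"
  obtains u where "riccati A l R u" "u R = 0" "u 0 = X R $ 2 $ 1 * inverse (X R $ 2 $ 2)"
proof -
  define a b c d where "a = (\<lambda>s. X s $ 1 $ 1)" and "b = (\<lambda>s. X s $ 1 $ 2)"
    and "c = (\<lambda>s. X s $ 2 $ 1)" and "d = (\<lambda>s. X s $ 2 $ 2)"
  note defs = a_def b_def c_def d_def
  have ac_a: "ac R a (\<lambda>s. \<i> * l * a s - cnj (A s) * c s)"
    and ac_b: "ac R b (\<lambda>s. \<i> * l * b s - cnj (A s) * d s)"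
    and ac_c: "ac R c (\<lambda>s. - A s * a s)" and ac_d: "ac R d (\<lambda>s. - A s * b s)"
    and X0: "X 0 = mat 1"
    using krein_solution_components[OF X A R] by (auto simp: defs)
  have init: "a 0 = 1" "b 0 = 0" "c 0 = 0" "d 0 = 1" by (simp_all add: defs X0 mat_def)
  \<comment> \<open>The determinant of X(s) is exp (i l s) by Liouville's formula, so
    \<open>E\<close> is its reciprocal, and the adjugate turns the second row of X(R) X(s)^-1 into
    \<open>w1\<close> and \<open>w2\<close>.\<close>
  define E where "E = (\<lambda>s. exp (- \<i> * l * complex_of_real s))"
  have ac_E: "ac R E (\<lambda>s. - \<i> * l * E s)" unfolding E_def by (rule ac_exp_linear)
  define w1 w2 where "w1 = (\<lambda>s. E s * (c R * d s - d R * c s))" and "w2 = (\<lambda>s. E s * (d R * a s - c R * b s))"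
  have ac1: "ac R w1 (\<lambda>s. - \<i> * l * w1 s + A s * w2 s)"
    by (rule ac_cong[OF ac_mult[OF ac_E ac_diff[OF ac_cmult[OF ac_d, of "c R"] ac_cmult[OF ac_c, of "d R"]]]])
      (simp_all add: w1_def w2_def algebra_simps)
  have ac2: "ac R w2 (\<lambda>s. cnj (A s) * w1 s)"
    by (rule ac_cong[OF ac_mult[OF ac_E ac_diff[OF ac_cmult[OF ac_a, of "d R"] ac_cmult[OF ac_b, of "c R"]]]])
      (simp_all add: w1_def w2_def algebra_simps)
  \<comment> \<open>Liouville's formula: this product is constant, equal to 1 at s = 0, and at s = R
    it is \<open>w2 R\<close>.\<close>
  have "ac R (\<lambda>s. E s * (a s * d s - b s * c s)) (\<lambda>s. 0)"
    by (rule ac_cong[OF ac_mult[OF ac_E ac_diff[OF ac_mult[OF ac_a ac_d] ac_mult[OF ac_b ac_c]]]])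
      (simp_all add: algebra_simps)
  from ac_eq_of_zero[OF this, of 0 R] R have w2R: "w2 R = 1"
    by (simp add: init w2_def algebra_simps) (simp add: E_def)
  have w1R: "w1 R = 0" by (simp add: w1_def)
  \<comment> \<open>The indefinite form |w2|^2 - |w1|^2 decreases at the rate 2 Im l |w1|^2 and
    equals 1 at \<open>R\<close>, so it is at least 1 before. This yields both that
    \<open>w2\<close> has no zero and that the quotient is bounded by 1.\<close>
  have acN: "ac R (\<lambda>s. w2 s * cnj (w2 s) - w1 s * cnj (w1 s)) (\<lambda>s. - 2 * of_real (Im l) * (w1 s * cnj (w1 s)))"
    by (rule ac_cong[OF ac_diff[OF ac_mult[OF ac2 ac_cnj[OF ac2]] ac_mult[OF ac1 ac_cnj[OF ac1]]]])
      (simp_all add: algebra_simps complex_eq_iff)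
  have N: "(cmod (w2 s))\<^sup>2 - (cmod (w1 s))\<^sup>2 \<ge> 1" if s: "s \<in> {0..R}" for s
  proof -
    have "Re (w2 R * cnj (w2 R) - w1 R * cnj (w1 R)) \<le> Re (w2 s * cnj (w2 s) - w1 s * cnj (w1 s))"
      by (rule ac_Re_antimono[OF acN]) (use s l in \<open>auto simp: complex_mult_cnj intro!: mult_nonneg_nonneg\<close>)
    then show ?thesis by (simp add: w1R w2R complex_mult_cnj cmod_power2)
  qed
  have w20: "w2 s \<noteq> 0" if "s \<in> {0..R}" for s
    using N[OF that] zero_le_power2[of "cmod (w1 s)"] by force
  define u where "u = (\<lambda>s. w1 s / w2 s)"
  have u1: "cmod (u s) \<le> 1" if s: "s \<in> {0..R}" for s
  proof -
    have "(cmod (w1 s))\<^sup>2 \<le> (cmod (w2 s))\<^sup>2" using N[OF s] by linarith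
    then have "cmod (w1 s) \<le> cmod (w2 s)" using power2_le_imp_le norm_ge_zero by blast
    then show ?thesis using w20[OF s] by (simp add: u_def norm_divide divide_simps)
  qed
  have cA: "(\<lambda>s. cnj (A s)) absolutely_integrable_on {0..R}"
    using absolutely_integrable_linear[OF A bounded_linear_cnj] by (simp add: o_def)
  have "continuous_on {0..R} u"
    unfolding u_def using w20 ac_continuous[OF ac1] ac_continuous[OF ac2] by (intro continuous_intros) auto
  from ac_indefinite_integral[OF absolutely_integrable_continuous_mult(2)[OF this cA]]
  have acL: "ac R (\<lambda>s. integral {0..s} (\<lambda>s. cnj (A s) * u s)) (\<lambda>s. cnj (A s) * u s)" .
  \<comment> \<open>Division by \<open>w2\<close> is traded for an exponential: w2' = conj(A) u w2,
    so \<open>G\<close> times \<open>w2\<close> is constant and u is a constant multiple of w1 * G,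
    to which the product rule applies.\<close>
  define G where "G = (\<lambda>s. exp (- integral {0..s} (\<lambda>s. cnj (A s) * u s)))"
  have acG: "ac R G (\<lambda>s. - (cnj (A s) * u s) * G s)"
    unfolding G_def using ac_exp[OF ac_minus[OF acL]] by simp
  have "ac R (\<lambda>s. G s * w2 s) (\<lambda>s. 0)"
    by (rule ac_cong[OF ac_mult[OF acG ac2]]) (simp_all add: u_def w20)
  from ac_eq_of_zero[OF this, of 0] have G: "G s * w2 s = w2 0" if "s \<in> {0..R}" for s
    using that by (simp add: G_def)
  have uG: "u s = 1 / w2 0 * (w1 s * G s)" if "s \<in> {0..R}" for s
    using G[OF that] w20[OF that] w20[of 0] R by (simp add: u_def divide_simps)
  have G': "G s / w2 0 = 1 / w2 s" if "s \<in> {0..R}" for s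
    using G[OF that] w20[OF that] w20[of 0] R by (simp add: divide_simps)
  have "ac R u (\<lambda>s. - \<i> * l * u s + A s - cnj (A s) * (u s)\<^sup>2)"
  proof (rule ac_cong[OF ac_cmult[OF ac_mult[OF ac1 acG], of "1 / w2 0"]])
    fix s assume s: "s \<in> {0..R}"
    show "1 / w2 0 * (w1 s * G s) = u s" using uG[OF s] by simp
    have "1 / w2 0 * ((- \<i> * l * w1 s + A s * w2 s) * G s + w1 s * (- (cnj (A s) * u s) * G s))
      = (G s / w2 0) * (- \<i> * l * w1 s + A s * w2 s - w1 s * (cnj (A s) * u s))"
      by (simp add: algebra_simps)
    also have "\<dots> = - \<i> * l * u s + A s - cnj (A s) * (u s)\<^sup>2"
      unfolding G'[OF s] using w20[OF s] by (simp add: u_def field_simps power2_eq_square)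
    finally show "1 / w2 0 * ((- \<i> * l * w1 s + A s * w2 s) * G s + w1 s * (- (cnj (A s) * u s) * G s))
      = - \<i> * l * u s + A s - cnj (A s) * (u s)\<^sup>2" .
  qed
  moreover have "u R = 0" by (simp add: u_def w1R)
  moreover have "u 0 = X R $ 2 $ 1 * inverse (X R $ 2 $ 2)"
    by (simp add: u_def w1_def w2_def init) (simp add: E_def c_def d_def divide_inverse)
  ultimately show ?thesis using that u1 unfolding riccati_def by blast
qed

section \<open>Riccati solutions: energy identity and dependence on the spectral parameter\<close>

abbreviation L1_mass :: "(real \<Rightarrow> complex) \<Rightarrow> real \<Rightarrow> real" where
  "L1_mass A r \<equiv> integral {0..r} (\<lambda>s. cmod (A s))"

abbreviation L2_mass :: "(real \<Rightarrow> complex) \<Rightarrow> real \<Rightarrow> real" where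
  "L2_mass A r \<equiv> integral {0..r} (\<lambda>s. (cmod (A s))\<^sup>2)"

text \<open>For the \<open>u\<close> coming from a Krein solution the exponential of this function
  is w2(r) / w2(0), with w2 the denominator of \<open>u\<close>. At r = R it is the reciprocal of
  the lower right entry of X(R).\<close>

definition riccati_log :: "(real \<Rightarrow> complex) \<Rightarrow> (real \<Rightarrow> complex) \<Rightarrow> real \<Rightarrow> complex" where
  "riccati_log A u r = integral {0..r} (\<lambda>s. cnj (A s) * u s)"

lemma absolutely_integrable_cnj:
  fixes A :: "real \<Rightarrow> complex"
  shows "A absolutely_integrable_on S \<Longrightarrow> (\<lambda>s. cnj (A s)) absolutely_integrable_on S"
  using absolutely_integrable_linear[OF _ bounded_linear_cnj] by (simp add: o_def)

lemma riccati_subinterval: "riccati A l R u \<Longrightarrow> 0 \<le> r \<Longrightarrow> r \<le> R \<Longrightarrow> riccati A l r u"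
  by (auto simp: riccati_def intro: ac_subinterval)

lemma riccati_log_ac:
  assumes "riccati A l R u" "A absolutely_integrable_on {0..R}"
  shows "ac R (riccati_log A u) (\<lambda>s. cnj (A s) * u s)"
  unfolding riccati_log_def
  using assms by (intro ac_indefinite_integral absolutely_integrable_continuous_mult(2)
      absolutely_integrable_cnj) (auto simp: riccati_def intro: ac_continuous)

lemma riccati_log_bound:
  assumes u: "riccati A l R u" and A: "A absolutely_integrable_on {0..R}" and s: "s \<in> {0..R}"
  shows "cmod (riccati_log A u s) \<le> L1_mass A R"
proof -
  have nA: "(\<lambda>t. cmod (A t)) integrable_on {0..R}"
    using A by (auto simp: absolutely_integrable_on_def)
  have nAs: "(\<lambda>t. cmod (A t)) integrable_on {0..s}"
    using integrable_subinterval_real[OF nA, of 0 s] s by auto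
  have "(\<lambda>t. cnj (A t) * u t) integrable_on {0..s}"
    using ac_integrand_integrable[OF riccati_log_ac[OF u A], of 0 s] s by (auto simp: absolutely_integrable_on_def)
  then have "cmod (riccati_log A u s) \<le> L1_mass A s"
    unfolding riccati_log_def
  proof (rule integral_norm_bound_integral[OF _ nAs])
    fix t assume "t \<in> {0..s}"
    then have "cmod (u t) \<le> 1" using u s by (auto simp: riccati_def)
    then show "cmod (cnj (A t) * u t) \<le> cmod (A t)"
      by (simp add: norm_mult mult_left_le)
  qed
  also have "\<dots> \<le> L1_mass A R"
    using s nA nAs by (intro integral_subset_le) auto
  finally show ?thesis .
qed

lemma riccati_square_ac:
  assumes "riccati A l R u"
  shows "ac R (\<lambda>s. u s * cnj (u s))
    (\<lambda>s. of_real (2 * Im l * (cmod (u s))\<^sup>2 + 2 * Re (cnj (u s) * A s) * (1 - (cmod (u s))\<^sup>2)))"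
proof -
  have u: "ac R u (\<lambda>s. - \<i> * l * u s + A s - cnj (A s) * (u s)\<^sup>2)" using assms by (simp add: riccati_def)
  show ?thesis
  proof (rule ac_cong[OF ac_mult[OF u ac_cnj[OF u]]])
    show "(- \<i> * l * u s + A s - cnj (A s) * (u s)\<^sup>2) * cnj (u s)
        + u s * cnj (- \<i> * l * u s + A s - cnj (A s) * (u s)\<^sup>2)
      = of_real (2 * Im l * (cmod (u s))\<^sup>2 + 2 * Re (cnj (u s) * A s) * (1 - (cmod (u s))\<^sup>2))" for s
      unfolding cmod_power2 by (simp add: complex_eq_iff power2_eq_square algebra_simps)
  qed simp
qed

text \<open>The quantity \<open>D\<close> of the energy identity decreases, at a rate of at most 2
  Im l exp (2 N); these two facts are the two inequalities. The first is applied to truncated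
  solutions, where \<open>u R = 0\<close>. The second has an error of order Im l for fixed
  \<open>R\<close> and serves \<open>l\<close> tending to the real line.\<close>

lemma riccati_energy:
  assumes u: "riccati A l R u" and A: "A absolutely_integrable_on {0..R}" and R: "0 \<le> R" and l: "0 < Im l"
  defines "N \<equiv> L1_mass A R"
  shows "exp (2 * Re (riccati_log A u R)) * (1 - (cmod (u R))\<^sup>2) \<le> 1 - (cmod (u 0))\<^sup>2"
    and "1 - (cmod (u 0))\<^sup>2 - 2 * Im l * R * exp (2 * N) \<le> exp (2 * Re (riccati_log A u R))"
proof -
  define G where "G = (\<lambda>s. exp (riccati_log A u s))"
  \<comment> \<open>The weight is exp (2 Re L). Its logarithmic derivative 2 Re (conj(A) u) cancels
    the term without a sign in the derivative of 1 - |u|^2.\<close>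
  define D where "D = (\<lambda>s. (1 - u s * cnj (u s)) * (G s * cnj (G s)))"
  have acG: "ac R G (\<lambda>s. cnj (A s) * u s * G s)"
    unfolding G_def by (rule ac_exp[OF riccati_log_ac[OF u A]])
  have acD: "ac R D (\<lambda>s. - of_real (2 * Im l * ((cmod (u s))\<^sup>2 * (cmod (G s))\<^sup>2)))"
    unfolding D_def
  proof (rule ac_cong[OF ac_mult[OF ac_diff[OF ac_const[of R 1] riccati_square_ac[OF u]] ac_mult[OF acG ac_cnj[OF acG]]]])
    show "(0 - of_real (2 * Im l * (cmod (u s))\<^sup>2 + 2 * Re (cnj (u s) * A s) * (1 - (cmod (u s))\<^sup>2))) * (G s * cnj (G s)) +
        (1 - u s * cnj (u s)) * (cnj (A s) * u s * G s * cnj (G s) + G s * cnj (cnj (A s) * u s * G s))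
      = - of_real (2 * Im l * ((cmod (u s))\<^sup>2 * (cmod (G s))\<^sup>2))" for s
      unfolding cmod_power2 by (simp add: complex_eq_iff power2_eq_square algebra_simps)
  qed simp
  have G: "(cmod (G s))\<^sup>2 = exp (2 * Re (riccati_log A u s))" for s
    by (simp add: G_def power2_eq_square exp_add[symmetric])
  have ReD: "Re (D s) = (1 - (cmod (u s))\<^sup>2) * exp (2 * Re (riccati_log A u s))" for s
  proof -
    have "D s = of_real ((1 - (cmod (u s))\<^sup>2) * (cmod (G s))\<^sup>2)"
      by (simp add: D_def complex_norm_square del: of_real_power)
    then show ?thesis by (simp only: Re_complex_of_real G)
  qed
  have log0: "riccati_log A u 0 = 0" by (simp add: riccati_log_def)
  have "Re (D R) \<le> Re (D 0)"
    using l by (intro ac_Re_antimono[OF acD]) (use R in \<open>auto intro!: mult_nonneg_nonneg\<close>)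
  then show "exp (2 * Re (riccati_log A u R)) * (1 - (cmod (u R))\<^sup>2) \<le> 1 - (cmod (u 0))\<^sup>2"
    by (simp add: ReD log0 mult.commute)
  have "Re (D R) - Re (D 0) \<ge> - (2 * Im l * exp (2 * N)) * (R - 0)"
  proof (rule has_integral_le[OF _ ac_has_integral_Re[OF acD order_refl R order_refl]])
    show "((\<lambda>_. - (2 * Im l * exp (2 * N))) has_integral - (2 * Im l * exp (2 * N)) * (R - 0)) {0..R}"
      using has_integral_const_real[of "- (2 * Im l * exp (2 * N))" 0 R] R by (simp add: mult.commute)
    fix s assume s: "s \<in> {0..R}"
    have "Re (riccati_log A u s) \<le> N"
      using riccati_log_bound[OF u A s] complex_Re_le_cmod[of "riccati_log A u s"] by (simp add: N_def)
    then have "(cmod (G s))\<^sup>2 \<le> exp (2 * N)" by (simp add: G)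
    moreover have "(cmod (u s))\<^sup>2 \<le> 1" using u s by (simp add: riccati_def power_le_one)
    ultimately have "(cmod (u s))\<^sup>2 * (cmod (G s))\<^sup>2 \<le> 1 * exp (2 * N)" by (intro mult_mono) auto
    then show "- (2 * Im l * exp (2 * N)) \<le> Re (- of_real (2 * Im l * ((cmod (u s))\<^sup>2 * (cmod (G s))\<^sup>2)))"
      using l by simp
  qed
  moreover have "Re (D R) \<le> exp (2 * Re (riccati_log A u R))"
    by (simp add: ReD algebra_simps)
  moreover have "Re (D 0) = 1 - (cmod (u 0))\<^sup>2" by (simp add: ReD log0)
  ultimately show "1 - (cmod (u 0))\<^sup>2 - 2 * Im l * R * exp (2 * N) \<le> exp (2 * Re (riccati_log A u R))"
    by (simp add: algebra_simps)
qed

text \<open>The difference solves a homogeneous linear equation with coefficient - (i l + conj(A) (u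
  + v)), and \<open>K\<close> is the integrating exponent. Convergence of the truncated solutions is
  known only at 0; this carries it over to bounded intervals.\<close>

lemma riccati_diff_bound:
  assumes u: "riccati A l R u" and v: "riccati A l R v" and A: "A absolutely_integrable_on {0..R}"
    and s: "s \<in> {0..R}"
  shows "cmod (u s - v s) \<le> cmod (u 0 - v 0) * exp (Im l * s + 2 * L1_mass A R)"
proof -
  define K where "K = (\<lambda>s. \<i> * l * of_real s + (riccati_log A u s + riccati_log A v s))"
  have "ac R (\<lambda>s. \<i> * l * of_real s) (\<lambda>s. \<i> * l)"
    by (rule ac_of_derivative) (auto intro!: derivative_eq_intros has_vector_derivative_real_field continuous_intros)
  then have acK: "ac R K (\<lambda>s. \<i> * l + (cnj (A s) * u s + cnj (A s) * v s))"
    unfolding K_def by (intro ac_add riccati_log_ac[OF u A] riccati_log_ac[OF v A])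
  have acu: "ac R u (\<lambda>s. - \<i> * l * u s + A s - cnj (A s) * (u s)\<^sup>2)"
    and acv: "ac R v (\<lambda>s. - \<i> * l * v s + A s - cnj (A s) * (v s)\<^sup>2)" using u v by (auto simp: riccati_def)
  have "ac R (\<lambda>s. (u s - v s) * exp (K s)) (\<lambda>s. 0)"
    by (rule ac_cong[OF ac_mult[OF ac_diff[OF acu acv] ac_exp[OF acK]]])
      (simp_all add: algebra_simps power2_eq_square)
  from ac_eq_of_zero[OF this, of 0 s] s have "(u s - v s) * exp (K s) = u 0 - v 0"
    by (simp add: K_def riccati_log_def)
  then have "u s - v s = (u 0 - v 0) * exp (- K s)"
    by (simp add: exp_minus field_simps)
  then have "cmod (u s - v s) = cmod (u 0 - v 0) * exp (Re (- K s))"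
    by (simp add: norm_mult)
  also have "Re (- K s) \<le> Im l * s + 2 * L1_mass A R"
    using riccati_log_bound[OF u A s] riccati_log_bound[OF v A s]
      abs_Re_le_cmod[of "riccati_log A u s"] abs_Re_le_cmod[of "riccati_log A v s"]
    by (simp add: K_def)
  finally show ?thesis by (simp add: mult_left_mono)
qed

text \<open>Linear equations \<open>z' = - (i l + conj A (u + v)) z + g\<close> with \<open>z(R) = 0\<close>: the integrating factor
  is bounded above and below because \<open>|u|, |v| \<le> 1\<close>.\<close>

lemma linearized_riccati_bound:
  assumes u: "riccati A l R u" and v: "riccati A m R v" and A: "A absolutely_integrable_on {0..R}"
    and l: "0 \<le> Im l" and s: "s \<in> {0..R}" and zR: "z R = 0"
    and z: "ac R z (\<lambda>s. - (\<i> * l + cnj (A s) * (u s + v s)) * z s + g s)"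
    and g: "\<And>t. t \<in> {0..R} \<Longrightarrow> cmod (g t) \<le> \<gamma> t" and \<gamma>: "\<gamma> integrable_on {0..R}"
  shows "cmod (z s) \<le> exp (4 * L1_mass A R) * integral {0..R} \<gamma>"
proof -
  define N where "N = L1_mass A R"
  define K where "K = (\<lambda>s. \<i> * l * of_real s + (riccati_log A u s + riccati_log A v s))"
  have "ac R (\<lambda>s. \<i> * l * of_real s) (\<lambda>s. \<i> * l)"
    by (rule ac_of_derivative) (auto intro!: derivative_eq_intros has_vector_derivative_real_field continuous_intros)
  then have acK: "ac R K (\<lambda>s. \<i> * l + (cnj (A s) * u s + cnj (A s) * v s))"
    unfolding K_def by (intro ac_add riccati_log_ac[OF u A] riccati_log_ac[OF v A])
  have zE: "ac R (\<lambda>s. z s * exp (K s)) (\<lambda>s. g s * exp (K s))"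
    by (rule ac_cong[OF ac_mult[OF z ac_exp[OF acK]]]) (simp_all add: algebra_simps)
  have I: "((\<lambda>t. g t * exp (K t)) has_integral (- (z s * exp (K s)))) {s..R}"
    using ac_has_integral[OF zE, of s R] s zR by simp
  have \<gamma>s: "\<gamma> integrable_on {s..R}" using integrable_subinterval_real[OF \<gamma>, of s R] s by auto
  have "cmod (- (z s * exp (K s)) ) \<le> integral {s..R} (\<lambda>t. exp (Re (K s) + 4 * N) * \<gamma> t)"
    unfolding integral_unique[OF I, symmetric]
  proof (rule integral_norm_bound_integral[OF has_integral_integrable[OF I]])
    show "(\<lambda>t. exp (Re (K s) + 4 * N) * \<gamma> t) integrable_on {s..R}" using \<gamma>s by (intro integrable_on_mult_right)
    fix t assume t: "t \<in> {s..R}"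
    then have t0: "t \<in> {0..R}" using s by auto
    \<comment> \<open>Since s is at most t and Im l is nonnegative, the exponential factor only
      decreases. What remains are two logarithms at s and two at t, each bounded by
      \<open>N\<close>.\<close>
    have "Re (K t) \<le> Re (K s) + 4 * N"
    proof -
      have "\<bar>Re (riccati_log A u x)\<bar> \<le> N" "\<bar>Re (riccati_log A v x)\<bar> \<le> N" if "x \<in> {0..R}" for x
        using riccati_log_bound[OF u A that] riccati_log_bound[OF v A that]
          abs_Re_le_cmod[of "riccati_log A u x"] abs_Re_le_cmod[of "riccati_log A v x"] by (auto simp: N_def)
      from this[OF s] this[OF t0] mult_left_mono[of s t "Im l"] l t show ?thesis
        by (simp add: K_def)
    qed
    then have "cmod (g t) * exp (Re (K t)) \<le> \<gamma> t * exp (Re (K s) + 4 * N)"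
      using g[OF t0] by (intro mult_mono) (auto intro: order_trans[OF norm_ge_zero])
    then show "cmod (g t * exp (K t)) \<le> exp (Re (K s) + 4 * N) * \<gamma> t"
      by (simp add: norm_mult mult.commute)
  qed
  also have "\<dots> = exp (Re (K s)) * (exp (4 * N) * integral {s..R} \<gamma>)"
    by (simp add: exp_add)
  finally have "cmod (z s) \<le> exp (4 * N) * integral {s..R} \<gamma>"
    by (simp add: norm_mult mult.commute)
  also have "\<dots> \<le> exp (4 * N) * integral {0..R} \<gamma>"
    using s \<gamma> \<gamma>s order_trans[OF norm_ge_zero g]
    by (intro mult_left_mono integral_subset_le) auto
  finally show ?thesis unfolding N_def .
qed

text \<open>\<open>p\<close> is the derivative of the solution in the spectral parameter at
  \<open>m\<close>. The remainder again satisfies a linear equation with zero terminal value, whose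
  source is quadratic in l - m. The bound is uniform in s, so it can later be integrated against
  conj(A).\<close>

lemma riccati_parameter_derivative:
  assumes v: "riccati A m R v" and vR: "v R = 0" and A: "A absolutely_integrable_on {0..R}"
    and R: "0 \<le> R" and m: "0 < Im m"
  obtains p C where "continuous_on {0..R} p"
    and "\<And>l u s. riccati A l R u \<Longrightarrow> u R = 0 \<Longrightarrow> 0 < Im l \<Longrightarrow> s \<in> {0..R} \<Longrightarrow>
      cmod (u s - v s - (l - m) * p s) \<le> C * (cmod (l - m))\<^sup>2"
proof -
  define N where "N = L1_mass A R"
  have N: "(\<lambda>t. cmod (A t)) integrable_on {0..R}" using A by (auto simp: absolutely_integrable_on_def)
  have acv: "ac R v (\<lambda>s. - \<i> * m * v s + A s - cnj (A s) * (v s)\<^sup>2)" using v by (auto simp: riccati_def)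
  define K where "K = (\<lambda>s. \<i> * m * of_real s + (riccati_log A v s + riccati_log A v s))"
  have "ac R (\<lambda>s. \<i> * m * of_real s) (\<lambda>s. \<i> * m)"
    by (rule ac_of_derivative) (auto intro!: derivative_eq_intros has_vector_derivative_real_field continuous_intros)
  then have acK: "ac R K (\<lambda>s. \<i> * m + (cnj (A s) * v s + cnj (A s) * v s))"
    unfolding K_def by (intro ac_add riccati_log_ac[OF v A])
  have "continuous_on {0..R} (\<lambda>s. v s * exp (K s))"
    using ac_continuous[OF acv] ac_continuous[OF acK] by (intro continuous_intros)
  then have acI: "ac R (\<lambda>s. integral {0..s} (\<lambda>s. v s * exp (K s))) (\<lambda>s. v s * exp (K s))"
    by (intro ac_indefinite_integral absolutely_integrable_continuous_real)
  define J where "J = (\<lambda>s. integral {0..s} (\<lambda>s. v s * exp (K s)))"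
  \<comment> \<open>Variation of constants for the equation linearised at \<open>v\<close>, with
    source - i v and the value 0 at \<open>R\<close>.\<close>
  define p where "p = (\<lambda>s. \<i> * (J R - J s) * exp (- K s))"
  have acp: "ac R p (\<lambda>s. - (\<i> * m + cnj (A s) * (v s + v s)) * p s + (- \<i> * v s))"
    unfolding p_def
    by (rule ac_cong[OF ac_mult[OF ac_cmult[OF ac_diff[OF ac_const[of R "J R"] acI[folded J_def]], of \<i>] ac_exp[OF ac_minus[OF acK]]]])
      (simp_all add: algebra_simps exp_minus field_simps)
  have pR: "p R = 0" by (simp add: p_def)
  have v1: "cmod (v t) \<le> 1" if "t \<in> {0..R}" for t using v that by (auto simp: riccati_def)
  have P: "cmod (p s) \<le> exp (4 * N) * R" if "s \<in> {0..R}" for s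
    using linearized_riccati_bound[OF v v A _ that pR acp, of "\<lambda>_. 1"] v1 m R
    by (simp add: N_def norm_mult integrable_on_const)
  define C where "C = exp (4 * N) * integral {0..R} (\<lambda>t. exp (4 * N) * R * (1 + exp (4 * N) * R * cmod (A t)))"
  show ?thesis
  proof (rule that)
    show "continuous_on {0..R} p" using ac_continuous[OF acp] .
    fix l u s assume u: "riccati A l R u" and uR: "u R = 0" and l: "0 < Im l" and s: "s \<in> {0..R}"
    have acu: "ac R u (\<lambda>s. - \<i> * l * u s + A s - cnj (A s) * (u s)\<^sup>2)" using u by (auto simp: riccati_def)
    have acd: "ac R (\<lambda>s. u s - v s) (\<lambda>s. - (\<i> * l + cnj (A s) * (u s + v s)) * (u s - v s) + (- \<i> * (l - m) * v s))"
      by (rule ac_cong[OF ac_diff[OF acu acv]]) (simp_all add: algebra_simps power2_eq_square)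
    have d: "cmod (u t - v t) \<le> cmod (l - m) * (exp (4 * N) * R)" if t: "t \<in> {0..R}" for t
    proof -
      have "cmod (u t - v t) \<le> exp (4 * N) * integral {0..R} (\<lambda>_. cmod (l - m))"
        unfolding N_def
        by (rule linearized_riccati_bound[OF u v A _ t _ acd])
          (use l uR vR v1 in \<open>auto simp: norm_mult intro: mult_left_le\<close>)
      then show ?thesis using R by (simp add: mult_ac)
    qed
    \<comment> \<open>The contributions of first order in l - m cancel. The remaining source has the
      factor l - m once explicitly and once more through l - m itself or through u - v, which
      \<open>d\<close> bounds by a multiple of |l - m|.\<close>
    have ace: "ac R (\<lambda>s. u s - v s - (l - m) * p s)
      (\<lambda>s. - (\<i> * l + cnj (A s) * (u s + v s)) * (u s - v s - (l - m) * p s)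
         + (- (l - m) * p s * (\<i> * (l - m) + cnj (A s) * (u s - v s))))"
      by (rule ac_cong[OF ac_diff[OF acd ac_cmult[OF acp, of "l - m"]]]) (simp_all add: algebra_simps)
    have "cmod (u s - v s - (l - m) * p s) \<le> exp (4 * N) * integral {0..R}
       (\<lambda>t. (cmod (l - m))\<^sup>2 * (exp (4 * N) * R * (1 + exp (4 * N) * R * cmod (A t))))"
      unfolding N_def
    proof (rule linearized_riccati_bound[OF u v A _ s _ ace], unfold N_def[symmetric])
      show "0 \<le> Im l" "u R - v R - (l - m) * p R = 0" using l uR vR pR by auto
      show "(\<lambda>t. (cmod (l - m))\<^sup>2 * (exp (4 * N) * R * (1 + exp (4 * N) * R * cmod (A t)))) integrable_on {0..R}"
        using N by (intro integrable_on_mult_right integrable_add) auto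
      fix t assume t: "t \<in> {0..R}"
      have "cmod (\<i> * (l - m) + cnj (A t) * (u t - v t)) \<le> cmod (l - m) + cmod (A t) * (cmod (l - m) * (exp (4 * N) * R))"
        using mult_left_mono[OF d[OF t], of "cmod (A t)"]
        by (intro order_trans[OF norm_triangle_ineq]) (simp add: norm_mult)
      then have "cmod (p t) * cmod (\<i> * (l - m) + cnj (A t) * (u t - v t)) \<le>
          (exp (4 * N) * R) * (cmod (l - m) + cmod (A t) * (cmod (l - m) * (exp (4 * N) * R)))"
        using P[OF t] R by (intro mult_mono) auto
      then have "cmod (l - m) * (cmod (p t) * cmod (\<i> * (l - m) + cnj (A t) * (u t - v t))) \<le>
          cmod (l - m) * ((exp (4 * N) * R) * (cmod (l - m) + cmod (A t) * (cmod (l - m) * (exp (4 * N) * R))))"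
        by (intro mult_left_mono) auto
      also have "\<dots> = (cmod (l - m))\<^sup>2 * (exp (4 * N) * R * (1 + exp (4 * N) * R * cmod (A t)))"
        by (simp add: power2_eq_square algebra_simps)
      finally show "cmod (- (l - m) * p t * (\<i> * (l - m) + cnj (A t) * (u t - v t)))
        \<le> (cmod (l - m))\<^sup>2 * (exp (4 * N) * R * (1 + exp (4 * N) * R * cmod (A t)))"
        unfolding norm_mult norm_minus_cancel by (simp only: mult.assoc)
    qed
    also have "\<dots> = C * (cmod (l - m))\<^sup>2"
      by (simp add: C_def)
    finally show "cmod (u s - v s - (l - m) * p s) \<le> C * (cmod (l - m))\<^sup>2" .
  qed
qed

lemma has_field_derivative_quadratic_error:
  fixes F :: "complex \<Rightarrow> complex"
  assumes "open S" "m \<in> S" "\<And>l. l \<in> S \<Longrightarrow> cmod (F l - F m - (l - m) * q) \<le> C * (cmod (l - m))\<^sup>2"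
  shows "(F has_field_derivative q) (at m)"
proof -
  have "((\<lambda>l. (F l - F m) / (l - m) - q) \<longlongrightarrow> 0) (at m)"
  proof (rule Lim_null_comparison)
    show "\<forall>\<^sub>F l in at m. norm ((F l - F m) / (l - m) - q) \<le> C * cmod (l - m)"
    proof (rule eventually_mono)
      show "\<forall>\<^sub>F l in at m. l \<in> S \<and> l \<noteq> m"
        using eventually_at_in_open[OF assms(1,2)] by (auto elim: eventually_mono)
      fix l assume l: "l \<in> S \<and> l \<noteq> m"
      then have "(F l - F m) / (l - m) - q = (F l - F m - (l - m) * q) / (l - m)"
        by (simp add: field_simps)
      then have "norm ((F l - F m) / (l - m) - q) = cmod (F l - F m - (l - m) * q) / cmod (l - m)"
        by (simp add: norm_divide)
      also have "\<dots> \<le> C * (cmod (l - m))\<^sup>2 / cmod (l - m)"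
        using assms(3) l by (intro divide_right_mono) auto
      also have "\<dots> = C * cmod (l - m)" using l by (simp add: power2_eq_square)
      finally show "norm ((F l - F m) / (l - m) - q) \<le> C * cmod (l - m)" .
    qed
    have "((\<lambda>l. C * cmod (l - m)) \<longlongrightarrow> C * cmod (m - m)) (at m)"
      by (intro tendsto_intros)
    then show "((\<lambda>l. C * cmod (l - m)) \<longlongrightarrow> 0) (at m)" by simp
  qed
  then show ?thesis
    unfolding has_field_derivative_iff using Lim_null by blast
qed

lemma open_upper_half_plane: "open upper_half_plane"
  unfolding upper_half_plane_def by (rule open_halfspace_Im_gt)

lemma riccati_holomorphic:
  assumes U: "\<And>l. l \<in> upper_half_plane \<Longrightarrow> riccati A l R (U l) \<and> U l R = 0"
    and A: "A absolutely_integrable_on {0..R}" and r: "0 \<le> r" "r \<le> R"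
  shows "(\<lambda>l. U l 0) holomorphic_on upper_half_plane"
    and "(\<lambda>l. riccati_log A (U l) r) holomorphic_on upper_half_plane"
proof -
  have Ar: "A absolutely_integrable_on {0..r}"
    using absolutely_integrable_on_subinterval[OF A, of 0 r] r by auto
  then have nA: "(\<lambda>t. cmod (A t)) integrable_on {0..r}" by (auto simp: absolutely_integrable_on_def)
  have "\<exists>q. ((\<lambda>l. U l 0) has_field_derivative q) (at m)"
    "\<exists>q. ((\<lambda>l. riccati_log A (U l) r) has_field_derivative q) (at m)" if m: "m \<in> upper_half_plane" for m
  proof -
    obtain p C where p: "continuous_on {0..R} p"
      and C: "\<And>l u s. riccati A l R u \<Longrightarrow> u R = 0 \<Longrightarrow> 0 < Im l \<Longrightarrow> s \<in> {0..R} \<Longrightarrow>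
        cmod (u s - U m s - (l - m) * p s) \<le> C * (cmod (l - m))\<^sup>2"
      using riccati_parameter_derivative[of A m R "U m"] U[OF m] A r m
      by (auto simp: upper_half_plane_def)
    have C': "cmod (U l s - U m s - (l - m) * p s) \<le> C * (cmod (l - m))\<^sup>2"
      if "l \<in> upper_half_plane" "s \<in> {0..R}" for l s
      using C[of l "U l" s] U[OF that(1)] that by (auto simp: upper_half_plane_def)
    show "\<exists>q. ((\<lambda>l. U l 0) has_field_derivative q) (at m)"
      by (rule exI, rule has_field_derivative_quadratic_error[OF open_upper_half_plane m])
        (use C'[of _ 0] r in auto)
    have int: "(\<lambda>s. cnj (A s) * U l s) integrable_on {0..r}" if "l \<in> upper_half_plane" for l
      using ac_integrand_integrable[OF riccati_log_ac[of A l R "U l"], of 0 r] U[OF that] A r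
      by (auto simp: absolutely_integrable_on_def)
    have intp: "(\<lambda>s. cnj (A s) * p s) integrable_on {0..r}"
      using absolutely_integrable_continuous_mult(2)[OF continuous_on_subset[OF p] absolutely_integrable_cnj[OF Ar]] r
      by (auto simp: absolutely_integrable_on_def)
    have "cmod (riccati_log A (U l) r - riccati_log A (U m) r - (l - m) * integral {0..r} (\<lambda>s. cnj (A s) * p s))
       \<le> L1_mass A r * C * (cmod (l - m))\<^sup>2" if l: "l \<in> upper_half_plane" for l
    proof -
      have I: "((\<lambda>s. cnj (A s) * (U l s - U m s - (l - m) * p s)) has_integral
          (riccati_log A (U l) r - riccati_log A (U m) r - (l - m) * integral {0..r} (\<lambda>s. cnj (A s) * p s))) {0..r}"
        using has_integral_diff[OF has_integral_diff[OF integrable_integral[OF int[OF l]] integrable_integral[OF int[OF m]]]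
            has_integral_mult_right[OF integrable_integral[OF intp], of "l - m"]]
        unfolding riccati_log_def by (rule has_integral_eq[rotated]) (simp add: algebra_simps)
      have "cmod (riccati_log A (U l) r - riccati_log A (U m) r - (l - m) * integral {0..r} (\<lambda>s. cnj (A s) * p s))
          \<le> integral {0..r} (\<lambda>s. cmod (A s) * (C * (cmod (l - m))\<^sup>2))"
        unfolding integral_unique[OF I, symmetric]
      proof (rule integral_norm_bound_integral[OF has_integral_integrable[OF I]])
        show "(\<lambda>s. cmod (A s) * (C * (cmod (l - m))\<^sup>2)) integrable_on {0..r}"
          using nA by (intro integrable_on_mult_left)
        fix s assume "s \<in> {0..r}"
        then show "cmod (cnj (A s) * (U l s - U m s - (l - m) * p s)) \<le> cmod (A s) * (C * (cmod (l - m))\<^sup>2)"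
          using C'[OF l, of s] r by (auto simp: norm_mult intro!: mult_left_mono)
      qed
      then show ?thesis by (simp add: mult_ac)
    qed
    then show "\<exists>q. ((\<lambda>l. riccati_log A (U l) r) has_field_derivative q) (at m)"
      by (intro exI) (rule has_field_derivative_quadratic_error[OF open_upper_half_plane m])
  qed
  then show "(\<lambda>l. U l 0) holomorphic_on upper_half_plane"
    and "(\<lambda>l. riccati_log A (U l) r) holomorphic_on upper_half_plane"
    by (auto simp: holomorphic_on_open[OF open_upper_half_plane])
qed

section \<open>Riccati solutions on the imaginary axis\<close>

text \<open>The bracket is the derivative of |u|^2 along the Riccati flow with Im l = y. Half of its
  quadratic term absorbs the mixed term by completing the square in y |u| and |a|.\<close>

lemma riccati_square_growth:
  assumes "cmod u \<le> 1" "0 < y"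
  shows "y * (2 * y * (cmod u)\<^sup>2 + 2 * Re (cnj u * a) * (1 - (cmod u)\<^sup>2)) \<ge> y\<^sup>2 * (cmod u)\<^sup>2 - (cmod a)\<^sup>2"
proof -
  have "\<bar>Re (cnj u * a) * (1 - (cmod u)\<^sup>2)\<bar> \<le> cmod u * cmod a * 1"
    unfolding abs_mult
    using assms(1) abs_Re_le_cmod[of "cnj u * a"] by (intro mult_mono) (auto simp: norm_mult power_le_one)
  then have "- (cmod u * cmod a) \<le> Re (cnj u * a) * (1 - (cmod u)\<^sup>2)" by simp
  then have "y * (- (cmod u * cmod a)) \<le> y * (Re (cnj u * a) * (1 - (cmod u)\<^sup>2))"
    using assms(2) by (intro mult_left_mono) auto
  moreover have "0 \<le> (y * cmod u - cmod a)\<^sup>2" by simp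
  ultimately show ?thesis by (simp add: power2_eq_square algebra_simps)
qed

text \<open>Integrated form of the growth inequality: up to a boundary term, y u is no larger than
  \<open>A\<close> in mean square. This is the size suggested by the formal leading order u = - A /
  y on the imaginary axis.\<close>

lemma riccati_L2_bound:
  assumes u: "riccati A l R u" and R: "0 \<le> R" and l: "0 < Im l"
    and A2: "(\<lambda>s. (cmod (A s))\<^sup>2) integrable_on {0..R}"
  shows "(Im l)\<^sup>2 * integral {0..R} (\<lambda>s. (cmod (u s))\<^sup>2)
    \<le> Im l * (cmod (u R))\<^sup>2 + L2_mass A R"
    and "(\<lambda>s. (cmod (u s))\<^sup>2) integrable_on {0..R}"
proof -
  have "continuous_on {0..R} u" using u by (auto simp: riccati_def intro: ac_continuous)
  then show u2: "(\<lambda>s. (cmod (u s))\<^sup>2) integrable_on {0..R}"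
    by (intro integrable_continuous_real continuous_intros)
  have I: "((\<lambda>s. (Im l)\<^sup>2 * (cmod (u s))\<^sup>2 - (cmod (A s))\<^sup>2) has_integral
    ((Im l)\<^sup>2 * integral {0..R} (\<lambda>s. (cmod (u s))\<^sup>2) - L2_mass A R)) {0..R}"
    by (intro has_integral_diff has_integral_mult_right integrable_integral u2 A2)
  have "(Im l)\<^sup>2 * integral {0..R} (\<lambda>s. (cmod (u s))\<^sup>2) - L2_mass A R
    \<le> Im l * (Re (u R * cnj (u R)) - Re (u 0 * cnj (u 0)))"
    by (rule has_integral_le[OF I has_integral_mult_right[OF ac_has_integral_Re[OF riccati_square_ac[OF u] order_refl R order_refl]]])
      (use riccati_square_growth l u in \<open>auto simp: riccati_def\<close>)
  also have "\<dots> \<le> Im l * (cmod (u R))\<^sup>2"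
    using l by (intro mult_left_mono) (auto simp: complex_norm_square[symmetric] simp del: of_real_power)
  finally show "(Im l)\<^sup>2 * integral {0..R} (\<lambda>s. (cmod (u s))\<^sup>2)
    \<le> Im l * (cmod (u R))\<^sup>2 + L2_mass A R" by simp
qed

lemma riccati_log_L2_bound:
  assumes u: "riccati A l R u" and R: "0 \<le> R" and l: "0 < Im l" and uR: "u R = 0"
    and A: "A absolutely_integrable_on {0..R}" and A2: "(\<lambda>s. (cmod (A s))\<^sup>2) integrable_on {0..R}"
  shows "Im l * cmod (riccati_log A u R) \<le> L2_mass A R"
proof -
  note u2 = riccati_L2_bound[OF u R l A2]
  have Au: "(\<lambda>t. cnj (A t) * u t) integrable_on {0..R}"
    using ac_integrand_integrable[OF riccati_log_ac[OF u A], of 0 R] by (auto simp: absolutely_integrable_on_def)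
  have "cmod (of_real (Im l) * riccati_log A u R) \<le> integral {0..R} (\<lambda>s. ((cmod (A s))\<^sup>2 + (Im l)\<^sup>2 * (cmod (u s))\<^sup>2) / 2)"
    unfolding riccati_log_def integral_mult_right[symmetric]
  proof (rule integral_norm_bound_integral)
    show "(\<lambda>x. of_real (Im l) * (cnj (A x) * u x)) integrable_on {0..R}"
      using Au by (intro integrable_on_mult_right)
    show "(\<lambda>s. ((cmod (A s))\<^sup>2 + (Im l)\<^sup>2 * (cmod (u s))\<^sup>2) / 2) integrable_on {0..R}"
      using A2 u2(2) by (intro integrable_on_divide integrable_add integrable_on_mult_right)
    fix s
    have "0 \<le> (cmod (A s) - Im l * cmod (u s))\<^sup>2" by simp
    then show "cmod (of_real (Im l) * (cnj (A s) * u s)) \<le> ((cmod (A s))\<^sup>2 + (Im l)\<^sup>2 * (cmod (u s))\<^sup>2) / 2"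
      using l by (simp add: norm_mult power2_eq_square algebra_simps)
  qed
  also have "\<dots> = (L2_mass A R + (Im l)\<^sup>2 * integral {0..R} (\<lambda>s. (cmod (u s))\<^sup>2)) / 2"
    using A2 u2(2) by (simp add: Henstock_Kurzweil_Integration.integral_add integrable_on_mult_right)
  also have "\<dots> \<le> L2_mass A R"
    using u2(1) uR by simp
  finally show ?thesis using l by (simp add: norm_mult)
qed

text \<open>The weight exp (- y t) makes the growth inequality one-sided and damps the unknown value
  at \<open>R\<close> by exp (- y (R - s)). Away from the right endpoint \<open>u\<close> is
  therefore small for large y, whatever its terminal value.\<close>

lemma riccati_pointwise_bound:
  assumes u: "riccati A l R u" and l: "0 < Im l" and s: "s \<in> {0..R}"
    and A2: "(\<lambda>s. (cmod (A s))\<^sup>2) integrable_on {0..R}"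
  shows "(cmod (u s))\<^sup>2 \<le> exp (- Im l * (R - s)) + L2_mass A R / Im l"
proof -
  define y where "y = Im l"
  have y: "0 < y" using l by (simp add: y_def)
  define E where "E = (\<lambda>t. exp (complex_of_real (- y) * of_real t))"
  have acE: "ac R E (\<lambda>t. complex_of_real (- y) * E t)" unfolding E_def by (rule ac_exp_linear)
  have E: "E t = of_real (exp (- y * t))" for t by (simp only: E_def of_real_mult[symmetric] exp_of_real)
  have acF: "ac R (\<lambda>t. E t * (u t * cnj (u t)))
     (\<lambda>t. of_real (exp (- y * t) * (2 * y * (cmod (u t))\<^sup>2 + 2 * Re (cnj (u t) * A t) * (1 - (cmod (u t))\<^sup>2) - y * (cmod (u t))\<^sup>2)))"
    by (rule ac_cong[OF ac_mult[OF acE riccati_square_ac[OF u]]])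
      (simp_all add: E y_def complex_norm_square algebra_simps del: of_real_power)
  have A2s: "(\<lambda>t. (cmod (A t))\<^sup>2) integrable_on {s..R}"
    using integrable_subinterval_real[OF A2, of s R] s by auto
  have I: "((\<lambda>t. - exp (- y * s) / y * (cmod (A t))\<^sup>2) has_integral
     - exp (- y * s) / y * integral {s..R} (\<lambda>t. (cmod (A t))\<^sup>2)) {s..R}"
    by (intro has_integral_mult_right integrable_integral A2s)
  have sR: "0 \<le> s" "s \<le> R" using s by auto
  have "- exp (- y * s) / y * integral {s..R} (\<lambda>t. (cmod (A t))\<^sup>2)
      \<le> Re (E R * (u R * cnj (u R))) - Re (E s * (u s * cnj (u s)))"
  proof (rule has_integral_le[OF I ac_has_integral_Re[OF acF sR(1,2) order_refl]])
    fix t assume t: "t \<in> {s..R}"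
    have u1: "cmod (u t) \<le> 1" using u t s by (auto simp: riccati_def)
    have "- (exp (- y * s) / y) * (cmod (A t))\<^sup>2 \<le> - (exp (- y * t) / y) * (cmod (A t))\<^sup>2"
      using t y by (intro mult_right_mono) (auto simp: divide_right_mono)
    also have "\<dots> = exp (- y * t) * (- (cmod (A t))\<^sup>2 / y)" by simp
    also have "\<dots> \<le> exp (- y * t) * (2 * y * (cmod (u t))\<^sup>2 + 2 * Re (cnj (u t) * A t) * (1 - (cmod (u t))\<^sup>2) - y * (cmod (u t))\<^sup>2)"
    proof (intro mult_left_mono)
      have "- (cmod (A t))\<^sup>2 \<le> (2 * y * (cmod (u t))\<^sup>2 + 2 * Re (cnj (u t) * A t) * (1 - (cmod (u t))\<^sup>2) - y * (cmod (u t))\<^sup>2) * y"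
        using riccati_square_growth[OF u1 y, of "A t"] by (simp add: power2_eq_square algebra_simps)
      then show "- (cmod (A t))\<^sup>2 / y \<le> 2 * y * (cmod (u t))\<^sup>2 + 2 * Re (cnj (u t) * A t) * (1 - (cmod (u t))\<^sup>2) - y * (cmod (u t))\<^sup>2"
        by (rule pos_divide_le_eq[OF y, THEN iffD2])
    qed auto
    finally show "- exp (- y * s) / y * (cmod (A t))\<^sup>2 \<le> Re (of_real (exp (- y * t) * (2 * y * (cmod (u t))\<^sup>2 + 2 * Re (cnj (u t) * A t) * (1 - (cmod (u t))\<^sup>2) - y * (cmod (u t))\<^sup>2)))"
      by simp
  qed
  moreover have "Re (E t * (u t * cnj (u t))) = exp (- y * t) * (cmod (u t))\<^sup>2" for t
    by (simp add: E complex_norm_square[symmetric] flip: of_real_power of_real_mult)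
  ultimately have "exp (- y * s) * (cmod (u s))\<^sup>2 \<le> exp (- y * R) * (cmod (u R))\<^sup>2
      + exp (- y * s) / y * integral {s..R} (\<lambda>t. (cmod (A t))\<^sup>2)" by simp
  also have "\<dots> \<le> exp (- y * R) * 1 + exp (- y * s) / y * L2_mass A R"
    using u s y A2 A2s
    by (intro add_mono mult_left_mono integral_subset_le) (auto simp: riccati_def power_le_one)
  also have "\<dots> = exp (- y * s) * (exp (- y * (R - s)) + L2_mass A R / y)"
    by (simp add: algebra_simps exp_add[symmetric])
  finally show ?thesis by (simp add: y_def)
qed

text \<open>Truncation followed by Weierstrass approximation.\<close>

lemma L2_polynomial_approximation:
  fixes B :: "real \<Rightarrow> complex"
  assumes B: "L2_on {a..b} B" and \<delta>: "0 < \<delta>"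
  obtains \<phi> where "polynomial_function \<phi>" "(\<lambda>s. (cmod (B s - \<phi> s))\<^sup>2) integrable_on {a..b}"
    "integral {a..b} (\<lambda>s. (cmod (B s - \<phi> s))\<^sup>2) < \<delta>"
proof -
  \<comment> \<open>Radial retraction onto the disc of radius M. Being continuous, it preserves
    measurability and pointwise limits while supplying the bounds for dominated convergence.\<close>
  define clip where "clip = (\<lambda>M (z::complex). (M / max M (cmod z)) *\<^sub>R z)"
  have clip_cont: "continuous_on UNIV (clip M)" if "0 < M" for M
    unfolding clip_def using that by (intro continuous_intros) (auto simp: max_def)
  have clip_le: "cmod (clip M z) \<le> M" "cmod (clip M z) \<le> cmod z" "cmod (z - clip M z) \<le> cmod z" if "0 < M" for M z
  proof -
    show "cmod (clip M z) \<le> M" "cmod (clip M z) \<le> cmod z"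
      using that by (auto simp: clip_def max_def divide_simps mult_left_le mult.commute)
    have "z - clip M z = (1 - M / max M (cmod z)) *\<^sub>R z" by (simp add: clip_def algebra_simps)
    moreover have "\<bar>1 - M / max M (cmod z)\<bar> \<le> 1" using that by (auto simp: max_def divide_simps)
    ultimately show "cmod (z - clip M z) \<le> cmod z" by (simp add: mult_left_le_one_le)
  qed
  have clip_eq: "clip M z = z" if "cmod z \<le> M" "0 < M" for M z using that by (simp add: clip_def max_def)
  have Bm: "B \<in> borel_measurable (lebesgue_on {a..b})"
    using L2_on_imp_absolutely_integrable[OF B] by (simp add: absolutely_integrable_measurable)
  have B2: "(\<lambda>s. (cmod (B s))\<^sup>2) integrable_on {a..b}"
    using B by (auto simp: L2_on_def absolutely_integrable_on_def)
  have meas_int: "g integrable_on {a..b}" if "g \<in> borel_measurable (lebesgue_on {a..b})"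
    "\<And>x. x \<in> {a..b} \<Longrightarrow> norm (g x) \<le> h x" "h integrable_on {a..b}" for g h :: "real \<Rightarrow> real"
    using measurable_bounded_by_integrable_imp_integrable[OF that(1,3)] that(2) by auto
  have clipm: "(\<lambda>s. clip M (B s)) \<in> borel_measurable (lebesgue_on {a..b})" if "0 < M" for M
    using measurable_compose[OF Bm borel_measurable_continuous_onI[OF clip_cont[OF that]]] .
  have lim1: "(\<lambda>n. integral {a..b} (\<lambda>s. (cmod (B s - clip (real (Suc n)) (B s)))\<^sup>2)) \<longlonglongrightarrow> integral {a..b} (\<lambda>s. 0)"
  proof (rule dominated_convergence(2)[OF _ B2])
    fix n
    show "(\<lambda>s. (cmod (B s - clip (real (Suc n)) (B s)))\<^sup>2) integrable_on {a..b}"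
      by (rule meas_int[OF _ _ B2]) (use Bm clipm in \<open>auto intro!: power_mono clip_le\<close>)
    show "norm ((cmod (B x - clip (real (Suc n)) (B x)))\<^sup>2) \<le> (cmod (B x))\<^sup>2" for x
      by (auto intro!: power_mono clip_le)
  next
    fix x
    obtain N where N: "cmod (B x) \<le> real N" using real_arch_simple by blast
    have "\<forall>\<^sub>F n in sequentially. (cmod (B x - clip (real (Suc n)) (B x)))\<^sup>2 = 0"
      unfolding eventually_sequentially by (rule exI[of _ N]) (use N in \<open>auto simp: clip_eq\<close>)
    then show "(\<lambda>n. (cmod (B x - clip (real (Suc n)) (B x)))\<^sup>2) \<longlonglongrightarrow> 0"
      by (rule tendsto_eventually)
  qed
  obtain n where n: "integral {a..b} (\<lambda>s. (cmod (B s - clip (real (Suc n)) (B s)))\<^sup>2) < \<delta> / 9"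
    using order_tendstoD(2)[OF lim1, of "\<delta> / 9"] \<delta> by (auto simp: eventually_sequentially)
  define M where "M = real (Suc n)"
  have M: "0 < M" by (simp add: M_def)
  \<comment> \<open>A measurable function is a pointwise limit of continuous functions off a null
    set. These are not uniformly bounded, so they are clipped as well.\<close>
  obtain N g where N: "negligible N" and g: "\<And>k. continuous_on UNIV (g k :: real \<Rightarrow> complex)"
    and lim: "\<And>x. x \<notin> N \<Longrightarrow> (\<lambda>k. g k x) \<longlonglongrightarrow> (if x \<in> {a..b} then B x else 0)"
    using Bm measurable_on_iff_borel_measurable[of "{a..b}" B] unfolding measurable_on_def by auto
  have const_int: "(\<lambda>s. (2 * M)\<^sup>2) integrable_on {a..b}" by (rule integrable_const_ivl)
  have clipg: "continuous_on {a..b} (\<lambda>s. clip M (g k s))" for k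
    using continuous_on_compose2[OF clip_cont[OF M] continuous_on_subset[OF g]] by auto
  have le2: "norm ((cmod (clip M (B x) - clip M (g k x)))\<^sup>2) \<le> (2 * M)\<^sup>2" for k x
  proof -
    have "cmod (clip M (B x) - clip M (g k x)) \<le> 2 * M"
      using norm_triangle_ineq4[of "clip M (B x)" "clip M (g k x)"] clip_le(1)[OF M, of "B x"] clip_le(1)[OF M, of "g k x"]
      by linarith
    from power_mono[OF this norm_ge_zero, of 2] show ?thesis by simp
  qed
  have int2: "(\<lambda>s. (cmod (clip M (B s) - clip M (g k s)))\<^sup>2) integrable_on {a..b}" for k
    by (rule meas_int[OF _ _ const_int])
      (use clipm[OF M] continuous_imp_measurable_on_sets_lebesgue[OF clipg] le2 in auto)
  \<comment> \<open>The dominated convergence theorem asks for convergence at every point, so the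
    integrands are set to 0 on the exceptional set.\<close>
  have int2': "(\<lambda>s. if s \<in> N then 0 else (cmod (clip M (B s) - clip M (g k s)))\<^sup>2) integrable_on {a..b}" for k
    by (rule integrable_spike[OF int2 N]) auto
  have lim2: "(\<lambda>k. integral {a..b} (\<lambda>s. if s \<in> N then 0 else (cmod (clip M (B s) - clip M (g k s)))\<^sup>2)) \<longlonglongrightarrow> integral {a..b} (\<lambda>s. 0)"
  proof (rule dominated_convergence(2)[OF int2' const_int])
    show "norm (if x \<in> N then 0 else (cmod (clip M (B x) - clip M (g k x)))\<^sup>2) \<le> (2 * M)\<^sup>2" for k x
      using le2[of x k] by auto
    fix x assume x: "x \<in> {a..b}"
    show "(\<lambda>k. if x \<in> N then 0 else (cmod (clip M (B x) - clip M (g k x)))\<^sup>2) \<longlonglongrightarrow> 0"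
    proof (cases "x \<in> N")
      case False
      then have "(\<lambda>k. g k x) \<longlonglongrightarrow> B x" using lim[of x] x by simp
      then have "(\<lambda>k. clip M (g k x)) \<longlonglongrightarrow> clip M (B x)"
        by (intro continuous_on_tendsto_compose[OF clip_cont[OF M]]) auto
      then have "(\<lambda>k. (cmod (clip M (B x) - clip M (g k x)))\<^sup>2) \<longlonglongrightarrow> (cmod (clip M (B x) - clip M (B x)))\<^sup>2"
        by (intro tendsto_intros)
      then show ?thesis using False by simp
    qed simp
  qed
  obtain k where "integral {a..b} (\<lambda>s. if s \<in> N then 0 else (cmod (clip M (B s) - clip M (g k s)))\<^sup>2) < \<delta> / 9"
    using order_tendstoD(2)[OF lim2, of "\<delta> / 9"] \<delta> by (auto simp: eventually_sequentially)
  moreover have "integral {a..b} (\<lambda>s. if s \<in> N then 0 else (cmod (clip M (B s) - clip M (g k s)))\<^sup>2)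
     = integral {a..b} (\<lambda>s. (cmod (clip M (B s) - clip M (g k s)))\<^sup>2)"
    by (rule integral_spike[OF N]) auto
  ultimately have k: "integral {a..b} (\<lambda>s. (cmod (clip M (B s) - clip M (g k s)))\<^sup>2) < \<delta> / 9" by simp
  \<comment> \<open>Three errors enter, each allowed \<open>\<delta> / 9\<close> because the square
    of a sum of three costs a factor 3. The summand 1 keeps the denominator positive when a =
    b.\<close>
  define \<eta> where "\<eta> = sqrt (\<delta> / (9 * (1 + \<bar>b - a\<bar>)))"
  have "0 < \<delta> / (9 * (1 + \<bar>b - a\<bar>))" using \<delta> by (intro divide_pos_pos mult_pos_pos) auto
  then have \<eta>: "0 < \<eta>" "\<eta>\<^sup>2 = \<delta> / (9 * (1 + \<bar>b - a\<bar>))"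
    unfolding \<eta>_def by (simp_all only: real_sqrt_gt_zero real_sqrt_pow2 less_imp_le)
  obtain \<phi> where \<phi>: "polynomial_function \<phi>" "\<And>x. x \<in> {a..b} \<Longrightarrow> norm (clip M (g k x) - \<phi> x) < \<eta>"
    using Stone_Weierstrass_polynomial_function[OF _ clipg[of k] \<eta>(1)] by auto
  have c\<phi>: "continuous_on {a..b} \<phi>" using \<phi>(1) by (simp add: continuous_on_polymonial_function)
  have e3: "(cmod (p + q + r))\<^sup>2 \<le> 3 * ((cmod p)\<^sup>2 + (cmod q)\<^sup>2 + (cmod r)\<^sup>2)" for p q r :: complex
  proof -
    have "(cmod (p + q + r))\<^sup>2 \<le> (cmod p + cmod q + cmod r)\<^sup>2"
      by (intro power_mono norm_triangle_le add_mono norm_triangle_ineq) auto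
    moreover have "0 \<le> (cmod p - cmod q)\<^sup>2 + (cmod q - cmod r)\<^sup>2 + (cmod p - cmod r)\<^sup>2" by simp
    ultimately show ?thesis by (simp add: power2_eq_square algebra_simps)
  qed
  have pw: "(cmod (B x - \<phi> x))\<^sup>2 \<le> 3 * ((cmod (B x - clip M (B x)))\<^sup>2 + (cmod (clip M (B x) - clip M (g k x)))\<^sup>2 + \<eta>\<^sup>2)"
    if "x \<in> {a..b}" for x
  proof -
    have "(cmod (clip M (g k x) - \<phi> x))\<^sup>2 \<le> \<eta>\<^sup>2" using \<phi>(2)[OF that] by (intro power_mono) auto
    then show ?thesis
      using e3[of "B x - clip M (B x)" "clip M (B x) - clip M (g k x)" "clip M (g k x) - \<phi> x"] by simp
  qed
  have int1: "(\<lambda>s. (cmod (B s - clip M (B s)))\<^sup>2) integrable_on {a..b}"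
    by (rule meas_int[OF _ _ B2]) (use Bm clipm M in \<open>auto intro!: power_mono clip_le\<close>)
  have hi: "((\<lambda>x. 3 * ((cmod (B x - clip M (B x)))\<^sup>2 + (cmod (clip M (B x) - clip M (g k x)))\<^sup>2 + \<eta>\<^sup>2)) has_integral
     3 * (integral {a..b} (\<lambda>x. (cmod (B x - clip M (B x)))\<^sup>2) + integral {a..b} (\<lambda>x. (cmod (clip M (B x) - clip M (g k x)))\<^sup>2) + integral {a..b} (\<lambda>_. \<eta>\<^sup>2))) {a..b}"
    by (intro has_integral_mult_right has_integral_add integrable_integral int1 int2 integrable_const_ivl)
  have intf: "(\<lambda>s. (cmod (B s - \<phi> s))\<^sup>2) integrable_on {a..b}"
    by (rule meas_int[OF _ _ has_integral_integrable[OF hi]])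
      (use Bm continuous_imp_measurable_on_sets_lebesgue[OF c\<phi>] pw in auto)
  have "integral {a..b} (\<lambda>_. \<eta>\<^sup>2) \<le> \<bar>b - a\<bar> * \<eta>\<^sup>2"
    by (cases "a \<le> b") auto
  also have "\<dots> < (1 + \<bar>b - a\<bar>) * \<eta>\<^sup>2"
    using zero_less_power[OF \<eta>(1), of 2] by (intro mult_strict_right_mono) auto
  also have "\<dots> = \<delta> / 9" unfolding \<eta>(2) by (simp del: distrib_left_numeral add: add_nonneg_eq_0_iff)
  finally have "3 * (integral {a..b} (\<lambda>x. (cmod (B x - clip M (B x)))\<^sup>2) + integral {a..b} (\<lambda>x. (cmod (clip M (B x) - clip M (g k x)))\<^sup>2) + integral {a..b} (\<lambda>_. \<eta>\<^sup>2)) < \<delta>"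
    using n k by (simp add: M_def)
  moreover have "integral {a..b} (\<lambda>s. (cmod (B s - \<phi> s))\<^sup>2) \<le> 3 * (integral {a..b} (\<lambda>x. (cmod (B x - clip M (B x)))\<^sup>2) + integral {a..b} (\<lambda>x. (cmod (clip M (B x) - clip M (g k x)))\<^sup>2) + integral {a..b} (\<lambda>_. \<eta>\<^sup>2))"
    using has_integral_le[OF integrable_integral[OF intf] hi] pw by auto
  ultimately show ?thesis using that[OF \<phi>(1) intf] by simp
qed

lemma L2_on_cnj: "L2_on S A \<Longrightarrow> L2_on S (\<lambda>s. cnj (A s))"
proof -
  assume A: "L2_on S A"
  have "(\<lambda>x. cnj (indicator S x *\<^sub>R A x)) \<in> borel_measurable lebesgue"
    using A by (intro borel_measurable_continuous_on[of cnj] continuous_intros)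
      (auto simp: L2_on_def set_borel_measurable_def)
  then show ?thesis using A by (simp add: L2_on_def set_borel_measurable_def)
qed

lemma L2_locD:
  assumes "L2_loc A" "0 < R"
  shows "L2_on {0..R} A" "A absolutely_integrable_on {0..R}" "(\<lambda>s. (cmod (A s))\<^sup>2) integrable_on {0..R}"
    "(\<lambda>s. cmod (A s)) integrable_on {0..R}"
proof -
  show "L2_on {0..R} A" using assms by (simp add: L2_loc_def)
  then show "A absolutely_integrable_on {0..R}" "(\<lambda>s. (cmod (A s))\<^sup>2) integrable_on {0..R}"
    using L2_on_imp_absolutely_integrable by (auto simp: L2_on_def absolutely_integrable_on_def)
  then show "(\<lambda>s. cmod (A s)) integrable_on {0..R}" by (simp add: absolutely_integrable_on_def)
qed

text \<open>The product y u + \<open>A\<close> stays bounded in mean square and tends weakly to 0 as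
  y grows, so pairing it with conj(A) gives the limit. Weak convergence is tested on polynomials,
  which are dense. Existence of the solutions up to r + 1 gives smallness at the endpoint r
  itself.\<close>

lemma riccati_log_asymptotics:
  assumes U: "\<And>y. 1 \<le> y \<Longrightarrow> riccati A (\<i> * of_real y) (r + 1) (U y)"
    and A: "L2_loc A" and r: "0 < r"
  shows "((\<lambda>y. of_real y * riccati_log A (U y) r) \<longlongrightarrow> - of_real (L2_mass A r)) at_top"
proof -
  define N where "N = L2_mass A (r + 1)"
  define K where "K = 1 + N"
  note Ar = L2_locD[OF A r] and A1 = L2_locD[OF A, of "r + 1"]
  have A1i: "(\<lambda>s. (cmod (A s))\<^sup>2) integrable_on {0..r + 1}" using A1(3) r by simp
  have N0: "0 \<le> N" unfolding N_def using A1i by (intro integral_nonneg) auto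
  then have K0: "0 < K" by (simp add: K_def)
  have NrN: "L2_mass A r \<le> N"
    unfolding N_def using A1i Ar by (intro integral_subset_le) auto
  have Ur: "riccati A (\<i> * of_real y) r (U y)" if "1 \<le> y" for y
    using riccati_subinterval[OF U[OF that]] r by simp
  have cU: "continuous_on {0..r} (U y)" if "1 \<le> y" for y
    using Ur[OF that] by (auto simp: riccati_def intro: ac_continuous)
  \<comment> \<open>The extra unit of length turns the damping factor into exp (- y) on all of
    {0..r}, which is at most 1 / y.\<close>
  have pw: "(cmod (U y s))\<^sup>2 \<le> K / y" if y: "1 \<le> y" and s: "s \<in> {0..r}" for y s
  proof -
    have "(cmod (U y s))\<^sup>2 \<le> exp (- y * (r + 1 - s)) + N / y"
      using riccati_pointwise_bound[OF U[OF y] _ _ A1i, of s] y s by (simp add: N_def)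
    also have "exp (- y * (r + 1 - s)) \<le> exp (- y * 1)"
      using y s by (subst exp_le_cancel_iff, intro mult_left_mono_neg) auto
    also have "exp (- y * 1) \<le> 1 / y"
    proof -
      have "y \<le> exp y" using exp_ge_add_one_self[of y] by linarith
      then show ?thesis using y by (simp add: exp_minus field_simps)
    qed
    finally show ?thesis by (simp add: K_def add_divide_distrib)
  qed
  have u2: "(\<lambda>s. (cmod (U y s))\<^sup>2) integrable_on {0..r}" if y: "1 \<le> y" for y
    using cU[OF y] by (intro integrable_continuous_real continuous_intros)
  have L2U: "y\<^sup>2 * integral {0..r} (\<lambda>s. (cmod (U y s))\<^sup>2) \<le> 2 * K" if y: "1 \<le> y" for y
  proof -
    have "y\<^sup>2 * integral {0..r} (\<lambda>s. (cmod (U y s))\<^sup>2) \<le> y * (cmod (U y r))\<^sup>2 + L2_mass A r"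
      using riccati_L2_bound(1)[OF Ur[OF y] _ _ Ar(3)] y r by simp
    also have "y * (cmod (U y r))\<^sup>2 \<le> K"
      using pw[OF y, of r] y r by (simp add: field_simps)
    finally show ?thesis using NrN K_def by simp
  qed
  show ?thesis
  proof (rule tendstoI)
    fix e :: real assume e: "0 < e"
    \<comment> \<open>Chosen so that the two parts of the Young bound below are e / 4 each: the mean
      square term is at most 3 * K and the approximation error at most
      \<open>\<eta> * e / 2\<close>.\<close>
    define \<eta> where "\<eta> = e / (12 * K)"
    have \<eta>: "0 < \<eta>" using e K0 by (simp add: \<eta>_def)
    have "0 < \<eta> * e / 2" using \<eta> e by simp
    from L2_polynomial_approximation[OF L2_on_cnj[OF Ar(1)] this] obtain \<phi> where
      \<phi>: "polynomial_function \<phi>" "(\<lambda>s. (cmod (cnj (A s) - \<phi> s))\<^sup>2) integrable_on {0..r}"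
        "integral {0..r} (\<lambda>s. (cmod (cnj (A s) - \<phi> s))\<^sup>2) < \<eta> * e / 2" by blast
    obtain \<phi>' where \<phi>': "polynomial_function \<phi>'" "\<And>x. (\<phi> has_vector_derivative \<phi>' x) (at x)"
      using has_vector_derivative_polynomial_function[OF \<phi>(1)] by blast
    have c\<phi>: "continuous_on {0..r} \<phi>" "continuous_on {0..r} \<phi>'"
      using \<phi>(1) \<phi>'(1) by (simp_all add: continuous_on_polymonial_function)
    have "bounded (\<phi> ` {0..r})" "bounded (\<phi>' ` {0..r})"
      using c\<phi> by (auto intro!: compact_imp_bounded compact_continuous_image)
    then obtain M M' where M: "0 < M" "\<And>s. s \<in> {0..r} \<Longrightarrow> cmod (\<phi> s) \<le> M"
      and M': "0 < M'" "\<And>s. s \<in> {0..r} \<Longrightarrow> cmod (\<phi>' s) \<le> M'"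
      unfolding bounded_pos by blast
    have ac\<phi>: "ac r \<phi> \<phi>'"
      using \<phi>'(2) c\<phi>(2) by (intro ac_of_derivative) (auto intro: has_vector_derivative_at_within)
    define C where "C = 2 * M + M' * r + M * L1_mass A r"
    \<comment> \<open>By the equation at l = i y, y u + A equals u' + conj(A) u^2. Integration by
      parts moves the derivative to \<open>\<phi>\<close>, and every term then carries a factor u,
      bounded by sqrt (K / y). The three summands of \<open>C\<close> are the boundary terms, the
      \<open>\<phi>'\<close> term and the quadratic term.\<close>
    have test: "((\<lambda>s. \<phi> s * (of_real y * U y s + A s)) has_integral
        integral {0..r} (\<lambda>s. \<phi> s * (of_real y * U y s + A s))) {0..r}
        \<and> cmod (integral {0..r} (\<lambda>s. \<phi> s * (of_real y * U y s + A s))) \<le> C * sqrt (K / y)" if y: "1 \<le> y" for y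
    proof -
      define \<epsilon> where "\<epsilon> = sqrt (K / y)"
      have \<epsilon>: "cmod (U y s) \<le> \<epsilon>" if "s \<in> {0..r}" for s
        unfolding \<epsilon>_def using pw[OF y that] by (rule real_le_rsqrt)
      have "ac r (U y) (\<lambda>s. of_real y * U y s + A s - cnj (A s) * (U y s)\<^sup>2)"
        by (rule ac_cong[of r "U y" "\<lambda>s. - \<i> * (\<i> * of_real y) * U y s + A s - cnj (A s) * (U y s)\<^sup>2"])
          (use Ur[OF y] in \<open>auto simp: riccati_def\<close>)
      from ac_has_integral[OF ac_mult[OF ac\<phi> this], of 0 r] r
      have I1: "((\<lambda>s. \<phi>' s * U y s + \<phi> s * (of_real y * U y s + A s - cnj (A s) * (U y s)\<^sup>2)) has_integral
        (\<phi> r * U y r - \<phi> 0 * U y 0)) {0..r}" by simp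
      have "continuous_on {0..r} (\<lambda>s. \<phi> s * (U y s)\<^sup>2)"
        using c\<phi> cU[OF y] by (intro continuous_intros)
      from absolutely_integrable_continuous_mult(1)[OF this absolutely_integrable_cnj[OF Ar(2)]]
      have "(\<lambda>s. \<phi>' s * U y s - \<phi> s * (U y s)\<^sup>2 * cnj (A s)) integrable_on {0..r}"
        unfolding absolutely_integrable_on_def using c\<phi> cU[OF y]
        by (intro integrable_diff[OF integrable_continuous_real[OF continuous_on_mult]]) auto
      note I2 = integrable_integral[OF this]
      have I: "((\<lambda>s. \<phi> s * (of_real y * U y s + A s)) has_integral
         (\<phi> r * U y r - \<phi> 0 * U y 0 - integral {0..r} (\<lambda>s. \<phi>' s * U y s - \<phi> s * (U y s)\<^sup>2 * cnj (A s)))) {0..r}"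
        using has_integral_diff[OF I1 I2] by (rule has_integral_eq[rotated]) (simp add: algebra_simps)
      have i2: "cmod (integral {0..r} (\<lambda>s. \<phi>' s * U y s - \<phi> s * (U y s)\<^sup>2 * cnj (A s)))
        \<le> integral {0..r} (\<lambda>s. M' * \<epsilon> + M * \<epsilon> * cmod (A s))"
      proof (rule integral_norm_bound_integral[OF has_integral_integrable[OF I2]])
        show "(\<lambda>s. M' * \<epsilon> + M * \<epsilon> * cmod (A s)) integrable_on {0..r}"
          using Ar(4) by (intro integrable_add integrable_const_ivl integrable_on_mult_right)
        fix s assume s: "s \<in> {0..r}"
        have u1: "cmod (U y s) \<le> 1" using Ur[OF y] s by (auto simp: riccati_def)
        have "(cmod (U y s))\<^sup>2 \<le> \<epsilon>"
          using \<epsilon>[OF s] u1 mult_left_le[of "cmod (U y s)" "cmod (U y s)"] by (simp add: power2_eq_square)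
        then have "cmod (\<phi> s) * (cmod (U y s))\<^sup>2 \<le> M * \<epsilon>"
          using M s by (intro mult_mono) auto
        then have "cmod (\<phi> s) * (cmod (U y s))\<^sup>2 * cmod (A s) \<le> M * \<epsilon> * cmod (A s)"
          by (intro mult_right_mono) auto
        moreover have "cmod (\<phi>' s) * cmod (U y s) \<le> M' * \<epsilon>"
          using M' s \<epsilon> by (intro mult_mono) auto
        ultimately show "cmod (\<phi>' s * U y s - \<phi> s * (U y s)\<^sup>2 * cnj (A s)) \<le> M' * \<epsilon> + M * \<epsilon> * cmod (A s)"
          by (intro order_trans[OF norm_triangle_ineq4]) (simp add: norm_mult norm_power)
      qed
      also have "\<dots> = M' * \<epsilon> * r + M * \<epsilon> * L1_mass A r"
        using r Ar(4) by (subst Henstock_Kurzweil_Integration.integral_add)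
          (auto intro: integrable_on_mult_right)
      finally have i2: "cmod (integral {0..r} (\<lambda>s. \<phi>' s * U y s - \<phi> s * (U y s)\<^sup>2 * cnj (A s)))
        \<le> M' * \<epsilon> * r + M * \<epsilon> * L1_mass A r" .
      have "cmod (\<phi> s * U y s) \<le> M * \<epsilon>" if "s \<in> {0..r}" for s
        unfolding norm_mult using M \<epsilon> that by (intro mult_mono) auto
      from this[of 0] this[of r] r have "cmod (\<phi> r * U y r - \<phi> 0 * U y 0) \<le> M * \<epsilon> + M * \<epsilon>"
        by (intro order_trans[OF norm_triangle_ineq4] add_mono) auto
      then have "cmod (\<phi> r * U y r - \<phi> 0 * U y 0 - integral {0..r} (\<lambda>s. \<phi>' s * U y s - \<phi> s * (U y s)\<^sup>2 * cnj (A s)))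
        \<le> (M * \<epsilon> + M * \<epsilon>) + (M' * \<epsilon> * r + M * \<epsilon> * L1_mass A r)"
        using i2 by (rule order_trans[OF norm_triangle_ineq4 add_mono])
      also have "\<dots> = C * \<epsilon>" by (simp add: C_def algebra_simps)
      finally show ?thesis
        unfolding integral_unique[OF I] \<epsilon>_def[symmetric] using I by blast
    qed
    have main: "cmod (of_real y * riccati_log A (U y) r + of_real (L2_mass A r))
      \<le> C * sqrt (K / y) + e / 2" if y: "1 \<le> y" for y
    proof -
      have iAu: "(\<lambda>s. cnj (A s) * U y s) integrable_on {0..r}"
        using ac_integrand_integrable[OF riccati_log_ac[OF Ur[OF y] Ar(2)], of 0 r] by (auto simp: absolutely_integrable_on_def)
      have iA2: "((\<lambda>s. complex_of_real ((cmod (A s))\<^sup>2)) has_integral of_real (L2_mass A r)) {0..r}"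
        by (rule has_integral_of_real[OF integrable_integral[OF Ar(3)]])
      have I: "((\<lambda>s. cnj (A s) * (of_real y * U y s + A s)) has_integral
        (of_real y * riccati_log A (U y) r + of_real (L2_mass A r))) {0..r}"
        using has_integral_add[OF has_integral_mult_right[OF integrable_integral[OF iAu], of "of_real y"] iA2]
        unfolding riccati_log_def
        by (rule has_integral_eq[rotated]) (simp add: complex_norm_square algebra_simps del: of_real_power)
      note T = test[OF y]
      have D: "((\<lambda>s. (cnj (A s) - \<phi> s) * (of_real y * U y s + A s)) has_integral
        (of_real y * riccati_log A (U y) r + of_real (L2_mass A r)
         - integral {0..r} (\<lambda>s. \<phi> s * (of_real y * U y s + A s)))) {0..r}"
        using has_integral_diff[OF I T[THEN conjunct1]] by (rule has_integral_eq[rotated]) (simp add: algebra_simps)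
      \<comment> \<open>Majorant from Young's inequality with weight \<open>\<eta>\<close>: the
        large coefficient falls on the approximation error, the small one on the bounded mean square
        of y u + A.\<close>
      have B: "((\<lambda>s. (1 / (2 * \<eta>)) * (cmod (cnj (A s) - \<phi> s))\<^sup>2 + \<eta> * (y\<^sup>2 * (cmod (U y s))\<^sup>2 + (cmod (A s))\<^sup>2)) has_integral
        ((1 / (2 * \<eta>)) * integral {0..r} (\<lambda>s. (cmod (cnj (A s) - \<phi> s))\<^sup>2) +
          \<eta> * (y\<^sup>2 * integral {0..r} (\<lambda>s. (cmod (U y s))\<^sup>2) + L2_mass A r))) {0..r}"
        by (intro has_integral_add has_integral_mult_right integrable_integral \<phi>(2) u2[OF y] Ar(3))
      have "cmod (of_real y * riccati_log A (U y) r + of_real (L2_mass A r)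
         - integral {0..r} (\<lambda>s. \<phi> s * (of_real y * U y s + A s))) \<le>
         (1 / (2 * \<eta>)) * integral {0..r} (\<lambda>s. (cmod (cnj (A s) - \<phi> s))\<^sup>2) +
          \<eta> * (y\<^sup>2 * integral {0..r} (\<lambda>s. (cmod (U y s))\<^sup>2) + L2_mass A r)"
        unfolding integral_unique[OF D, symmetric] integral_unique[OF B, symmetric]
      proof (rule integral_norm_bound_integral[OF has_integral_integrable[OF D] has_integral_integrable[OF B]])
        fix s
        define p q where "p = cmod (cnj (A s) - \<phi> s)" and "q = cmod (of_real y * U y s + A s)"
        have "q \<le> y * cmod (U y s) + cmod (A s)"
          using norm_triangle_ineq[of "of_real y * U y s" "A s"] y by (simp add: q_def norm_mult)
        then have "q\<^sup>2 \<le> (y * cmod (U y s) + cmod (A s))\<^sup>2"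
          by (intro power_mono) (auto simp: q_def)
        also have "\<dots> \<le> 2 * (y\<^sup>2 * (cmod (U y s))\<^sup>2 + (cmod (A s))\<^sup>2)"
          using zero_le_power2[of "y * cmod (U y s) - cmod (A s)"] by (simp add: power2_eq_square algebra_simps)
        finally have q2: "q\<^sup>2 \<le> 2 * (y\<^sup>2 * (cmod (U y s))\<^sup>2 + (cmod (A s))\<^sup>2)" .
        have "0 \<le> (p - \<eta> * q)\<^sup>2 / (2 * \<eta>)" using \<eta> by simp
        also have "\<dots> = (1 / (2 * \<eta>)) * p\<^sup>2 + \<eta> * q\<^sup>2 / 2 - p * q"
          using \<eta> by (simp add: power2_eq_square field_simps)
        finally have "p * q \<le> (1 / (2 * \<eta>)) * p\<^sup>2 + \<eta> * q\<^sup>2 / 2" by simp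
        also have "\<eta> * q\<^sup>2 / 2 \<le> \<eta> * (y\<^sup>2 * (cmod (U y s))\<^sup>2 + (cmod (A s))\<^sup>2)"
          using mult_left_mono[OF q2, of \<eta>] \<eta> by simp
        finally show "cmod ((cnj (A s) - \<phi> s) * (of_real y * U y s + A s)) \<le>
          (1 / (2 * \<eta>)) * (cmod (cnj (A s) - \<phi> s))\<^sup>2 + \<eta> * (y\<^sup>2 * (cmod (U y s))\<^sup>2 + (cmod (A s))\<^sup>2)"
          by (simp add: p_def q_def norm_mult)
      qed
      also have "\<dots> \<le> (1 / (2 * \<eta>)) * (\<eta> * e / 2) + \<eta> * (2 * K + K)"
        using \<phi>(3) L2U[OF y] NrN \<eta> K_def by (intro add_mono mult_left_mono) auto
      also have "\<dots> = e / 2" using \<eta> K0 by (simp add: \<eta>_def field_simps)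
      finally show ?thesis
        using T[THEN conjunct2] norm_triangle_sub[of "of_real y * riccati_log A (U y) r + of_real (L2_mass A r)"
          "integral {0..r} (\<lambda>s. \<phi> s * (of_real y * U y s + A s))"] by linarith
    qed
    have "((\<lambda>y. C * sqrt (K / y)) \<longlongrightarrow> C * sqrt 0) at_top"
      by (intro tendsto_intros tendsto_divide_0[OF tendsto_const] filterlim_at_top_imp_at_infinity filterlim_ident)
    then have "\<forall>\<^sub>F y in at_top. C * sqrt (K / y) < e / 2"
      using order_tendstoD(2)[of "\<lambda>y. C * sqrt (K / y)" "C * sqrt 0" at_top "e / 2"] e by simp
    moreover have "\<forall>\<^sub>F y::real in at_top. 1 \<le> y" by (rule eventually_ge_at_top)
    ultimately show "\<forall>\<^sub>F y in at_top. dist (of_real y * riccati_log A (U y) r)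
       (- of_real (L2_mass A r)) < e"
    proof eventually_elim
      case (elim y)
      then show ?case using main[of y] by (simp add: dist_norm)
    qed
  qed
qed

section \<open>The Poisson formula for the upper half-plane\<close>

abbreviation Cauchy_kernel :: "real \<Rightarrow> real \<Rightarrow> real" where
  "Cauchy_kernel y t \<equiv> 1 / (t\<^sup>2 + y\<^sup>2)"

abbreviation odd_kernel :: "real \<Rightarrow> real \<Rightarrow> real" where
  "odd_kernel y t \<equiv> t / (t\<^sup>2 + y\<^sup>2)\<^sup>2"

abbreviation square_kernel :: "real \<Rightarrow> real \<Rightarrow> real" where
  "square_kernel y t \<equiv> t\<^sup>2 / (t\<^sup>2 + y\<^sup>2)\<^sup>2"

lemma integrable_Cauchy_kernel:
  assumes "0 < y" shows "integrable lborel (\<lambda>x::real. Cauchy_kernel y x)"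
    and "(LBINT x. Cauchy_kernel y x) = pi / y"
proof -
  define f where "f = (\<lambda>(n::nat) x::real. (Cauchy_kernel y x) * indicator {- real n .. real n} x)"
  have pos: "0 < x\<^sup>2 + y\<^sup>2" for x using assms by (simp add: add_nonneg_pos)
  have h: "has_bochner_integral lborel (f n) (arctan (real n / y) / y - arctan (- real n / y) / y)" for n
    unfolding f_def
  proof (rule has_bochner_integral_FTC_Icc_nonneg)
    fix x :: real
    have "((\<lambda>x. arctan (x / y) / y) has_real_derivative (inverse (1 + (x / y)\<^sup>2) * (1 / y)) / y) (at x)"
      using assms by (auto intro!: derivative_eq_intros)
    moreover have "(inverse (1 + (x / y)\<^sup>2) * (1 / y)) / y = Cauchy_kernel y x"
    proof -
      have "1 + (x / y)\<^sup>2 = (x\<^sup>2 + y\<^sup>2) / y\<^sup>2" using assms by (simp add: field_simps)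
      then show ?thesis using assms by (simp add: power2_eq_square)
    qed
    ultimately show "((\<lambda>x. arctan (x / y) / y) has_real_derivative Cauchy_kernel y x) (at x)" by simp
  qed (use pos in \<open>auto simp: less_imp_le\<close>)
  have lim: "(\<lambda>n. arctan (real n / y) / y - arctan (- real n / y) / y) \<longlonglongrightarrow> pi / 2 / y - (- pi / 2) / y"
  proof (intro tendsto_intros)
    have 1: "LIM n sequentially. real n / y :> at_top"
      unfolding divide_inverse
      by (rule filterlim_at_top_mult_tendsto_pos[OF tendsto_const _ filterlim_real_sequentially]) (use assms in simp)
    show "(\<lambda>n. arctan (real n / y)) \<longlonglongrightarrow> pi / 2"
      using tendsto_arctan_at_top 1 by (rule filterlim_compose)
    then show "(\<lambda>n. arctan (- real n / y)) \<longlonglongrightarrow> - pi / 2"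
      by (simp add: arctan_minus tendsto_minus)
  qed (use assms in auto)
  have "has_bochner_integral lborel (\<lambda>x::real. Cauchy_kernel y x) (pi / 2 / y - (- pi / 2) / y)"
  proof (rule has_bochner_integral_monotone_convergence[of lborel f])
    show "integrable lborel (f i)" for i using h by (rule has_bochner_integral_iff[THEN iffD1, THEN conjunct1])
    show "AE x in lborel. mono (\<lambda>n. f n x)"
      using pos by (intro AE_I2) (auto simp: f_def mono_def indicator_def less_imp_le)
    show "AE x in lborel. (\<lambda>i. f i x) \<longlonglongrightarrow> Cauchy_kernel y x"
    proof (rule AE_I2)
      fix x :: real
      obtain N where "\<bar>x\<bar> \<le> real N" using real_arch_simple by blast
      then have "\<forall>\<^sub>F i in sequentially. f i x = Cauchy_kernel y x"
        unfolding eventually_sequentially by (intro exI[of _ N]) (auto simp: f_def indicator_def)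
      then show "(\<lambda>i. f i x) \<longlonglongrightarrow> Cauchy_kernel y x" by (rule tendsto_eventually)
    qed
    show "(\<lambda>i. LBINT x. f i x) \<longlonglongrightarrow> pi / 2 / y - (- pi / 2) / y"
      using lim has_bochner_integral_integral_eq[OF h] by simp
  qed simp
  then show "integrable lborel (\<lambda>x::real. Cauchy_kernel y x)" "(LBINT x. Cauchy_kernel y x) = pi / y"
    by (auto simp: has_bochner_integral_iff)
qed

text \<open>Cauchy's theorem for the real line, closed up by a large rectangle: a primitive of \<open>H\<close>
  changes by \<open>O(1/R)\<close> along the other three sides.\<close>

lemma line_integral_zero:
  assumes H: "H holomorphic_on {z. Im z > - \<delta>}" and \<delta>: "0 < \<delta>"
    and bound: "\<And>z. 0 \<le> Im z \<Longrightarrow> K \<le> cmod z \<Longrightarrow> cmod (H z) \<le> C / (cmod z)\<^sup>2"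
    and int: "integrable lborel (\<lambda>x. H (of_real x))"
  shows "(LBINT x. H (of_real x)) = 0"
proof -
  define S where "S = {z. Im z > - \<delta>}"
  have "convex S" "open S" by (auto simp: S_def convex_halfspace_Im_gt open_halfspace_Im_gt)
  then obtain Q where Q: "\<And>x. x \<in> S \<Longrightarrow> (Q has_field_derivative H x) (at x within S)"
    using holomorphic_convex_primitive'[of S H] H by (auto simp: S_def)
  have Q': "(Q has_field_derivative H x) (at x)" if "x \<in> S" for x
    using Q[OF that] at_within_open[OF that \<open>open S\<close>] by simp
  have upS: "z \<in> S" if "0 \<le> Im z" for z using that \<delta> by (simp add: S_def)
  have C0: "0 \<le> C"
  proof -
    have "0 \<le> cmod (H (of_real (\<bar>K\<bar> + 1)))" by simp
    also have "\<dots> \<le> C / (cmod (of_real (\<bar>K\<bar> + 1)))\<^sup>2" by (rule bound) (auto simp del: of_real_add)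
    finally have "0 \<le> C / (cmod (of_real (\<bar>K\<bar> + 1)))\<^sup>2" .
    moreover have "0 < (cmod (of_real (\<bar>K\<bar> + 1)))\<^sup>2" by (simp del: of_real_add)
    ultimately show ?thesis by (simp add: zero_le_divide_iff del: of_real_add)
  qed
  have seg: "cmod (Q b - Q a) \<le> C / R\<^sup>2 * cmod (b - a)"
    if "convex T" "\<And>z. z \<in> T \<Longrightarrow> 0 \<le> Im z \<and> R \<le> cmod z" "a \<in> T" "b \<in> T" "0 < R" "K \<le> R" for T R a b
  proof (rule field_differentiable_bound[OF that(1) _ _ that(4,3), where f' = H])
    fix z assume z: "z \<in> T"
    show "(Q has_field_derivative H z) (at z within T)"
      using Q'[OF upS] that(2)[OF z] has_field_derivative_at_within by blast
    have "cmod (H z) \<le> C / (cmod z)\<^sup>2" using bound[of z] that(2)[OF z] that(6) by auto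
    also have "\<dots> \<le> C / R\<^sup>2"
      using that(2)[OF z] that(5) C0 by (intro divide_left_mono power_mono mult_pos_pos zero_less_power) auto
    finally show "cmod (H z) \<le> C / R\<^sup>2" .
  qed
  have Qb: "cmod (Q (of_real R) - Q (of_real (- R))) \<le> 4 * C / R" if R: "0 < R" "K \<le> R" for R
  proof -
    \<comment> \<open>Each of the three sides of the rectangle lies in its own convex part of the
      closed half-plane where the modulus is at least R. There the primitive varies by at most C /
      R^2 times the length.\<close>
    have 1: "cmod (Q (Complex R R) - Q (of_real R)) \<le> C / R\<^sup>2 * cmod (Complex R R - of_real R)"
      by (rule seg[of "{z. R \<le> Re z} \<inter> {z. 0 \<le> Im z}"])
        (use R in \<open>auto intro!: convex_Int convex_halfspace_Re_ge convex_halfspace_Im_ge order_trans[OF _ complex_Re_le_cmod]\<close>)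
    have 2: "cmod (Q (Complex (- R) R) - Q (Complex R R)) \<le> C / R\<^sup>2 * cmod (Complex (- R) R - Complex R R)"
      by (rule seg[of "{z. R \<le> Im z}"])
        (use R in \<open>auto intro!: convex_halfspace_Im_ge order_trans[OF _ abs_Im_le_cmod]\<close>)
    have 3: "cmod (Q (Complex (- R) R) - Q (of_real (- R))) \<le> C / R\<^sup>2 * cmod (Complex (- R) R - of_real (- R))"
      by (rule seg[of "{z. Re z \<le> - R} \<inter> {z. 0 \<le> Im z}"])
        (use R in \<open>auto intro!: convex_Int convex_halfspace_Re_le convex_halfspace_Im_ge order_trans[OF _ abs_Re_le_cmod]\<close>)
    have n: "cmod (Complex R R - of_real R) = R" "cmod (Complex (- R) R - Complex R R) = 2 * R"
      "cmod (Complex (- R) R - of_real (- R)) = R"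
      using R by (simp_all add: cmod_def real_sqrt_mult power2_eq_square)
    have "cmod (Q (of_real R) - Q (of_real (- R))) \<le> C / R\<^sup>2 * R + C / R\<^sup>2 * (2 * R) + C / R\<^sup>2 * R"
    proof -
      have "Q (of_real R) - Q (of_real (- R)) = Q (Complex (- R) R) - Q (of_real (- R))
          - (Q (Complex (- R) R) - Q (Complex R R)) - (Q (Complex R R) - Q (of_real R))" by simp
      from arg_cong[OF this, of cmod] show ?thesis
        using 1 2 3 norm_triangle_ineq4[of "Q (Complex (- R) R) - Q (of_real (- R)) - (Q (Complex (- R) R) - Q (Complex R R))" "Q (Complex R R) - Q (of_real R)"]
          norm_triangle_ineq4[of "Q (Complex (- R) R) - Q (of_real (- R))" "Q (Complex (- R) R) - Q (Complex R R)"]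
        unfolding n by linarith
    qed
    also have "\<dots> = 4 * C / R" using R by (simp add: field_simps power2_eq_square)
    finally show ?thesis .
  qed
  have cH: "continuous_on UNIV (\<lambda>x. H (of_real x))"
    by (rule continuous_on_compose2[OF holomorphic_on_imp_continuous_on[OF H]])
      (use \<delta> in \<open>auto intro!: continuous_intros\<close>)
  have eq: "(LBINT x. indicator {- real n..real n} x *\<^sub>R H (of_real x)) = Q (of_real (real n)) - Q (of_real (- real n))" for n
  proof (rule integral_FTC_Icc)
    show "continuous_on {- real n..real n} (\<lambda>x. H (of_real x))"
      using cH continuous_on_subset by blast
    fix x :: real
    have "((Q \<circ> of_real) has_vector_derivative (1 * H (of_real x))) (at x)"
      by (rule field_vector_diff_chain_at) (use Q'[of "of_real x"] \<delta> in \<open>auto simp: S_def intro!: derivative_eq_intros has_vector_derivative_of_real\<close>)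
    then show "((\<lambda>x. Q (of_real x)) has_vector_derivative H (of_real x)) (at x within {- real n..real n})"
      by (auto simp: o_def intro: has_vector_derivative_at_within)
  qed simp
  have "(\<lambda>n. LBINT x. indicator {- real n..real n} x *\<^sub>R H (of_real x)) \<longlonglongrightarrow> (LBINT x. H (of_real x))"
  proof (rule integral_dominated_convergence[where w = "\<lambda>x. cmod (H (of_real x))"])
    show "AE x in lborel. (\<lambda>n. indicator {- real n..real n} x *\<^sub>R H (of_real x)) \<longlonglongrightarrow> H (of_real x)"
    proof (rule AE_I2)
      fix x :: real
      obtain N where "\<bar>x\<bar> \<le> real N" using real_arch_simple by blast
      then have "\<forall>\<^sub>F n in sequentially. indicator {- real n..real n} x *\<^sub>R H (of_real x) = H (of_real x)"
        unfolding eventually_sequentially by (intro exI[of _ N]) (auto simp: indicator_def)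
      then show "(\<lambda>n. indicator {- real n..real n} x *\<^sub>R H (of_real x)) \<longlonglongrightarrow> H (of_real x)"
        by (rule tendsto_eventually)
    qed
    show "AE x in lborel. cmod (indicator {- real n..real n} x *\<^sub>R H (of_real x)) \<le> cmod (H (of_real x))" for n
      by (rule AE_I2) (auto simp: indicator_def)
  qed (use int borel_measurable_integrable[OF int] in auto)
  moreover have "(\<lambda>n. LBINT x. indicator {- real n..real n} x *\<^sub>R H (of_real x)) \<longlonglongrightarrow> 0"
  proof (rule Lim_null_comparison)
    show "\<forall>\<^sub>F n in sequentially. norm (LBINT x. indicator {- real n..real n} x *\<^sub>R H (of_real x)) \<le> 4 * C / real n"
    proof (rule eventually_sequentiallyI)
      fix n assume "n \<ge> nat \<lceil>max K 1\<rceil>"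
      then have "0 < real n" "K \<le> real n" by linarith+
      then show "norm (LBINT x. indicator {- real n..real n} x *\<^sub>R H (of_real x)) \<le> 4 * C / real n"
        using Qb[of "real n"] unfolding eq by simp
    qed
    show "(\<lambda>n. 4 * C / real n) \<longlonglongrightarrow> 0" by (rule lim_const_over_n)
  qed
  ultimately show ?thesis using LIMSEQ_unique by blast
qed

lemma cmod_square_plus_ge:
  assumes "0 < y" "2 * y \<le> cmod z"
  shows "3 / 4 * (cmod z)\<^sup>2 \<le> cmod (z\<^sup>2 + of_real (y\<^sup>2))"
proof -
  have "(2 * y)\<^sup>2 \<le> (cmod z)\<^sup>2" using assms by (intro power_mono) auto
  moreover have "cmod (z\<^sup>2) - cmod (- of_real (y\<^sup>2)) \<le> cmod (z\<^sup>2 - (- of_real (y\<^sup>2)))" by (rule norm_triangle_ineq2)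
  ultimately show ?thesis by (simp add: norm_power power_mult_distrib)
qed

lemma factor_square_plus: "(z::complex)\<^sup>2 + of_real (y\<^sup>2) = (z - \<i> * of_real y) * (z + \<i> * of_real y)"
  by (simp add: power2_eq_square algebra_simps)

lemma shift_holomorphic_upper_half_plane:
  assumes "g holomorphic_on upper_half_plane"
  shows "(\<lambda>z. g (z + of_real a + \<i> * of_real e)) holomorphic_on {z. Im z > - e}"
proof -
  have "g \<circ> (\<lambda>z. z + of_real a + \<i> * of_real e) holomorphic_on {z. Im z > - e}"
    by (rule holomorphic_on_compose_gen[OF _ assms]) (auto simp: upper_half_plane_def intro!: holomorphic_intros)
  then show ?thesis by (simp add: o_def)
qed

lemma pole_quotient_holomorphic:
  assumes "f holomorphic_on S" "open S" "a \<in> S"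
  obtains h where "h holomorphic_on S" "h a = deriv f a" "\<And>z. z \<noteq> a \<Longrightarrow> h z = (f z - f a) / (z - a)"
  using pole_lemma[of f S a] assms that[of "\<lambda>z. if z = a then deriv f a else (f z - f a) / (z - a)"]
  by (auto simp: interior_open)

text \<open>Subtracting the value of the shifted function at a = i y cancels the only pole in the
  closed half-plane and keeps decay of order |z|^-2, so the integral vanishes. The subtracted
  constant contributes its multiple of pi / y.\<close>

lemma Poisson_line:
  assumes g: "g holomorphic_on upper_half_plane" and M: "\<And>z. z \<in> upper_half_plane \<Longrightarrow> cmod (g z) \<le> M"
    and e: "0 < e" and y: "0 < y"
  shows "integrable lborel (\<lambda>x. g (Complex x e) / of_real (x\<^sup>2 + y\<^sup>2))"
    and "(LBINT x. g (Complex x e) / of_real (x\<^sup>2 + y\<^sup>2)) = of_real (pi / y) * g (\<i> * of_real (y + e))"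
proof -
  define G where "G = (\<lambda>z. g (z + of_real 0 + \<i> * of_real e))"
  define S where "S = {z. Im z > - e}"
  \<comment> \<open>Holomorphy slightly below the real line is limited by the shift e on one side
    and by the uncancelled pole at - i y on the other.\<close>
  define S' where "S' = {z. Im z > - min e y}"
  define a where "a = \<i> * complex_of_real y"
  have G: "G holomorphic_on S" unfolding G_def S_def by (rule shift_holomorphic_upper_half_plane[OF g])
  have openS: "open S" by (simp add: S_def open_halfspace_Im_gt)
  have GM: "cmod (G z) \<le> M" if "0 \<le> Im z" for z
    using M[of "z + of_real 0 + \<i> * of_real e"] that e by (simp add: G_def upper_half_plane_def)
  have aS: "a \<in> S" using e y by (simp add: a_def S_def)
  obtain h where h: "h holomorphic_on S" "\<And>z. z \<noteq> a \<Longrightarrow> h z = (G z - G a) / (z - a)"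
    using pole_quotient_holomorphic[OF G openS aS] by blast
  define H where "H = (\<lambda>z. h z / (z + a))"
  have za: "z + a \<noteq> 0" if "z \<in> S'" for z
  proof
    assume "z + a = 0"
    then have "Im (z + a) = 0" by simp
    then show False using that by (auto simp: S'_def a_def)
  qed
  have HH: "H holomorphic_on S'"
    unfolding H_def by (intro holomorphic_intros holomorphic_on_subset[OF h(1)]) (use za in \<open>auto simp: S'_def S_def\<close>)
  have Heq: "H z = (G z - G a) / (z\<^sup>2 + of_real (y\<^sup>2))" if "z \<noteq> a" for z
    unfolding factor_square_plus H_def h(2)[OF that] by (simp add: a_def)
  have Im_a: "Im a = y" by (simp add: a_def)
  have Hreal: "H (of_real x) = (G (of_real x) - G a) / of_real (x\<^sup>2 + y\<^sup>2)" for x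
    using Heq[of "of_real x"] Im_a y by (metis Im_complex_of_real less_irrefl of_real_add of_real_power)
  have pos: "0 < x\<^sup>2 + y\<^sup>2" for x using y by (simp add: add_nonneg_pos)
  have Gx: "G (of_real x) = g (Complex x e)" for x by (simp add: G_def complex_eq_iff Complex_eq)
  have "continuous_on UNIV (\<lambda>x::real. G (of_real x))"
    by (rule continuous_on_compose2[OF holomorphic_on_imp_continuous_on[OF G]])
      (use e in \<open>auto simp: S_def intro!: continuous_intros\<close>)
  then have mG: "(\<lambda>x::real. G (of_real x)) \<in> borel_measurable lborel"
    using borel_measurable_continuous_onI by simp
  have iM: "integrable lborel (\<lambda>x. M * (Cauchy_kernel y x))"
    using integrable_Cauchy_kernel(1)[OF y] by (rule integrable_mult_right)
  show i1: "integrable lborel (\<lambda>x. g (Complex x e) / of_real (x\<^sup>2 + y\<^sup>2))"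
    unfolding Gx[symmetric]
  proof (rule Bochner_Integration.integrable_bound[OF iM])
    show "(\<lambda>x. G (of_real x) / of_real (x\<^sup>2 + y\<^sup>2)) \<in> borel_measurable lborel" using mG by measurable
    have "cmod (G (of_real x) / of_real (x\<^sup>2 + y\<^sup>2)) \<le> norm (M * (Cauchy_kernel y x))" for x
    proof -
      have "cmod (G (of_real x) / of_real (x\<^sup>2 + y\<^sup>2)) = cmod (G (of_real x)) / (x\<^sup>2 + y\<^sup>2)"
        using pos[of x] by (simp only: norm_divide norm_of_real abs_of_pos)
      also have "\<dots> \<le> M / (x\<^sup>2 + y\<^sup>2)" using GM[of "of_real x"] pos[of x] by (intro divide_right_mono) auto
      also have "\<dots> = norm (M * (Cauchy_kernel y x))"
        using order_trans[OF norm_ge_zero GM[of a]] Im_a y pos[of x] by simp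
      finally show ?thesis .
    qed
    then show "AE x in lborel. norm (G (of_real x) / of_real (x\<^sup>2 + y\<^sup>2)) \<le> norm (M * (Cauchy_kernel y x))" by simp
  qed
  have hb: "has_bochner_integral lborel (\<lambda>x. complex_of_real (Cauchy_kernel y x)) (of_real (pi / y))"
    using integrable_Cauchy_kernel[OF y] by (intro has_bochner_integral_of_real) (simp add: has_bochner_integral_iff)
  have i2: "has_bochner_integral lborel (\<lambda>x. G a * of_real (Cauchy_kernel y x)) (G a * of_real (pi / y))"
    by (rule has_bochner_integral_mult_right[OF hb])
  have i3: "has_bochner_integral lborel (\<lambda>x. g (Complex x e) / of_real (x\<^sup>2 + y\<^sup>2) - G a * of_real (Cauchy_kernel y x))
    ((LBINT x. g (Complex x e) / of_real (x\<^sup>2 + y\<^sup>2)) - G a * of_real (pi / y))"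
    by (intro has_bochner_integral_diff has_bochner_integral_integrable i1 i2)
  have HI: "(\<lambda>x. H (of_real x)) = (\<lambda>x. g (Complex x e) / of_real (x\<^sup>2 + y\<^sup>2) - G a * of_real (Cauchy_kernel y x))"
    by (rule ext) (simp add: Hreal Gx diff_divide_distrib)
  have "(LBINT x. H (of_real x)) = 0"
  proof (rule line_integral_zero[OF HH[unfolded S'_def], where K = "2 * y" and C = "2 * M * (4 / 3)"])
    show "0 < min e y" using e y by simp
    show "integrable lborel (\<lambda>x. H (of_real x))"
      using i3 unfolding HI has_bochner_integral_iff by blast
    fix z assume z: "0 \<le> Im z" "2 * y \<le> cmod z"
    have "z \<noteq> a" using z y by (auto simp: a_def norm_mult)
    have zpos: "0 < (cmod z)\<^sup>2" using z y by (intro zero_less_power) linarith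
    have "cmod (H z) = cmod (G z - G a) / cmod (z\<^sup>2 + of_real (y\<^sup>2))"
      unfolding Heq[OF \<open>z \<noteq> a\<close>] by (rule norm_divide)
    also have "\<dots> \<le> (2 * M) / (3 / 4 * (cmod z)\<^sup>2)"
    proof (rule frac_le)
      show "cmod (G z - G a) \<le> 2 * M"
        using norm_triangle_ineq4[of "G z" "G a"] GM[OF z(1)] GM[of a] Im_a y by simp
      then show "0 \<le> 2 * M" using norm_ge_zero order_trans by blast
    qed (use zpos cmod_square_plus_ge[OF y z(2)] in auto)
    finally show "cmod (H z) \<le> 2 * M * (4 / 3) / (cmod z)\<^sup>2" by simp
  qed
  then have "(LBINT x. g (Complex x e) / of_real (x\<^sup>2 + y\<^sup>2)) - G a * of_real (pi / y) = 0"
    using i3 unfolding HI has_bochner_integral_iff by simp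
  moreover have "G a = g (\<i> * of_real (y + e))" by (simp add: G_def a_def algebra_simps)
  ultimately show "(LBINT x. g (Complex x e) / of_real (x\<^sup>2 + y\<^sup>2)) = of_real (pi / y) * g (\<i> * of_real (y + e))"
    by (simp add: mult.commute)
qed

section \<open>Vertical boundary limits\<close>

lemma odd_Cauchy_kernel_le:
  fixes t y :: real
  assumes "0 < y"
  shows "square_kernel y t \<le> Cauchy_kernel y t" "\<bar>odd_kernel y t\<bar> \<le> 1 / (2 * y) * (Cauchy_kernel y t)"
proof -
  have pos: "0 < t\<^sup>2 + y\<^sup>2" using assms by (simp add: add_nonneg_pos)
  have "square_kernel y t \<le> (t\<^sup>2 + y\<^sup>2) / (t\<^sup>2 + y\<^sup>2)\<^sup>2" by (intro divide_right_mono) auto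
  also have "\<dots> = Cauchy_kernel y t" using pos by (simp add: power2_eq_square)
  finally show "square_kernel y t \<le> Cauchy_kernel y t" .
  have "0 \<le> (\<bar>t\<bar> - y)\<^sup>2" by simp
  then have "2 * y * \<bar>t\<bar> \<le> t\<^sup>2 + y\<^sup>2" by (simp add: power2_diff mult_ac)
  then have "\<bar>t\<bar> \<le> (t\<^sup>2 + y\<^sup>2) / (2 * y)" using assms by (simp add: field_simps)
  then have "\<bar>t\<bar> / (t\<^sup>2 + y\<^sup>2)\<^sup>2 \<le> ((t\<^sup>2 + y\<^sup>2) / (2 * y)) / (t\<^sup>2 + y\<^sup>2)\<^sup>2" by (intro divide_right_mono) auto
  also have "\<dots> = 1 / (2 * y) * (Cauchy_kernel y t)" using pos by (simp add: power2_eq_square)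
  finally show "\<bar>odd_kernel y t\<bar> \<le> 1 / (2 * y) * (Cauchy_kernel y t)" by (simp add: abs_divide)
qed

lemma integrable_square_kernel:
  assumes "0 < y" shows "integrable lborel (\<lambda>t::real. square_kernel y t)"
  by (rule Bochner_Integration.integrable_bound[OF integrable_Cauchy_kernel(1)[OF assms]])
    (use odd_Cauchy_kernel_le(1)[OF assms] in auto)

lemma odd_kernel_integral:
  assumes "0 < y" shows "has_bochner_integral lborel (\<lambda>t::real. odd_kernel y t) 0"
proof -
  have i: "integrable lborel (\<lambda>t::real. odd_kernel y t)"
    by (rule Bochner_Integration.integrable_bound[OF integrable_mult_right[OF integrable_Cauchy_kernel(1)[OF assms], of "1 / (2 * y)"]])
      (use odd_Cauchy_kernel_le(2)[OF assms] assms in \<open>auto simp: abs_mult abs_divide\<close>)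
  have "(LBINT t::real. odd_kernel y t) = - (LBINT t::real. odd_kernel y t)"
    using lborel_integral_real_affine[of "-1" "\<lambda>t::real. odd_kernel y t" 0] by simp
  then show ?thesis using i by (simp add: has_bochner_integral_iff)
qed

text \<open>The kernel is \<open>1/(t - i y)\<^sup>2 - 1/(t + i y)\<^sup>2\<close> up to a factor: it reproduces \<open>F'\<close> and, unlike
  \<open>1/(t - i y)\<^sup>2\<close> alone, makes the difference quotients of \<open>F\<close> appear against an integrable weight.\<close>

lemma primitive_kernel_line:
  assumes F: "\<And>z. z \<in> upper_half_plane \<Longrightarrow> (F has_field_derivative f z) (at z)"
    and f1: "\<And>z. z \<in> upper_half_plane \<Longrightarrow> cmod (f z) \<le> 1"
    and Lip: "\<And>z w. z \<in> upper_half_plane \<Longrightarrow> w \<in> upper_half_plane \<Longrightarrow> cmod (F z - F w) \<le> cmod (z - w)"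
    and e: "0 < e" and y: "0 < y"
  shows "(LBINT t. (F (Complex (x0 + t) e) - F (Complex x0 e)) * of_real (odd_kernel y t))
    = f (Complex x0 (y + e)) * of_real (LBINT t. square_kernel y t)"
proof -
  define G where "G = (\<lambda>z. F (z + of_real x0 + \<i> * of_real e))"
  define S where "S = {z. Im z > - e}"
  define S' where "S' = {z. Im z > - min e y}"
  define a where "a = \<i> * complex_of_real y"
  define D where "D = f (Complex x0 (y + e))"
  have Fhol: "F holomorphic_on upper_half_plane"
    using F by (auto simp: holomorphic_on_open[OF open_upper_half_plane])
  have G: "G holomorphic_on S" unfolding G_def S_def by (rule shift_holomorphic_upper_half_plane[OF Fhol])
  have openS: "open S" by (simp add: S_def open_halfspace_Im_gt)
  have aS: "a \<in> S" using e y by (simp add: a_def S_def)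
  have Im_a: "Im a = y" by (simp add: a_def)
  have up: "z + of_real x0 + \<i> * of_real e \<in> upper_half_plane" if "0 \<le> Im z" for z
    using that e by (simp add: upper_half_plane_def)
  have GL: "cmod (G z - G w) \<le> cmod (z - w)" if "0 \<le> Im z" "0 \<le> Im w" for z w
    using Lip[OF up[OF that(1)] up[OF that(2)]] by (simp add: G_def)
  have D1: "cmod D \<le> 1" unfolding D_def using f1 e y by (simp add: upper_half_plane_def)
  have "(G has_field_derivative D) (at a)"
  proof -
    have "((\<lambda>z. F (z + (of_real x0 + \<i> * of_real e))) has_field_derivative f (a + (of_real x0 + \<i> * of_real e))) (at a)"
      using F[OF up[of a]] Im_a y by (simp add: DERIV_shift add.assoc)
    moreover have "a + (of_real x0 + \<i> * of_real e) = Complex x0 (y + e)" by (simp add: a_def complex_eq_iff)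
    ultimately show ?thesis by (simp add: G_def D_def add.assoc)
  qed
  then have dG: "deriv G a = D" by (rule DERIV_imp_deriv)
  \<comment> \<open>The kernel has double poles, so the first-order Taylor polynomial at
    \<open>a\<close> is removed, by dividing twice.\<close>
  obtain h1 where h1: "h1 holomorphic_on S" "h1 a = D" "\<And>z. z \<noteq> a \<Longrightarrow> h1 z = (G z - G a) / (z - a)"
    using pole_quotient_holomorphic[OF G openS aS] dG by metis
  obtain h2 where h2: "h2 holomorphic_on S" "\<And>z. z \<noteq> a \<Longrightarrow> h2 z = (h1 z - D) / (z - a)"
    using pole_quotient_holomorphic[OF h1(1) openS aS] h1(2) by metis
  define H where "H = (\<lambda>z. h2 z * z / (z + a)\<^sup>2)"
  have za: "z + a \<noteq> 0" if "z \<in> S'" for z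
  proof
    assume "z + a = 0"
    then have "Im (z + a) = 0" by simp
    then show False using that by (auto simp: S'_def a_def)
  qed
  have HH: "H holomorphic_on S'"
    unfolding H_def by (intro holomorphic_intros holomorphic_on_subset[OF h2(1)]) (use za in \<open>auto simp: S'_def S_def\<close>)
  have Heq: "H z = (G z - G a - D * (z - a)) * z / (z\<^sup>2 + of_real (y\<^sup>2))\<^sup>2" if "z \<noteq> a" for z
  proof -
    have "h2 z = (G z - G a - D * (z - a)) / (z - a)\<^sup>2"
      unfolding h2(2)[OF that] h1(3)[OF that] using that by (simp add: field_simps power2_eq_square)
    then show ?thesis
      unfolding factor_square_plus H_def by (simp add: a_def power_mult_distrib)
  qed
  have pos: "0 < x\<^sup>2 + y\<^sup>2" for x using y by (simp add: add_nonneg_pos)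
  define k where "k = (\<lambda>t::real. odd_kernel y t)"
  define k2 where "k2 = (\<lambda>t::real. square_kernel y t)"
  \<comment> \<open>All constants multiply the odd kernel and integrate to 0. The linear term D x
    turns the odd kernel into the square kernel, which produces the right-hand side.\<close>
  have Hreal: "H (of_real x) = (G (of_real x) - G 0) * of_real (k x) + ((G 0 - G a + D * a) * of_real (k x) - D * of_real (k2 x))" for x
  proof -
    have "of_real x \<noteq> a" using Im_a y by auto
    then show ?thesis
      by (simp add: Heq k_def k2_def flip: of_real_power of_real_add)
        (simp add: add_divide_distrib[symmetric] diff_divide_distrib[symmetric] power2_eq_square algebra_simps)
  qed
  have GF: "G (of_real x) = F (Complex (x0 + x) e)" for x
    by (simp add: G_def Complex_eq algebra_simps)
  have "continuous_on UNIV (\<lambda>x::real. G (of_real x))"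
    by (rule continuous_on_compose2[OF holomorphic_on_imp_continuous_on[OF G]])
      (use e in \<open>auto simp: S_def intro!: continuous_intros\<close>)
  then have mG: "(\<lambda>x::real. G (of_real x)) \<in> borel_measurable lborel"
    using borel_measurable_continuous_onI by simp
  have i1: "integrable lborel (\<lambda>x. (G (of_real x) - G 0) * of_real (k x))"
  proof (rule Bochner_Integration.integrable_bound[OF integrable_square_kernel[OF y]])
    show "(\<lambda>x. (G (of_real x) - G 0) * of_real (k x)) \<in> borel_measurable lborel"
      using mG unfolding k_def by measurable
    have "cmod ((G (of_real x) - G 0) * of_real (k x)) \<le> norm (square_kernel y x)" for x
    proof -
      have "cmod (G (of_real x) - G 0) * \<bar>k x\<bar> \<le> \<bar>x\<bar> * \<bar>k x\<bar>"
        using GL[of "of_real x" 0] by (intro mult_right_mono) auto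
      also have "\<bar>x\<bar> * \<bar>k x\<bar> = norm (square_kernel y x)"
        by (simp add: k_def abs_mult[symmetric] power2_eq_square)
      finally show ?thesis by (simp only: norm_mult norm_of_real)
    qed
    then show "AE x in lborel. norm ((G (of_real x) - G 0) * of_real (k x)) \<le> norm (square_kernel y x)" by simp
  qed
  have i2: "has_bochner_integral lborel (\<lambda>x. (G 0 - G a + D * a) * complex_of_real (k x)) ((G 0 - G a + D * a) * of_real 0)"
    unfolding k_def by (intro has_bochner_integral_mult_right has_bochner_integral_of_real odd_kernel_integral y)
  have i3: "has_bochner_integral lborel (\<lambda>x. D * complex_of_real (k2 x)) (D * of_real (LBINT t. k2 t))"
    unfolding k2_def by (intro has_bochner_integral_mult_right has_bochner_integral_of_real has_bochner_integral_integrable integrable_square_kernel y)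
  have hI: "has_bochner_integral lborel (\<lambda>x. H (of_real x)) ((LBINT x. (G (of_real x) - G 0) * of_real (k x))
     + ((G 0 - G a + D * a) * of_real 0 - D * of_real (LBINT t. k2 t)))"
    unfolding Hreal by (intro has_bochner_integral_add has_bochner_integral_diff i2 i3 has_bochner_integral_integrable i1)
  have "(LBINT x. H (of_real x)) = 0"
  proof (rule line_integral_zero[OF HH[unfolded S'_def], where K = "2 * y" and C = "3 * (16 / 9)"])
    show "0 < min e y" using e y by simp
    show "integrable lborel (\<lambda>x. H (of_real x))" using hI by (simp add: has_bochner_integral_iff)
    fix z assume z: "0 \<le> Im z" "2 * y \<le> cmod z"
    have "z \<noteq> a" using z y by (auto simp: a_def norm_mult)
    have zpos: "0 < cmod z" using z y by linarith
    \<comment> \<open>The Lipschitz bound makes the Taylor remainder at most 2 |z - a|, hence 3 |z|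
      as y is at most |z| / 2. With the factor z of the kernel the quotient by |z|^4 decays like
      |z|^-2.\<close>
    have n: "cmod (G z - G a - D * (z - a)) \<le> 3 * cmod z"
    proof -
      have "cmod (G z - G a - D * (z - a)) \<le> cmod (G z - G a) + cmod D * cmod (z - a)"
        by (metis norm_triangle_ineq4 norm_mult)
      also have "\<dots> \<le> cmod (z - a) + 1 * cmod (z - a)"
        using GL[of z a] D1 z Im_a y by (intro add_mono mult_right_mono) auto
      also have "cmod (z - a) \<le> cmod z + y"
        using norm_triangle_ineq4[of z a] y by (simp add: a_def norm_mult)
      finally show ?thesis using z by simp
    qed
    have "cmod (H z) = (cmod (G z - G a - D * (z - a)) * cmod z) / (cmod (z\<^sup>2 + of_real (y\<^sup>2)))\<^sup>2"
      unfolding Heq[OF \<open>z \<noteq> a\<close>] by (simp add: norm_divide norm_mult norm_power)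
    also have "\<dots> \<le> (3 * cmod z * cmod z) / (3 / 4 * (cmod z)\<^sup>2)\<^sup>2"
      using n zpos cmod_square_plus_ge[OF y z(2)] by (intro frac_le mult_right_mono power_mono) auto
    also have "\<dots> = 3 * (16 / 9) / (cmod z)\<^sup>2" using zpos by (simp add: power2_eq_square field_simps)
    finally show "cmod (H z) \<le> 3 * (16 / 9) / (cmod z)\<^sup>2" .
  qed
  then have "(LBINT x. (G (of_real x) - G 0) * of_real (k x)) = D * of_real (LBINT t. k2 t)"
    using hI by (simp add: has_bochner_integral_iff)
  then show ?thesis
    using GF[of 0] by (simp add: GF D_def k_def k2_def)
qed

lemma square_kernel_integral_pos: "0 < (LBINT s::real. square_kernel 1 s)"
proof -
  have "(LBINT s::real. square_kernel 1 s) \<noteq> 0"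
  proof
    assume "(LBINT s::real. square_kernel 1 s) = 0"
    then have "AE s::real in lborel. square_kernel 1 s = 0"
      using integral_nonneg_eq_0_iff_AE[OF integrable_square_kernel[of 1]] by simp
    then have "AE s::real in lborel. s = 0"
    proof (rule AE_mp, intro AE_I2 impI)
      fix s :: real assume "square_kernel 1 s = 0"
      moreover have "s\<^sup>2 + 1\<^sup>2 > 0" by (simp add: add_nonneg_pos)
      ultimately show "s = 0" by auto
    qed
    moreover have "AE s::real in lborel. s \<noteq> 0" by (rule AE_lborel_singleton)
    ultimately have "AE s::real in lborel. False" by eventually_elim auto
    then show False by (simp add: eventually_False ae_filter_eq_bot_iff)
  qed
  then show ?thesis by (simp add: less_le)
qed

text \<open>Up to the constant \<open>c\<close>, the value of \<open>f\<close> at height y is the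
  average of the difference quotients of the trace at \<open>x0\<close>, taken at scale y against a
  fixed integrable weight. These quotients are bounded by 1, so differentiability at the single
  point \<open>x0\<close> passes through dominated convergence.\<close>

lemma vertical_limit_of_differentiable_trace:
  assumes F: "\<And>z. z \<in> upper_half_plane \<Longrightarrow> (F has_field_derivative f z) (at z)"
    and fhol: "f holomorphic_on upper_half_plane"
    and f1: "\<And>z. z \<in> upper_half_plane \<Longrightarrow> cmod (f z) \<le> 1"
    and Lip: "\<And>z w. z \<in> upper_half_plane \<Longrightarrow> w \<in> upper_half_plane \<Longrightarrow> cmod (F z - F w) \<le> cmod (z - w)"
    and trace: "\<And>x. (\<lambda>n. F (Complex x (1 / real (Suc n)))) \<longlonglongrightarrow> \<Phi> x"
    and \<Phi>L: "\<And>x x'. cmod (\<Phi> x - \<Phi> x') \<le> \<bar>x - x'\<bar>"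
    and lim: "((\<lambda>h. (\<Phi> (x0 + h) - \<Phi> x0) / of_real h) \<longlongrightarrow> l) (at 0)"
  shows "((\<lambda>y. f (Complex x0 y)) \<longlongrightarrow> l) (at_right 0)"
proof -
  have "1-lipschitz_on UNIV \<Phi>"
    using \<Phi>L by (intro lipschitz_onI) (auto simp: dist_norm)
  then have c\<Phi>: "continuous_on UNIV \<Phi>" by (rule lipschitz_on_continuous_on)
  then have m\<Phi>: "\<Phi> \<in> borel_measurable borel" by (rule borel_measurable_continuous_onI)
  have Fcont: "continuous_on upper_half_plane F"
    using F DERIV_isCont by (blast intro: continuous_at_imp_continuous_on)
  \<comment> \<open>The line formula is moved down to the real axis. The Lipschitz bound dominates
    the integrands by the square kernel, uniformly in the height of the line.\<close>
  have step1: "(LBINT t. (\<Phi> (x0 + t) - \<Phi> x0) * of_real (odd_kernel y t))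
    = f (Complex x0 y) * of_real (LBINT t. square_kernel y t)" if y: "0 < y" for y
  proof -
    have "(\<lambda>n. LBINT t. (F (Complex (x0 + t) (1 / real (Suc n))) - F (Complex x0 (1 / real (Suc n)))) * of_real (odd_kernel y t))
      \<longlonglongrightarrow> (LBINT t. (\<Phi> (x0 + t) - \<Phi> x0) * of_real (odd_kernel y t))"
    proof (rule integral_dominated_convergence[OF _ _ integrable_square_kernel[OF y]])
      show "(\<lambda>t. (\<Phi> (x0 + t) - \<Phi> x0) * of_real (odd_kernel y t)) \<in> borel_measurable lborel"
        using m\<Phi> by measurable
      fix n :: nat
      have "continuous_on UNIV (\<lambda>t. F (Complex (x0 + t) (1 / real (Suc n))))"
        by (rule continuous_on_compose2[OF Fcont]) (auto simp: upper_half_plane_def Complex_eq intro!: continuous_intros)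
      then have "(\<lambda>t. F (Complex (x0 + t) (1 / real (Suc n)))) \<in> borel_measurable borel"
        by (rule borel_measurable_continuous_onI)
      then show "(\<lambda>t. (F (Complex (x0 + t) (1 / real (Suc n))) - F (Complex x0 (1 / real (Suc n)))) * of_real (odd_kernel y t)) \<in> borel_measurable lborel"
        by measurable
      show "AE t in lborel. norm ((F (Complex (x0 + t) (1 / real (Suc n))) - F (Complex x0 (1 / real (Suc n)))) * of_real (odd_kernel y t)) \<le> square_kernel y t"
      proof (rule AE_I2)
        fix t :: real
        have "Complex (x0 + t) (1 / real (Suc n)) - Complex x0 (1 / real (Suc n)) = of_real t"
          by (simp add: complex_eq_iff)
        then have "cmod (F (Complex (x0 + t) (1 / real (Suc n))) - F (Complex x0 (1 / real (Suc n)))) \<le> \<bar>t\<bar>"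
          using Lip[of "Complex (x0 + t) (1 / real (Suc n))" "Complex x0 (1 / real (Suc n))"]
          by (simp add: upper_half_plane_def)
        then have "cmod (F (Complex (x0 + t) (1 / real (Suc n))) - F (Complex x0 (1 / real (Suc n)))) * \<bar>odd_kernel y t\<bar> \<le> \<bar>t\<bar> * \<bar>odd_kernel y t\<bar>"
          by (intro mult_right_mono) auto
        also have "\<dots> = square_kernel y t" by (simp add: abs_mult[symmetric] power2_eq_square)
        finally show "norm ((F (Complex (x0 + t) (1 / real (Suc n))) - F (Complex x0 (1 / real (Suc n)))) * of_real (odd_kernel y t)) \<le> square_kernel y t"
          by (simp only: norm_mult norm_of_real)
      qed
    qed (intro AE_I2 tendsto_intros trace)
    moreover have "(\<lambda>n. LBINT t. (F (Complex (x0 + t) (1 / real (Suc n))) - F (Complex x0 (1 / real (Suc n)))) * of_real (odd_kernel y t))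
      = (\<lambda>n. f (Complex x0 (y + 1 / real (Suc n))) * of_real (LBINT t. square_kernel y t))"
      by (rule ext, rule primitive_kernel_line[OF F f1 Lip _ y]) auto
    moreover have "(\<lambda>n. f (Complex x0 (y + 1 / real (Suc n))) * of_real (LBINT t. square_kernel y t)) \<longlonglongrightarrow>
      f (Complex x0 y) * of_real (LBINT t. square_kernel y t)"
    proof (intro tendsto_mult tendsto_const)
      have "(\<lambda>n. y + 1 / real (Suc n)) \<longlonglongrightarrow> y + 0"
        by (intro tendsto_intros LIMSEQ_Suc[OF lim_const_over_n[of 1, simplified]])
      then have "(\<lambda>n. Complex x0 (y + 1 / real (Suc n))) \<longlonglongrightarrow> Complex x0 y"
        by (intro tendsto_Complex tendsto_const) simp
      then show "(\<lambda>n. f (Complex x0 (y + 1 / real (Suc n)))) \<longlonglongrightarrow> f (Complex x0 y)"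
        by (rule continuous_on_tendsto_compose[OF holomorphic_on_imp_continuous_on[OF fhol]])
          (use y in \<open>auto simp: upper_half_plane_def add_pos_pos\<close>)
    qed
    ultimately show ?thesis using LIMSEQ_unique by fastforce
  qed
  define c where "c = (LBINT s::real. square_kernel 1 s)"
  have c: "0 < c" unfolding c_def by (rule square_kernel_integral_pos)
  define q where "q = (\<lambda>h. (\<Phi> (x0 + h) - \<Phi> x0) / of_real h)"
  \<comment> \<open>Substituting t = y s scales both sides like 1 / y, so y survives only inside the
    difference quotient.\<close>
  have step2: "(LBINT s. q (y * s) * of_real (square_kernel 1 s)) = f (Complex x0 y) * of_real c" if y: "0 < y" for y
  proof -
    have den: "((y * s)\<^sup>2 + y\<^sup>2)\<^sup>2 = y ^ 4 * (s\<^sup>2 + 1\<^sup>2)\<^sup>2" for s :: real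
      by (simp add: power2_eq_square power4_eq_xxxx algebra_simps)
    have "(LBINT t. square_kernel y t) = y * (LBINT s. (y * s)\<^sup>2 / ((y * s)\<^sup>2 + y\<^sup>2)\<^sup>2)"
      using lborel_integral_real_affine[of y "\<lambda>t. square_kernel y t" 0] y by simp
    also have "(\<lambda>s::real. (y * s)\<^sup>2 / ((y * s)\<^sup>2 + y\<^sup>2)\<^sup>2) = (\<lambda>s. 1 / y\<^sup>2 * (square_kernel 1 s))"
      unfolding den using y by (intro ext) (simp add: power_mult_distrib power2_eq_square power4_eq_xxxx)
    also have "y * (LBINT s. 1 / y\<^sup>2 * (square_kernel 1 s)) = y * (1 / y\<^sup>2 * c)"
      unfolding c_def integral_mult_right_zero ..
    also have "\<dots> = c / y" using y by (simp add: power2_eq_square)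
    finally have R: "(LBINT t. square_kernel y t) = c / y" .
    have "(LBINT t. (\<Phi> (x0 + t) - \<Phi> x0) * of_real (odd_kernel y t))
      = y *\<^sub>R (LBINT s. (\<Phi> (x0 + y * s) - \<Phi> x0) * of_real (y * s / ((y * s)\<^sup>2 + y\<^sup>2)\<^sup>2))"
      using lborel_integral_real_affine[of y "\<lambda>t. (\<Phi> (x0 + t) - \<Phi> x0) * of_real (odd_kernel y t)" 0] y by simp
    also have "(\<lambda>s. (\<Phi> (x0 + y * s) - \<Phi> x0) * complex_of_real (y * s / ((y * s)\<^sup>2 + y\<^sup>2)\<^sup>2))
      = (\<lambda>s. of_real (1 / y\<^sup>2) * (q (y * s) * of_real (square_kernel 1 s)))"
    proof
      fix s :: real
      show "(\<Phi> (x0 + y * s) - \<Phi> x0) * complex_of_real (y * s / ((y * s)\<^sup>2 + y\<^sup>2)\<^sup>2)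
        = of_real (1 / y\<^sup>2) * (q (y * s) * of_real (square_kernel 1 s))"
      proof (cases "s = 0")
        case False
        have "y * s / ((y * s)\<^sup>2 + y\<^sup>2)\<^sup>2 = 1 / (y * s) * (1 / y\<^sup>2 * (square_kernel 1 s))"
          unfolding den using y False by (simp add: power2_eq_square power4_eq_xxxx)
        then show ?thesis by (simp only: q_def of_real_mult of_real_divide) (simp add: divide_inverse mult_ac)
      qed simp
    qed
    also have "y *\<^sub>R (LBINT s. of_real (1 / y\<^sup>2) * (q (y * s) * of_real (square_kernel 1 s)))
      = of_real y * (of_real (1 / y\<^sup>2) * (LBINT s. q (y * s) * of_real (square_kernel 1 s)))"
      unfolding integral_mult_right_zero scaleR_conv_of_real ..
    also have "\<dots> = of_real (y * (1 / y\<^sup>2)) * (LBINT s. q (y * s) * of_real (square_kernel 1 s))"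
      by (simp only: of_real_mult mult.assoc)
    also have "y * (1 / y\<^sup>2) = 1 / y" using y by (simp add: power2_eq_square)
    finally have "(LBINT t. (\<Phi> (x0 + t) - \<Phi> x0) * of_real (odd_kernel y t))
      = of_real (1 / y) * (LBINT s. q (y * s) * of_real (square_kernel 1 s))" .
    then have "of_real (1 / y) * (LBINT s. q (y * s) * of_real (square_kernel 1 s)) = of_real (1 / y) * (f (Complex x0 y) * of_real c)"
      using step1[OF y] R by (simp add: mult_ac)
    then show ?thesis using y by (subst (asm) mult_cancel_left) auto
  qed
  have q1: "cmod (q h) \<le> 1" for h
    using \<Phi>L[of "x0 + h" x0] by (cases "h = 0") (auto simp: q_def norm_divide)
  have mq: "q \<in> borel_measurable borel" unfolding q_def using m\<Phi> by measurable
  \<comment> \<open>The height is written as \<open>inverse T\<close>, which turns the limit at 0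
    from the right into one at infinity.\<close>
  have "((\<lambda>T. LBINT s. q (inverse T * s) * of_real (square_kernel 1 s)) \<longlongrightarrow> (LBINT s. l * complex_of_real (square_kernel 1 s))) at_top"
  proof (rule integral_dominated_convergence_at_top[OF _ _ integrable_square_kernel[OF zero_less_one]])
    show "(\<lambda>s. q (inverse T * s) * of_real (square_kernel 1 s)) \<in> borel_measurable lborel" for T
      using mq by measurable
    show "\<forall>\<^sub>F T in at_top. AE s in lborel. norm (q (inverse T * s) * of_real (square_kernel 1 s)) \<le> square_kernel 1 s"
    proof (intro always_eventually allI AE_I2)
      fix T s :: real
      have "norm (q (inverse T * s) * of_real (square_kernel 1 s)) = cmod (q (inverse T * s)) * (square_kernel 1 s)"
        unfolding norm_mult norm_of_real by simp
      also have "\<dots> \<le> 1 * (square_kernel 1 s)" using q1 by (intro mult_right_mono) auto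
      finally show "norm (q (inverse T * s) * of_real (square_kernel 1 s)) \<le> square_kernel 1 s" by simp
    qed
    \<comment> \<open>The point s = 0 must be left out: there division by zero gives the quotient
      the value 0 instead of \<open>l\<close>.\<close>
    have ql: "((\<lambda>T. q (inverse T * s)) \<longlongrightarrow> l) at_top" if "s \<noteq> 0" for s
    proof (rule filterlim_compose[OF lim[folded q_def]])
      have "((\<lambda>T. inverse T * s) \<longlongrightarrow> 0 * s) at_top"
        by (intro tendsto_mult tendsto_const tendsto_inverse_0_at_top filterlim_ident)
      moreover have "\<forall>\<^sub>F T in at_top. inverse T * s \<noteq> 0"
        using eventually_gt_at_top[of 0] by eventually_elim (use that in auto)
      ultimately show "filterlim (\<lambda>T. inverse T * s) (at 0) at_top" by (auto simp: filterlim_at)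
    qed
    show "AE s in lborel. ((\<lambda>T. q (inverse T * s) * of_real (square_kernel 1 s)) \<longlongrightarrow> l * complex_of_real (square_kernel 1 s)) at_top"
    proof (rule AE_mp[OF AE_lborel_singleton[of 0]], rule AE_I2, rule impI)
      fix s :: real assume "s \<noteq> 0"
      then show "((\<lambda>T. q (inverse T * s) * of_real (square_kernel 1 s)) \<longlongrightarrow> l * complex_of_real (square_kernel 1 s)) at_top"
        by (intro tendsto_mult ql tendsto_const)
    qed
  qed simp
  then have "((\<lambda>T. LBINT s. q (inverse T * s) * of_real (square_kernel 1 s)) \<longlongrightarrow> l * of_real c) at_top"
    by (simp only: integral_mult_right_zero integral_complex_of_real c_def)
  moreover have "\<forall>\<^sub>F T in at_top. (LBINT s. q (inverse T * s) * of_real (square_kernel 1 s)) = f (Complex x0 (inverse T)) * of_real c"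
    using eventually_gt_at_top[of 0] by eventually_elim (simp only: step2 positive_imp_inverse_positive)
  ultimately have "((\<lambda>T. f (Complex x0 (inverse T)) * of_real c) \<longlongrightarrow> l * of_real c) at_top"
    using tendsto_cong by fast
  then have "((\<lambda>T. f (Complex x0 (inverse T)) * of_real c / of_real c) \<longlongrightarrow> l * of_real c / of_real c) at_top"
    using c by (intro tendsto_divide tendsto_const) auto
  then show ?thesis
    unfolding filterlim_at_right_to_top using c by simp
qed

section \<open>Almost everywhere differentiability of monotone Lipschitz functions\<close>

lemma emeasure_interval_measure_Ioo:
  assumes ab: "a \<le> b" and mono: "\<And>x y. x \<le> y \<Longrightarrow> g x \<le> g y" and cont: "continuous_on UNIV g"
  shows "emeasure (interval_measure g) {a<..<b} = ennreal (g b - g a)"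
proof -
  have b0: "emeasure (interval_measure g) {b} = 0"
    using emeasure_interval_measure_Icc[OF order_refl mono cont, of b] by simp
  have rc: "continuous (at_right x) g" for x
    using cont continuous_on_eq_continuous_at[of UNIV g] continuous_at_imp_continuous_within by blast
  have Ioc: "emeasure (interval_measure g) {a<..b} = ennreal (g b - g a)"
    by (rule emeasure_interval_measure_Ioc[OF ab mono rc])
  show ?thesis
  proof (cases "a < b")
    case True
    then have "{a<..b} = {a<..<b} \<union> {b}" by auto
    then have "emeasure (interval_measure g) {a<..b} = emeasure (interval_measure g) {a<..<b} + emeasure (interval_measure g) {b}"
      by (simp only:) (rule plus_emeasure[symmetric], auto)
    then show ?thesis using Ioc b0 by simp
  qed (use ab in simp)
qed

text \<open>The sign \<open>\<sigma>\<close> lets one statement serve both quotients below p (value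
  1) and quotients above q (value - 1). The interval between x and x + h has x as an endpoint;
  enlarging it slightly puts x inside an open ball, and the strict inequality survives by continuity
  of \<open>g\<close>.\<close>

lemma Vitali_small_interval:
  fixes g :: "real \<Rightarrow> real"
  assumes cont: "continuous_on UNIV g" and W: "open W" "x \<in> W" and d: "0 < d"
    and h: "\<And>n. \<exists>h. h \<noteq> 0 \<and> \<bar>h\<bar> < 1 / real (Suc n) \<and> \<sigma> * ((g (x + h) - g x) / h) < \<sigma> * p"
  shows "\<exists>a r. 0 < r \<and> x \<in> ball a r \<and> r < d \<and> ball a r \<subseteq> W \<and> \<sigma> * (g (a + r) - g (a - r)) < \<sigma> * p * (2 * r)"
proof -
  obtain \<delta>0 where \<delta>0: "0 < \<delta>0" "ball x \<delta>0 \<subseteq> W" using W open_contains_ball by blast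
  define \<delta> where "\<delta> = min \<delta>0 d"
  have \<delta>: "0 < \<delta>" "ball x \<delta> \<subseteq> W" "\<delta> \<le> d" using \<delta>0 d by (auto simp: \<delta>_def)
  obtain n where n: "1 / real (Suc n) < \<delta> / 2"
    using \<delta>(1) by (metis half_gt_zero nat_approx_posE)
  obtain h where h: "h \<noteq> 0" "\<bar>h\<bar> < \<delta> / 2" "\<sigma> * ((g (x + h) - g x) / h) < \<sigma> * p"
    using h[of n] n by (metis less_trans)
  define a b where "a = min x (x + h)" and "b = max x (x + h)"
  have ab: "a < b" "b - a = \<bar>h\<bar>" "a \<le> x" "x \<le> b" using h(1) by (auto simp: a_def b_def)
  have quot: "(g b - g a) / (b - a) = (g (x + h) - g x) / h"
    using h(1) by (cases "0 < h") (auto simp: a_def b_def min_def max_def field_simps)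
  have "\<sigma> * (g b - g a) = \<sigma> * ((g b - g a) / (b - a)) * (b - a)" using ab by simp
  also have "\<dots> < \<sigma> * p * (b - a)" unfolding quot using h(3) ab by (intro mult_strict_right_mono) auto
  finally have lt: "\<sigma> * (g b - g a) < \<sigma> * p * (b - a)" .
  define F where "F = (\<lambda>\<eta>. \<sigma> * (g (b + \<eta>) - g (a - \<eta>)) - \<sigma> * p * (b - a + 2 * \<eta>))"
  have "continuous_on UNIV F"
    unfolding F_def by (intro continuous_intros continuous_on_compose2[OF cont]) auto
  then have "(F \<longlongrightarrow> F 0) (at_right 0)"
    by (metis UNIV_I continuous_on_eq_continuous_at continuous_within filterlim_at_split open_UNIV isCont_def)
  moreover have "F 0 < 0" using lt by (simp add: F_def)
  ultimately have "\<forall>\<^sub>F \<eta> in at_right 0. F \<eta> < 0" by (rule order_tendstoD(2))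
  moreover have "\<forall>\<^sub>F \<eta> in at_right 0. \<eta> \<in> {0<..<\<delta> / 4}"
    using \<delta>(1) by (intro eventually_at_right_real) auto
  ultimately have "\<forall>\<^sub>F \<eta> in at_right 0. F \<eta> < 0 \<and> \<eta> \<in> {0<..<\<delta> / 4}" by eventually_elim auto
  then obtain \<eta> where \<eta>: "F \<eta> < 0" "0 < \<eta>" "\<eta> < \<delta> / 4"
    using eventually_happens[of _ "at_right (0::real)"] by (auto simp: trivial_limit_at_right_real)
  define r where "r = (b - a) / 2 + \<eta>"
  define c where "c = (a + b) / 2"
  have cr: "c + r = b + \<eta>" "c - r = a - \<eta>" by (auto simp: c_def r_def field_simps)
  have "r < \<delta>" using \<eta> h(2) ab by (simp add: r_def)
  moreover have "ball c r \<subseteq> ball x \<delta>"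
  proof
    fix z assume "z \<in> ball c r"
    then have "a - \<eta> < z" "z < b + \<eta>" using cr by (auto simp: dist_real_def)
    then show "z \<in> ball x \<delta>" using ab h(2) \<eta> by (auto simp: dist_real_def)
  qed
  moreover have "x \<in> ball c r" using cr ab \<eta> by (auto simp: dist_real_def)
  moreover have "0 < r" using ab \<eta> by (simp add: r_def)
  moreover have "\<sigma> * (g (c + r) - g (c - r)) < \<sigma> * p * (2 * r)"
  proof -
    have "2 * r = b - a + 2 * \<eta>" by (simp add: r_def)
    then show ?thesis using \<eta>(1) unfolding cr F_def by simp
  qed
  ultimately show ?thesis using \<delta>(2,3) by (meson le_less_trans less_le_trans subset_trans)
qed

lemma Vitali_cover_intervals:
  fixes g :: "real \<Rightarrow> real"
  assumes cont: "continuous_on UNIV g" and W: "open W" and S: "S \<subseteq> W"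
    and h: "\<And>x n. x \<in> S \<Longrightarrow> \<exists>h. h \<noteq> 0 \<and> \<bar>h\<bar> < 1 / real (Suc n) \<and> \<sigma> * ((g (x + h) - g x) / h) < \<sigma> * p"
  obtains C :: "(real \<times> real) set" where "countable C" "disjoint_family_on (\<lambda>i. ball (fst i) (snd i)) C"
    "(\<Union>i\<in>C. ball (fst i) (snd i)) \<subseteq> W" "AE x in lborel. x \<in> S \<longrightarrow> x \<in> (\<Union>i\<in>C. ball (fst i) (snd i))"
    "\<And>i. i \<in> C \<Longrightarrow> 0 < snd i \<and> \<sigma> * (g (fst i + snd i) - g (fst i - snd i)) < \<sigma> * p * (2 * snd i)"
proof -
  define K where "K = {i :: real \<times> real. 0 < snd i \<and> ball (fst i) (snd i) \<subseteq> W \<and>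
     \<sigma> * (g (fst i + snd i) - g (fst i - snd i)) < \<sigma> * p * (2 * snd i)}"
  obtain C where C: "countable C" "C \<subseteq> K"
     "pairwise (\<lambda>i j. disjnt (ball (fst i) (snd i)) (ball (fst j) (snd j))) C"
     "negligible (S - (\<Union>i\<in>C. ball (fst i) (snd i)))"
  proof (rule Vitali_covering_theorem_balls[of S K fst snd])
    fix x d :: real assume x: "x \<in> S" and d: "0 < d"
    then show "\<exists>i. i \<in> K \<and> x \<in> ball (fst i) (snd i) \<and> snd i < d"
      using Vitali_small_interval[OF cont W _ d h[OF x]] S by (fastforce simp: K_def)
  qed
  have "AE x in lebesgue. x \<notin> S - (\<Union>i\<in>C. ball (fst i) (snd i))"
    using C(4) by (intro AE_not_in) (simp add: negligible_iff_null_sets)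
  then have ae: "AE x in lborel. x \<in> S \<longrightarrow> x \<in> (\<Union>i\<in>C. ball (fst i) (snd i))"
    by (simp add: AE_completion_iff)
  have dj: "disjoint_family_on (\<lambda>i. ball (fst i) (snd i)) C"
    using C(3) by (auto simp: disjoint_family_on_def pairwise_def disjnt_def)
  show ?thesis
    by (rule that[OF C(1) dj _ ae]) (use C(2) in \<open>auto simp: K_def\<close>)
qed

text \<open>Lebesgue's double covering argument. Let m be the measure of the oscillation set.
  Intervals on which \<open>g\<close> grows by less than p times their length cover it inside an
  open set of measure m + e; inside these, intervals with growth above q times their length cover it
  again. Comparing the Stieltjes measure of \<open>g\<close> gives q m at most p (m + e), hence m =
  0.\<close>

lemma oscillating_quotient_null:
  fixes g :: "real \<Rightarrow> real"
  assumes mono: "\<And>x y. x \<le> y \<Longrightarrow> g x \<le> g y" and cont: "continuous_on UNIV g" and p: "0 \<le> p" and pq: "p < q"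
  shows "AE x in lborel. \<not> (\<bar>x\<bar> < N \<and>
    (\<forall>n. \<exists>h. h \<noteq> 0 \<and> \<bar>h\<bar> < 1 / real (Suc n) \<and> (g (x + h) - g x) / h < p) \<and>
    (\<forall>n. \<exists>h. h \<noteq> 0 \<and> \<bar>h\<bar> < 1 / real (Suc n) \<and> q < (g (x + h) - g x) / h))"
proof -
  define E where "E = {x. \<bar>x\<bar> < N \<and>
    (\<forall>n. \<exists>h. h \<noteq> 0 \<and> \<bar>h\<bar> < 1 / real (Suc n) \<and> (g (x + h) - g x) / h < p) \<and>
    (\<forall>n. \<exists>h. h \<noteq> 0 \<and> \<bar>h\<bar> < 1 / real (Suc n) \<and> q < (g (x + h) - g x) / h)}"
  have cq: "continuous_on UNIV (\<lambda>x. (g (x + h) - g x) / h)" if "h \<noteq> 0" for h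
    using that by (intro continuous_intros continuous_on_compose2[OF cont]) auto
  \<comment> \<open>For each fixed h the condition is open in x, so even the uncountable unions over
    h are open and the oscillation set is Borel.\<close>
  have op: "open (\<Union>h\<in>{h. h \<noteq> 0 \<and> \<bar>h\<bar> < 1 / real (Suc n)}. {x. (g (x + h) - g x) / h < p})"
    "open (\<Union>h\<in>{h. h \<noteq> 0 \<and> \<bar>h\<bar> < 1 / real (Suc n)}. {x. q < (g (x + h) - g x) / h})" for n
    by (intro open_UN ballI open_Collect_less cq continuous_on_const; simp)+
  have "E = {x. \<bar>x\<bar> < N} \<inter> (\<Inter>n. \<Union>h\<in>{h. h \<noteq> 0 \<and> \<bar>h\<bar> < 1 / real (Suc n)}. {x. (g (x + h) - g x) / h < p})
     \<inter> (\<Inter>n. \<Union>h\<in>{h. h \<noteq> 0 \<and> \<bar>h\<bar> < 1 / real (Suc n)}. {x. q < (g (x + h) - g x) / h})"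
    by (auto simp: E_def)
  also have "\<dots> \<in> sets borel"
    by (intro sets.Int sets.countable_INT'' borel_open op open_Collect_less continuous_intros) auto
  finally have Em: "E \<in> sets borel" .
  \<comment> \<open>The cut-off by \<open>N\<close> keeps the measure finite, so that it can be
    cancelled in the final comparison.\<close>
  have "emeasure lborel E \<le> emeasure lborel {- N..N}"
    by (rule emeasure_mono) (auto simp: E_def)
  also have "\<dots> < \<infinity>" by (simp add: emeasure_lborel_Icc_eq)
  finally obtain m where m: "emeasure lborel E = ennreal m" "0 \<le> m"
    by (metis ennreal_cases infinity_ennreal_def less_irrefl)
  let ?\<nu> = "interval_measure g"
  have nu_ball: "emeasure ?\<nu> (ball a r) = ennreal (g (a + r) - g (a - r))" if "0 < r" for a r
    using emeasure_interval_measure_Ioo[OF _ mono cont, of "a - r" "a + r"] that by (simp add: ball_eq_greaterThanLessThan)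
  have le_ball: "emeasure lborel (ball a r) = ennreal (2 * r)" if "0 < r" for a r :: real
    using that by (simp add: ball_eq_greaterThanLessThan)
  have key: "q * m \<le> p * (m + e)" if e: "0 < e" for e :: real
  proof -
    obtain U where U: "open U" "E \<subseteq> U" "emeasure lborel (U - E) < ennreal e"
      using outer_regular_lborel[OF Em e] by blast
    have "emeasure lborel U = emeasure lborel (E \<union> (U - E))" using U(2) by (simp add: Un_absorb1)
    also have "\<dots> \<le> emeasure lborel E + emeasure lborel (U - E)"
      using Em U(1) by (intro emeasure_subadditive) auto
    also have "\<dots> \<le> ennreal m + ennreal e" using U(3) m by (intro add_mono) auto
    finally have Ue: "emeasure lborel U \<le> ennreal (m + e)" using m(2) e by simp
    obtain C where C: "countable C" "disjoint_family_on (\<lambda>i. ball (fst i) (snd i)) C"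
      "(\<Union>i\<in>C. ball (fst i) (snd i)) \<subseteq> U" "AE x in lborel. x \<in> E \<longrightarrow> x \<in> (\<Union>i\<in>C. ball (fst i) (snd i))"
      "\<And>i. i \<in> C \<Longrightarrow> 0 < snd i \<and> 1 * (g (fst i + snd i) - g (fst i - snd i)) < 1 * p * (2 * snd i)"
      by (rule Vitali_cover_intervals[OF cont U(1,2), where \<sigma> = 1 and p = p]) (auto simp: E_def)
    define W where "W = (\<Union>i\<in>C. ball (fst i) (snd i))"
    have oW: "open W" unfolding W_def by auto
    \<comment> \<open>The second cover is chosen inside the union of the first, so its Stieltjes
      measure cannot exceed that of \<open>W\<close>. Almost every point of \<open>E\<close> lies in
      \<open>W\<close>, so nothing of its measure is lost.\<close>
    obtain C' where C': "countable C'" "disjoint_family_on (\<lambda>i. ball (fst i) (snd i)) C'"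
      "(\<Union>i\<in>C'. ball (fst i) (snd i)) \<subseteq> W" "AE x in lborel. x \<in> E \<inter> W \<longrightarrow> x \<in> (\<Union>i\<in>C'. ball (fst i) (snd i))"
      "\<And>i. i \<in> C' \<Longrightarrow> 0 < snd i \<and> (- 1) * (g (fst i + snd i) - g (fst i - snd i)) < (- 1) * q * (2 * snd i)"
    proof (rule Vitali_cover_intervals[OF cont oW, of "E \<inter> W", where \<sigma> = "- 1" and p = q])
      have neg: "- 1 * s < - 1 * q \<longleftrightarrow> q < s" for s :: real by auto
      show "\<exists>h. h \<noteq> 0 \<and> \<bar>h\<bar> < 1 / real (Suc n) \<and> - 1 * ((g (x + h) - g x) / h) < - 1 * q" if "x \<in> E \<inter> W" for x n
        unfolding neg using that by (simp add: E_def)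
    qed simp_all
    define W' where "W' = (\<Union>i\<in>C'. ball (fst i) (snd i))"
    have oW': "open W'" unfolding W'_def by auto
    have "emeasure lborel E \<le> emeasure lborel W'"
      using C(4) C'(4) oW' by (intro emeasure_mono_AE) (auto simp: W_def W'_def elim!: eventually_elim2)
    then have "ennreal q * ennreal m \<le> ennreal q * emeasure lborel W'" unfolding m(1) by (intro mult_left_mono) auto
    also have "emeasure lborel W' = (\<integral>\<^sup>+i. emeasure lborel (ball (fst i) (snd i)) \<partial>count_space C')"
      unfolding W'_def by (rule emeasure_UN_countable[OF _ C'(1,2)]) auto
    also have "ennreal q * \<dots> = (\<integral>\<^sup>+i. ennreal q * emeasure lborel (ball (fst i) (snd i)) \<partial>count_space C')"
      by (simp add: nn_integral_cmult)
    also have "\<dots> \<le> (\<integral>\<^sup>+i. emeasure ?\<nu> (ball (fst i) (snd i)) \<partial>count_space C')"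
    proof (rule nn_integral_mono)
      fix i assume "i \<in> space (count_space C')"
      then have i: "0 < snd i" "q * (2 * snd i) \<le> g (fst i + snd i) - g (fst i - snd i)" using C'(5)[of i] by auto
      then show "ennreal q * emeasure lborel (ball (fst i) (snd i)) \<le> emeasure ?\<nu> (ball (fst i) (snd i))"
        using p pq by (simp add: nu_ball le_ball ennreal_mult[symmetric] ennreal_leI del: ennreal_mult'')
    qed
    also have "\<dots> = emeasure ?\<nu> W'"
      unfolding W'_def by (rule emeasure_UN_countable[OF _ C'(1,2), symmetric]) auto
    also have "\<dots> \<le> emeasure ?\<nu> W" using C'(3) oW by (intro emeasure_mono) (auto simp: W'_def)
    also have "\<dots> = (\<integral>\<^sup>+i. emeasure ?\<nu> (ball (fst i) (snd i)) \<partial>count_space C)"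
      unfolding W_def by (rule emeasure_UN_countable[OF _ C(1,2)]) auto
    also have "\<dots> \<le> (\<integral>\<^sup>+i. ennreal p * emeasure lborel (ball (fst i) (snd i)) \<partial>count_space C)"
    proof (rule nn_integral_mono)
      fix i assume "i \<in> space (count_space C)"
      then have i: "0 < snd i" "g (fst i + snd i) - g (fst i - snd i) \<le> p * (2 * snd i)" using C(5)[of i] by auto
      then show "emeasure ?\<nu> (ball (fst i) (snd i)) \<le> ennreal p * emeasure lborel (ball (fst i) (snd i))"
        using p by (simp add: nu_ball le_ball ennreal_mult[symmetric] ennreal_leI del: ennreal_mult'')
    qed
    also have "\<dots> = ennreal p * (\<integral>\<^sup>+i. emeasure lborel (ball (fst i) (snd i)) \<partial>count_space C)"
      by (simp add: nn_integral_cmult)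
    also have "(\<integral>\<^sup>+i. emeasure lborel (ball (fst i) (snd i)) \<partial>count_space C) = emeasure lborel W"
      unfolding W_def by (rule emeasure_UN_countable[OF _ C(1,2), symmetric]) auto
    also have "ennreal p * emeasure lborel W \<le> ennreal p * ennreal (m + e)"
      using order_trans[OF emeasure_mono Ue, of W] C(3) U(1) by (intro mult_left_mono) (auto simp: W_def)
    finally have "ennreal (q * m) \<le> ennreal (p * (m + e))"
      using p pq m(2) e by (simp add: ennreal_mult)
    then show ?thesis using p m(2) e by (simp add: ennreal_le_iff)
  qed
  have "q * m \<le> p * m"
  proof (rule field_le_epsilon)
    fix d :: real assume d: "0 < d"
    \<comment> \<open>The denominator p + 1 covers the case p = 0.\<close>
    have "q * m \<le> p * (m + d / (p + 1))" using d p by (intro key divide_pos_pos) auto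
    also have "\<dots> \<le> p * m + d"
      using d p by (simp add: field_simps)
    finally show "q * m \<le> p * m + d" .
  qed
  then have "m = 0" using pq m(2) by (metis mult_le_cancel_right less_le_not_le order_antisym_conv)
  then have "E \<in> null_sets lborel" using m Em by (auto simp: null_sets_def)
  then show ?thesis using AE_not_in[of E lborel] by (simp add: E_def)
qed

text \<open>If the lower and upper limits of the quotients differed, two rationals would lie
  strictly between them, and \<open>x\<close> would belong to one of countably many oscillation null
  sets. The Lipschitz bound keeps the common value finite.\<close>

lemma Lipschitz_mono_quotient_convergent:
  fixes g :: "real \<Rightarrow> real"
  assumes mono: "\<And>x y. x \<le> y \<Longrightarrow> g x \<le> g y" and Lip: "\<And>x y. \<bar>g x - g y\<bar> \<le> B * \<bar>x - y\<bar>"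
  shows "AE x in lborel. \<exists>l. ((\<lambda>h. (g (x + h) - g x) / h) \<longlongrightarrow> l) (at 0)"
proof -
  have B: "0 \<le> B" using Lip[of 0 1] abs_ge_zero[of "g 0 - g 1"] by simp
  then have "B-lipschitz_on UNIV g"
    using Lip by (intro lipschitz_onI) (auto simp: dist_real_def)
  then have cont: "continuous_on UNIV g" by (rule lipschitz_on_continuous_on)
  have "AE x in lborel. \<forall>(p::rat) (q::rat) (N::nat). 0 \<le> real_of_rat p \<and> real_of_rat p < real_of_rat q \<longrightarrow> \<not> (\<bar>x\<bar> < real N \<and>
    (\<forall>n. \<exists>h. h \<noteq> 0 \<and> \<bar>h\<bar> < 1 / real (Suc n) \<and> (g (x + h) - g x) / h < real_of_rat p) \<and>
    (\<forall>n. \<exists>h. h \<noteq> 0 \<and> \<bar>h\<bar> < 1 / real (Suc n) \<and> real_of_rat q < (g (x + h) - g x) / h))"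
    unfolding AE_all_countable using oscillating_quotient_null[OF mono cont] by (intro allI AE_impI) auto
  then show ?thesis
  proof (rule AE_mp, intro AE_I2 impI)
    fix x
    assume osc: "\<forall>(p::rat) (q::rat) (N::nat). 0 \<le> real_of_rat p \<and> real_of_rat p < real_of_rat q \<longrightarrow> \<not> (\<bar>x\<bar> < real N \<and>
    (\<forall>n. \<exists>h. h \<noteq> 0 \<and> \<bar>h\<bar> < 1 / real (Suc n) \<and> (g (x + h) - g x) / h < real_of_rat p) \<and>
    (\<forall>n. \<exists>h. h \<noteq> 0 \<and> \<bar>h\<bar> < 1 / real (Suc n) \<and> real_of_rat q < (g (x + h) - g x) / h))"
    define Q where "Q = (\<lambda>h. (g (x + h) - g x) / h)"
    have Q: "0 \<le> Q h" "Q h \<le> B" for h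
    proof -
      show "0 \<le> Q h"
        using mono[of x "x + h"] mono[of "x + h" x] by (cases "0 \<le> h") (auto simp: Q_def divide_nonpos_nonpos)
      have "\<bar>Q h\<bar> \<le> B" using Lip[of "x + h" x] B by (cases "h = 0") (auto simp: Q_def abs_divide divide_le_eq)
      then show "Q h \<le> B" by simp
    qed
    obtain N where N: "\<bar>x\<bar> < real N" using reals_Archimedean2 by blast
    define lo hi where "lo = Liminf (at 0) (\<lambda>h. ereal (Q h))" and "hi = Limsup (at 0) (\<lambda>h. ereal (Q h))"
    have lo0: "0 \<le> lo" unfolding lo_def using Q by (intro Liminf_bounded always_eventually) auto
    have hiB: "hi \<le> ereal B" unfolding hi_def using Q by (intro Limsup_bounded always_eventually) auto
    have lohi: "lo \<le> hi" unfolding lo_def hi_def by (rule Liminf_le_Limsup) simp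
    have "\<not> lo < hi"
    proof
      assume "lo < hi"
      then obtain p :: rat where p: "lo < ereal (real_of_rat p)" "ereal (real_of_rat p) < hi" using ereal_dense3 by blast
      then obtain q :: rat where q: "ereal (real_of_rat p) < ereal (real_of_rat q)" "ereal (real_of_rat q) < hi" using ereal_dense3 by blast
      have p0: "0 \<le> real_of_rat p" using lo0 p(1) by (metis ereal_less_eq(5) less_imp_le order_trans)
      have near: "eventually P (at 0)" if "\<And>h. h \<noteq> 0 \<Longrightarrow> \<bar>h\<bar> < 1 / real (Suc n) \<Longrightarrow> P h" for P and n :: nat
        unfolding eventually_at using that by (intro exI[of _ "1 / real (Suc n)"]) (auto simp: dist_real_def)
      have "\<exists>h. h \<noteq> 0 \<and> \<bar>h\<bar> < 1 / real (Suc n) \<and> Q h < real_of_rat p" for n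
      proof (rule ccontr)
        assume "\<not> ?thesis"
        then have "eventually (\<lambda>h. ereal (real_of_rat p) \<le> ereal (Q h)) (at 0)" by (intro near[of n]) force
        then have "ereal (real_of_rat p) \<le> lo" unfolding lo_def by (rule Liminf_bounded)
        then show False using p(1) by simp
      qed
      moreover have "\<exists>h. h \<noteq> 0 \<and> \<bar>h\<bar> < 1 / real (Suc n) \<and> real_of_rat q < Q h" for n
      proof (rule ccontr)
        assume "\<not> ?thesis"
        then have "eventually (\<lambda>h. ereal (Q h) \<le> ereal (real_of_rat q)) (at 0)" by (intro near[of n]) force
        then have "hi \<le> ereal (real_of_rat q)" unfolding hi_def by (rule Limsup_bounded)
        then show False using q(2) by simp
      qed
      moreover have "real_of_rat p < real_of_rat q" using q(1) by simp
      ultimately show False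
        using osc N p0 unfolding Q_def by blast
    qed
    then have eq: "hi = lo" using lohi by simp
    obtain l where l: "lo = ereal l"
      using lo0 hiB eq by (cases lo) auto
    have "((\<lambda>h. ereal (Q h)) \<longlongrightarrow> ereal l) (at 0)"
      by (rule Liminf_eq_Limsup) (use eq l in \<open>auto simp: lo_def hi_def\<close>)
    then show "\<exists>l. ((\<lambda>h. (g (x + h) - g x) / h) \<longlongrightarrow> l) (at 0)"
      unfolding Q_def by auto
  qed
qed

text \<open>A primitive of \<open>f\<close> is Lipschitz with constant 1, so it has a Lipschitz
  trace on the real line. Where the trace is differentiable, its derivative is the vertical limit of
  \<open>f\<close>.\<close>

theorem Fatou_vertical_limit:
  assumes fhol: "f holomorphic_on upper_half_plane"
    and f1: "\<And>z. z \<in> upper_half_plane \<Longrightarrow> cmod (f z) \<le> 1"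
  shows "AE x in lborel. \<exists>l. ((\<lambda>y. f (Complex x y)) \<longlongrightarrow> l) (at_right 0)"
proof -
  have cvx: "convex upper_half_plane" unfolding upper_half_plane_def by (rule convex_halfspace_Im_gt)
  obtain F where "\<And>z. z \<in> upper_half_plane \<Longrightarrow> (F has_field_derivative f z) (at z within upper_half_plane)"
    using holomorphic_convex_primitive'[OF cvx open_upper_half_plane fhol] by blast
  then have F: "(F has_field_derivative f z) (at z)" if "z \<in> upper_half_plane" for z
    using that at_within_open[OF that open_upper_half_plane] by metis
  have Lip: "cmod (F z - F w) \<le> cmod (z - w)" if "z \<in> upper_half_plane" "w \<in> upper_half_plane" for z w
    using field_differentiable_bound[OF cvx has_field_derivative_at_within[OF F] f1 that] by simp
  define \<epsilon> where "\<epsilon> = (\<lambda>n. 1 / real (Suc n))"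
  have \<epsilon>0: "\<epsilon> \<longlonglongrightarrow> 0" unfolding \<epsilon>_def by (rule LIMSEQ_Suc[OF lim_const_over_n[of 1, simplified]])
  have \<epsilon>: "0 < \<epsilon> n" for n by (simp add: \<epsilon>_def)
  have up: "Complex x (\<epsilon> n) \<in> upper_half_plane" for x n using \<epsilon> by (simp add: upper_half_plane_def)
  have conv: "convergent (\<lambda>n. F (Complex x (\<epsilon> n)))" for x
  proof (rule Cauchy_convergent, rule metric_CauchyI)
    fix e :: real assume "0 < e"
    then obtain M where M: "\<And>m n. m \<ge> M \<Longrightarrow> n \<ge> M \<Longrightarrow> dist (\<epsilon> m) (\<epsilon> n) < e"
      using LIMSEQ_imp_Cauchy[OF \<epsilon>0] by (meson metric_CauchyD)
    have "dist (F (Complex x (\<epsilon> m))) (F (Complex x (\<epsilon> n))) \<le> dist (\<epsilon> m) (\<epsilon> n)" for m n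
      using Lip[OF up[of x m] up[of x n]] by (simp add: dist_norm cmod_def)
    then show "\<exists>M. \<forall>m\<ge>M. \<forall>n\<ge>M. dist (F (Complex x (\<epsilon> m))) (F (Complex x (\<epsilon> n))) < e"
      using M le_less_trans by blast
  qed
  define \<Phi> where "\<Phi> = (\<lambda>x. lim (\<lambda>n. F (Complex x (\<epsilon> n))))"
  have trace: "(\<lambda>n. F (Complex x (\<epsilon> n))) \<longlonglongrightarrow> \<Phi> x" for x
    using conv[of x] by (simp add: \<Phi>_def convergent_LIMSEQ_iff)
  have \<Phi>L: "cmod (\<Phi> x - \<Phi> x') \<le> \<bar>x - x'\<bar>" for x x'
  proof (rule LIMSEQ_le_const2[OF tendsto_norm[OF tendsto_diff[OF trace trace]]])
    have "cmod (F (Complex x (\<epsilon> n)) - F (Complex x' (\<epsilon> n))) \<le> \<bar>x - x'\<bar>" for n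
      using Lip[OF up[of x n] up[of x' n]] by (simp add: cmod_def[of "Complex x (\<epsilon> n) - Complex x' (\<epsilon> n)"])
    then show "\<exists>N. \<forall>n\<ge>N. cmod (F (Complex x (\<epsilon> n)) - F (Complex x' (\<epsilon> n))) \<le> \<bar>x - x'\<bar>" by blast
  qed
  \<comment> \<open>Adding the identity makes both Lipschitz coordinates of the trace monotone; the
    extra slope is subtracted again as \<open>Complex 1 1\<close>.\<close>
  define gR gI where "gR = (\<lambda>x. Re (\<Phi> x) + x)" and "gI = (\<lambda>x. Im (\<Phi> x) + x)"
  have RI: "\<bar>Re (\<Phi> x) - Re (\<Phi> y)\<bar> \<le> \<bar>x - y\<bar>" "\<bar>Im (\<Phi> x) - Im (\<Phi> y)\<bar> \<le> \<bar>x - y\<bar>" for x y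
    using order_trans[OF abs_Re_le_cmod \<Phi>L] order_trans[OF abs_Im_le_cmod \<Phi>L]
    by (metis minus_complex.simps(1), metis minus_complex.simps(2))
  have "AE x in lborel. \<exists>l. ((\<lambda>h. (gR (x + h) - gR x) / h) \<longlongrightarrow> l) (at 0)"
  proof (rule Lipschitz_mono_quotient_convergent[where B = 2])
    show "gR x \<le> gR y" if "x \<le> y" for x y using RI(1)[of x y] that by (simp add: gR_def abs_le_iff)
    show "\<bar>gR x - gR y\<bar> \<le> 2 * \<bar>x - y\<bar>" for x y using RI(1)[of x y] abs_triangle_ineq[of "Re (\<Phi> x) - Re (\<Phi> y)" "x - y"]
      by (simp add: gR_def algebra_simps)
  qed
  moreover have "AE x in lborel. \<exists>l. ((\<lambda>h. (gI (x + h) - gI x) / h) \<longlongrightarrow> l) (at 0)"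
  proof (rule Lipschitz_mono_quotient_convergent[where B = 2])
    show "gI x \<le> gI y" if "x \<le> y" for x y using RI(2)[of x y] that by (simp add: gI_def abs_le_iff)
    show "\<bar>gI x - gI y\<bar> \<le> 2 * \<bar>x - y\<bar>" for x y using RI(2)[of x y] abs_triangle_ineq[of "Im (\<Phi> x) - Im (\<Phi> y)" "x - y"]
      by (simp add: gI_def algebra_simps)
  qed
  ultimately show ?thesis
  proof eventually_elim
    case (elim x)
    then obtain lR lI where "((\<lambda>h. (gR (x + h) - gR x) / h) \<longlongrightarrow> lR) (at 0)" "((\<lambda>h. (gI (x + h) - gI x) / h) \<longlongrightarrow> lI) (at 0)"
      by blast
    then have "((\<lambda>h. Complex ((gR (x + h) - gR x) / h) ((gI (x + h) - gI x) / h) - Complex 1 1) \<longlongrightarrow> Complex lR lI - Complex 1 1) (at 0)"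
      by (intro tendsto_diff tendsto_Complex tendsto_const)
    moreover have "\<forall>\<^sub>F h in at 0. Complex ((gR (x + h) - gR x) / h) ((gI (x + h) - gI x) / h) - Complex 1 1
       = (\<Phi> (x + h) - \<Phi> x) / of_real h"
      using eventually_neq_at_within[of 0 0 UNIV]
      by eventually_elim (simp add: complex_eq_iff gR_def gI_def field_simps Re_divide_of_real Im_divide_of_real)
    ultimately have "((\<lambda>h. (\<Phi> (x + h) - \<Phi> x) / of_real h) \<longlongrightarrow> Complex lR lI - Complex 1 1) (at 0)"
      using tendsto_cong by fast
    then show ?case
      using vertical_limit_of_differentiable_trace[OF F fhol f1 Lip trace[unfolded \<epsilon>_def] \<Phi>L] by blast
  qed
qed

section \<open>The sum rule\<close>

lemma neg_log_defect_measurable [measurable]: "neg_log_defect \<in> borel_measurable borel"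
  unfolding neg_log_defect_def by measurable

text \<open>This feeds Fatou's lemma, first along the truncations and then towards the real line.
  The case of modulus at least 1 matters because boundary values of modulus 1 are a priori
  possible.\<close>

lemma neg_log_defect_lower_semicontinuous:
  assumes lim: "z \<longlonglongrightarrow> w"
  shows "neg_log_defect w \<le> liminf (\<lambda>n. neg_log_defect (z n))"
proof (cases "cmod w < 1")
  case True
  have w2: "(cmod w)\<^sup>2 < 1" using True by (simp add: power_less_one_iff abs_square_less_1)
  have "(\<lambda>n. ennreal (- ln (1 - (cmod (z n))\<^sup>2))) \<longlonglongrightarrow> ennreal (- ln (1 - (cmod w)\<^sup>2))"
    using w2 by (intro tendsto_intros lim) auto
  moreover have "\<forall>\<^sub>F n in sequentially. ennreal (- ln (1 - (cmod (z n))\<^sup>2)) = neg_log_defect (z n)"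
    using order_tendstoD(2)[OF tendsto_norm[OF lim] True]
    by eventually_elim (simp add: neg_log_defect_def)
  ultimately have "(\<lambda>n. neg_log_defect (z n)) \<longlonglongrightarrow> ennreal (- ln (1 - (cmod w)\<^sup>2))"
    using tendsto_cong by fast
  from lim_imp_Liminf[OF _ this] show ?thesis using True by (simp add: neg_log_defect_def)
next
  case False
  \<comment> \<open>A squared modulus above 1 - exp (- N) forces the logarithmic defect above N, or
    puts it in its infinite branch.\<close>
  have "of_nat N \<le> liminf (\<lambda>n. neg_log_defect (z n))" for N :: nat
  proof (rule Liminf_bounded)
    have "1 \<le> (cmod w)\<^sup>2" using False by (simp add: one_le_power)
    then have "1 - exp (- real N) < (cmod w)\<^sup>2" using exp_gt_zero[of "- real N"] by linarith
    then have "\<forall>\<^sub>F n in sequentially. 1 - exp (- real N) < (cmod (z n))\<^sup>2"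
      by (intro order_tendstoD(1)[OF tendsto_power[OF tendsto_norm[OF lim]]])
    then show "\<forall>\<^sub>F n in sequentially. of_nat N \<le> neg_log_defect (z n)"
    proof eventually_elim
      case (elim n)
      show ?case
      proof (cases "cmod (z n) < 1")
        case True
        then have pos: "0 < 1 - (cmod (z n))\<^sup>2" by (simp add: power_less_one_iff abs_square_less_1)
        have "ln (1 - (cmod (z n))\<^sup>2) \<le> ln (exp (- real N))" using elim pos by (intro ln_mono) auto
        then have "real N \<le> - ln (1 - (cmod (z n))\<^sup>2)" by simp
        then show ?thesis
          using True by (simp add: neg_log_defect_def ennreal_of_nat_eq_real_of_nat ennreal_leI)
      qed (simp add: neg_log_defect_def)
    qed
  qed
  then have *: "of_nat N \<le> liminf (\<lambda>n. neg_log_defect (z n))" for N :: nat .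
  have "liminf (\<lambda>n. neg_log_defect (z n)) = top"
  proof (rule ccontr)
    assume "liminf (\<lambda>n. neg_log_defect (z n)) \<noteq> top"
    then obtain N :: nat where "liminf (\<lambda>n. neg_log_defect (z n)) < of_nat N"
      using ennreal_Ex_less_of_nat less_top by blast
    then show False using *[of N] by simp
  qed
  then show ?thesis by simp
qed

lemma log_integral_finite_iff:
  "log_integral f > - \<infinity> \<longleftrightarrow> (\<integral>\<^sup>+ x. neg_log_defect (boundary_value f x) \<partial>lborel) < \<infinity>"
  unfolding log_integral_def nn_integral_completion
  by (cases "\<integral>\<^sup>+ x. neg_log_defect (boundary_value f x) \<partial>lborel") (auto simp: less_top ereal_uminus_less_reorder)

lemma boundary_value_sequence:
  assumes "f holomorphic_on upper_half_plane" "\<And>z. z \<in> upper_half_plane \<Longrightarrow> cmod (f z) \<le> 1"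
  shows "AE x in lborel. (\<lambda>k. f (Complex x (1 / real (Suc k)))) \<longlonglongrightarrow> boundary_value f x"
proof (rule AE_mp, rule Fatou_vertical_limit[OF assms(1)])
  show "cmod (f z) \<le> 1" if "z \<in> upper_half_plane" for z using that by (rule assms(2))
  show "AE x in lborel. (\<exists>l. ((\<lambda>y. f (Complex x y)) \<longlongrightarrow> l) (at_right 0)) \<longrightarrow>
     (\<lambda>k. f (Complex x (1 / real (Suc k)))) \<longlonglongrightarrow> boundary_value f x"
  proof (intro AE_I2 impI)
    fix x assume "\<exists>l. ((\<lambda>y. f (Complex x y)) \<longlongrightarrow> l) (at_right 0)"
    then obtain l where l: "((\<lambda>y. f (Complex x y)) \<longlongrightarrow> l) (at_right 0)" by blast
    then have "boundary_value f x = l"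
      unfolding boundary_value_def by (intro tendsto_Lim) (simp_all add: trivial_limit_at_right_real)
    moreover have "(\<lambda>k. 1 / real (Suc k)) \<longlonglongrightarrow> 0" by (rule LIMSEQ_Suc[OF lim_const_over_n[of 1, simplified]])
    then have "filterlim (\<lambda>k. 1 / real (Suc k)) (at_right 0) sequentially"
      by (intro filterlim_at_withinI) auto
    ultimately show "(\<lambda>k. f (Complex x (1 / real (Suc k)))) \<longlonglongrightarrow> boundary_value f x"
      using filterlim_compose[OF l] by simp
  qed
qed

section \<open>From truncated solutions to the Schur function\<close>

lemma pointwise_limit_holomorphic:
  assumes S: "open S" and F: "\<And>n. F n holomorphic_on S"
    and B: "\<And>n z. z \<in> S \<Longrightarrow> cmod (F n z) \<le> B"
    and lim: "\<And>z. z \<in> S \<Longrightarrow> (\<lambda>n. F n z) \<longlonglongrightarrow> f z"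
  shows "f holomorphic_on S"
proof -
  obtain g r where g: "g holomorphic_on S" "strict_mono (r :: nat \<Rightarrow> nat)"
      "\<And>x. x \<in> S \<Longrightarrow> ((\<lambda>n. F (r n) x) \<longlongrightarrow> g x) sequentially"
    by (rule Montel[of S "range F" F]) (use S F B in \<open>auto 4 4 intro!: exI[of _ B]\<close>)
  have "g x = f x" if "x \<in> S" for x
    using LIMSEQ_unique[OF g(3)[OF that] LIMSEQ_subseq_LIMSEQ[OF lim[OF that] g(2), unfolded o_def]] .
  then show ?thesis using g(1) holomorphic_cong by blast
qed

text \<open>The bound by 1 dominates the Riccati right-hand side by |l| + 2 |A|, so the integrated
  equation passes to pointwise limits. No terminal value has to be shared by the approximating
  solutions.\<close>

lemma riccati_limit:
  assumes V: "\<And>n. riccati A l R (V n)" and lim: "\<And>s. s \<in> {0..R} \<Longrightarrow> (\<lambda>n. V n s) \<longlonglongrightarrow> v s"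
    and A: "A absolutely_integrable_on {0..R}" and R: "0 \<le> R"
  shows "riccati A l R v" and "(\<lambda>n. riccati_log A (V n) R) \<longlonglongrightarrow> riccati_log A v R"
proof -
  have nA: "(\<lambda>s. cmod (A s)) integrable_on {0..R}" using A by (auto simp: absolutely_integrable_on_def)
  have V1: "cmod (V n s) \<le> 1" if "s \<in> {0..R}" for n s using V[of n] that by (auto simp: riccati_def)
  have v1: "cmod (v s) \<le> 1" if "s \<in> {0..R}" for s
    using LIMSEQ_le_const2[OF tendsto_norm[OF lim[OF that]]] V1[OF that] by auto
  define G where "G = (\<lambda>u s. - \<i> * l * u s + A s - cnj (A s) * (u s)\<^sup>2)"
  define \<gamma> where "\<gamma> = (\<lambda>s. cmod l + 2 * cmod (A s))"
  have G\<gamma>: "cmod (G u s) \<le> \<gamma> s" if "cmod (u s) \<le> 1" for u :: "real \<Rightarrow> complex" and s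
  proof -
    have "cmod (G u s) \<le> cmod (- \<i> * l * u s) + cmod (A s) + cmod (cnj (A s) * (u s)\<^sup>2)"
      unfolding G_def by (rule order_trans[OF norm_triangle_ineq4]) (intro add_mono norm_triangle_ineq order_refl)
    also have "\<dots> = cmod l * cmod (u s) + cmod (A s) + cmod (A s) * (cmod (u s))\<^sup>2"
      by (simp add: norm_mult norm_power)
    also have "\<dots> \<le> cmod l * 1 + cmod (A s) + cmod (A s) * 1"
      using that by (intro add_mono mult_left_mono power_le_one) auto
    finally show ?thesis by (simp add: \<gamma>_def)
  qed
  have \<gamma>: "\<gamma> integrable_on {0..R}"
    unfolding \<gamma>_def using nA by (intro integrable_add integrable_const_ivl integrable_on_mult_right)
  have acV: "ac R (V n) (G (V n))" for n using V[of n] by (simp add: riccati_def G_def)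
  have Glim: "(\<lambda>n. G (V n) s) \<longlonglongrightarrow> G v s" if "s \<in> {0..R}" for s
    unfolding G_def by (intro tendsto_intros lim that)
  have sub: "(G v has_integral (v s - v 0)) {0..s}" if s: "s \<in> {0..R}" for s
  proof -
    have Gi: "(G (V n) has_integral (V n s - V n 0)) {0..s}" for n using acV[of n] s by (simp add: ac_def)
    have \<gamma>s: "\<gamma> integrable_on {0..s}" using integrable_subinterval_real[OF \<gamma>, of 0 s] s by auto
    have d: "G v integrable_on {0..s}" "(\<lambda>n. integral {0..s} (G (V n))) \<longlonglongrightarrow> integral {0..s} (G v)"
      using s by (intro dominated_convergence[OF has_integral_integrable[OF Gi] \<gamma>s _ Glim]; auto intro!: G\<gamma> V1)+
    have "(\<lambda>n. V n s - V n 0) \<longlonglongrightarrow> v s - v 0" using s R by (intro tendsto_diff lim) auto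
    then have "integral {0..s} (G v) = v s - v 0"
      using d(2) LIMSEQ_unique unfolding integral_unique[OF Gi] by blast
    then show ?thesis using d(1) integrable_integral by fastforce
  qed
  have "G v absolutely_integrable_on {0..R}"
    by (rule absolutely_integrable_integrable_bound[OF _ has_integral_integrable[OF sub] \<gamma>])
      (use R v1 in \<open>auto intro!: G\<gamma>\<close>)
  then show "riccati A l R v" using sub v1 by (auto simp: riccati_def ac_def G_def)
  show "(\<lambda>n. riccati_log A (V n) R) \<longlonglongrightarrow> riccati_log A v R"
    unfolding riccati_log_def
  proof (rule dominated_convergence(2)[OF _ nA])
    show "(\<lambda>s. cnj (A s) * V n s) integrable_on {0..R}" for n
      using ac_integrand_integrable[OF riccati_log_ac[OF V A], of 0 R] by (auto simp: absolutely_integrable_on_def)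
    show "norm (cnj (A s) * V n s) \<le> cmod (A s)" if "s \<in> {0..R}" for n s
      using V1[OF that] by (simp add: norm_mult mult_left_le)
    show "(\<lambda>n. cnj (A s) * V n s) \<longlonglongrightarrow> cnj (A s) * v s" if "s \<in> {0..R}" for s
      by (intro tendsto_intros lim that)
  qed
qed

text \<open>Solutions are selected for all \<open>l\<close> at once, so that each truncation yields
  a function of the spectral parameter. The index is shifted by one to give intervals of positive
  length.\<close>

lemma schur_approximants:
  assumes A: "L2_loc A" and f: "is_schur_function A f"
  obtains U where "\<And>n l. l \<in> upper_half_plane \<Longrightarrow> riccati A l (real (Suc n)) (U n l)"
    "\<And>n l. l \<in> upper_half_plane \<Longrightarrow> U n l (real (Suc n)) = 0"
    "\<And>l. l \<in> upper_half_plane \<Longrightarrow> (\<lambda>n. U n l 0) \<longlonglongrightarrow> f l"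
proof -
  have "\<exists>X. \<forall>l\<in>upper_half_plane. krein_solution A l (X l) \<and>
        ((\<lambda>r. X l r $ 2 $ 1 * inverse (X l r $ 2 $ 2)) \<longlongrightarrow> f l) at_top"
    using f unfolding is_schur_function_def by (rule bchoice)
  then obtain X :: "complex \<Rightarrow> real \<Rightarrow> complex^2^2" where X: "\<And>l. l \<in> upper_half_plane \<Longrightarrow> krein_solution A l (X l)"
    "\<And>l. l \<in> upper_half_plane \<Longrightarrow> ((\<lambda>r. X l r $ 2 $ 1 * inverse (X l r $ 2 $ 2)) \<longlongrightarrow> f l) at_top"
    by blast
  have "\<exists>u. riccati A l (real (Suc n)) u \<and> u (real (Suc n)) = 0 \<and>
     u 0 = X l (real (Suc n)) $ 2 $ 1 * inverse (X l (real (Suc n)) $ 2 $ 2)" if "l \<in> upper_half_plane" for n l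
    using riccati_of_krein_solution[OF X(1)[OF that] L2_locD(2)[OF A, of "real (Suc n)"]] that
    by (auto simp: upper_half_plane_def)
  then have "\<forall>n. \<forall>l\<in>upper_half_plane. \<exists>u. riccati A l (real (Suc n)) u \<and> u (real (Suc n)) = 0 \<and>
     u 0 = X l (real (Suc n)) $ 2 $ 1 * inverse (X l (real (Suc n)) $ 2 $ 2)" by blast
  then have "\<forall>n. \<exists>u. \<forall>l\<in>upper_half_plane. riccati A l (real (Suc n)) (u l) \<and> u l (real (Suc n)) = 0 \<and>
     u l 0 = X l (real (Suc n)) $ 2 $ 1 * inverse (X l (real (Suc n)) $ 2 $ 2)" by (intro allI bchoice) blast
  then have "\<exists>U. \<forall>n. \<forall>l\<in>upper_half_plane. riccati A l (real (Suc n)) (U n l) \<and> U n l (real (Suc n)) = 0 \<and>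
     U n l 0 = X l (real (Suc n)) $ 2 $ 1 * inverse (X l (real (Suc n)) $ 2 $ 2)" by (rule choice)
  then obtain U where U: "\<And>n l. l \<in> upper_half_plane \<Longrightarrow> riccati A l (real (Suc n)) (U n l) \<and> U n l (real (Suc n)) = 0 \<and>
     U n l 0 = X l (real (Suc n)) $ 2 $ 1 * inverse (X l (real (Suc n)) $ 2 $ 2)" by blast
  have "(\<lambda>n. U n l 0) \<longlonglongrightarrow> f l" if l: "l \<in> upper_half_plane" for l
  proof -
    have "filterlim (\<lambda>n. real (Suc n)) at_top sequentially"
      using filterlim_real_sequentially filterlim_sequentially_Suc[of real] by blast
    from filterlim_compose[OF X(2)[OF l] this] show ?thesis using U[OF l] by simp
  qed
  then show ?thesis using that U by blast
qed

text \<open>Multiplying the Poisson formula by y^2 makes the kernel at most 1 with limit 1 for large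
  y, while the other side becomes y times the value on the imaginary axis. Letting y grow thus
  compares a plain line integral with the mass of |A|^2.\<close>

lemma Poisson_line_Re:
  assumes g: "g holomorphic_on upper_half_plane" and M: "\<And>z. z \<in> upper_half_plane \<Longrightarrow> cmod (g z) \<le> M"
    and e: "0 < e" and y: "0 < y"
  shows "has_bochner_integral lborel (\<lambda>x. - Re (g (Complex x e)) * (y\<^sup>2 / (x\<^sup>2 + y\<^sup>2))) (pi * y * - Re (g (\<i> * of_real (y + e))))"
proof -
  have "has_bochner_integral lborel (\<lambda>x. g (Complex x e) / of_real (x\<^sup>2 + y\<^sup>2)) (of_real (pi / y) * g (\<i> * of_real (y + e)))"
    using Poisson_line[OF g M e y] by (simp add: has_bochner_integral_iff)
  from has_bochner_integral_bounded_linear[OF bounded_linear_Re this]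
  have "has_bochner_integral lborel (\<lambda>x. Re (g (Complex x e) / of_real (x\<^sup>2 + y\<^sup>2))) (Re (of_real (pi / y) * g (\<i> * of_real (y + e))))"
    by (simp only: comp_def)
  from has_bochner_integral_mult_right[OF this, of "- y\<^sup>2"]
  have "has_bochner_integral lborel (\<lambda>x. - y\<^sup>2 * Re (g (Complex x e) / of_real (x\<^sup>2 + y\<^sup>2))) (- y\<^sup>2 * Re (of_real (pi / y) * g (\<i> * of_real (y + e))))" .
  moreover have "- y\<^sup>2 * Re (g (Complex x e) / of_real (x\<^sup>2 + y\<^sup>2)) = - Re (g (Complex x e)) * (y\<^sup>2 / (x\<^sup>2 + y\<^sup>2))" for x
    by (simp only: Re_divide_of_real) simp
  moreover have "- y\<^sup>2 * Re (of_real (pi / y) * g (\<i> * of_real (y + e))) = pi * y * - Re (g (\<i> * of_real (y + e)))"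
  proof -
    have "Re (of_real (pi / y) * w) = pi / y * Re w" for w by simp
    then show ?thesis using y by (simp only:) (simp add: power2_eq_square)
  qed
  ultimately show ?thesis by (simp only:)
qed

lemma schur_function_bounded_holomorphic:
  assumes A: "L2_loc A" and f: "is_schur_function A f"
  shows "f holomorphic_on upper_half_plane" and "\<And>z. z \<in> upper_half_plane \<Longrightarrow> cmod (f z) \<le> 1"
proof -
  obtain U where U: "\<And>n l. l \<in> upper_half_plane \<Longrightarrow> riccati A l (real (Suc n)) (U n l)"
    "\<And>n l. l \<in> upper_half_plane \<Longrightarrow> U n l (real (Suc n)) = 0"
    "\<And>l. l \<in> upper_half_plane \<Longrightarrow> (\<lambda>n. U n l 0) \<longlonglongrightarrow> f l"
    by (rule schur_approximants[OF A f]) blast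
  have U1: "cmod (U n l 0) \<le> 1" if "l \<in> upper_half_plane" for n l
    using U(1)[OF that, of n] by (auto simp: riccati_def)
  have Uhol: "(\<lambda>l. U n l 0) holomorphic_on upper_half_plane" for n
    by (rule riccati_holomorphic(1)[where R = "real (Suc n)" and r = 0 and A = A]) (use U L2_locD(2)[OF A, of "real (Suc n)"] in auto)
  show "f holomorphic_on upper_half_plane"
    by (rule pointwise_limit_holomorphic[OF open_upper_half_plane Uhol U1 U(3)])
  show "cmod (f z) \<le> 1" if "z \<in> upper_half_plane" for z
    using LIMSEQ_le_const2[OF tendsto_norm[OF U(3)[OF that]]] U1[OF that] by auto
qed

section \<open>The two implications\<close>

lemma nn_integral_square_on:
  assumes "L2_loc A" "0 < R"
  shows "(\<integral>\<^sup>+ s. ennreal (indicator {0..R} s * (cmod (A s))\<^sup>2) \<partial>lebesgue) = ennreal (L2_mass A R)"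
proof -
  have si: "set_integrable lebesgue {0..R} (\<lambda>s. (cmod (A s))\<^sup>2)"
    using L2_locD(1)[OF assms] by (simp add: L2_on_def)
  have "(\<integral>\<^sup>+ s. ennreal (indicator {0..R} s * (cmod (A s))\<^sup>2) \<partial>lebesgue)
      = ennreal (LINT s|lebesgue. indicator {0..R} s * (cmod (A s))\<^sup>2)"
    using si by (intro nn_integral_eq_integral) (auto simp: set_integrable_def)
  then show ?thesis
    using set_lebesgue_integral_eq_integral(2)[OF si] by (simp add: set_lebesgue_integral_def)
qed

lemma L2_on_half_line_of_bound:
  assumes A: "L2_loc A" and C: "\<And>R. 0 < R \<Longrightarrow> L2_mass A R \<le> C"
  shows "L2_on {0..} A"
proof -
  have m: "(\<lambda>x. indicator {0..real (Suc n)} x *\<^sub>R A x) \<in> borel_measurable lebesgue" for n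
    using L2_locD(1)[OF A, of "real (Suc n)"] by (simp add: L2_on_def set_borel_measurable_def)
  have ind: "(\<lambda>n. indicator {0..real (Suc n)} x :: real) \<longlonglongrightarrow> indicator {0..} x" for x
  proof -
    obtain N where "\<bar>x\<bar> \<le> real N" using real_arch_simple by blast
    then have "\<forall>\<^sub>F n in sequentially. indicator {0..real (Suc n)} x = (indicator {0..} x :: real)"
      unfolding eventually_sequentially by (intro exI[of _ N]) (auto simp: indicator_def)
    then show ?thesis by (rule tendsto_eventually)
  qed
  have meas: "(\<lambda>x. indicator {0..} x *\<^sub>R A x) \<in> borel_measurable lebesgue"
    by (rule borel_measurable_LIMSEQ_metric[where f = "\<lambda>n x. indicator {0..real (Suc n)} x *\<^sub>R A x"]) (intro m tendsto_scaleR ind tendsto_const)+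
  have "(\<lambda>x. (cmod (indicator {0..} x *\<^sub>R A x))\<^sup>2) \<in> borel_measurable lebesgue"
    using meas by measurable
  moreover have "(cmod (indicator {0..} x *\<^sub>R A x))\<^sup>2 = indicator {0..} x *\<^sub>R (cmod (A x))\<^sup>2" for x
    by (simp add: indicator_def)
  ultimately have meas2: "(\<lambda>x. indicator {0..} x *\<^sub>R (cmod (A x))\<^sup>2) \<in> borel_measurable lebesgue" by simp
  have mn: "(\<lambda>x. ennreal (indicator {0..real (Suc n)} x * (cmod (A x))\<^sup>2)) \<in> borel_measurable lebesgue" for n
  proof -
    have "(\<lambda>x. ennreal ((cmod (indicator {0..real (Suc n)} x *\<^sub>R A x))\<^sup>2)) \<in> borel_measurable lebesgue"
      using m[of n] by measurable
    moreover have "(cmod (indicator {0..real (Suc n)} x *\<^sub>R A x))\<^sup>2 = indicator {0..real (Suc n)} x * (cmod (A x))\<^sup>2" for x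
      by (simp add: indicator_def)
    ultimately show ?thesis by simp
  qed
  have "(\<integral>\<^sup>+ x. ennreal (norm (indicator {0..} x *\<^sub>R (cmod (A x))\<^sup>2)) \<partial>lebesgue)
    = (\<integral>\<^sup>+ x. liminf (\<lambda>n. ennreal (indicator {0..real (Suc n)} x * (cmod (A x))\<^sup>2)) \<partial>lebesgue)"
  proof (intro nn_integral_cong)
    fix x
    have "(\<lambda>n. ennreal (indicator {0..real (Suc n)} x * (cmod (A x))\<^sup>2)) \<longlonglongrightarrow> ennreal (indicator {0..} x * (cmod (A x))\<^sup>2)"
      by (intro tendsto_ennrealI tendsto_mult ind tendsto_const)
    from lim_imp_Liminf[OF _ this]
    show "ennreal (norm (indicator {0..} x *\<^sub>R (cmod (A x))\<^sup>2)) = liminf (\<lambda>n. ennreal (indicator {0..real (Suc n)} x * (cmod (A x))\<^sup>2))"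
      by (simp add: abs_mult)
  qed
  also have "\<dots> \<le> liminf (\<lambda>n. \<integral>\<^sup>+ x. ennreal (indicator {0..real (Suc n)} x * (cmod (A x))\<^sup>2) \<partial>lebesgue)"
    by (rule nn_integral_liminf[OF mn])
  also have "\<dots> \<le> ennreal C"
  proof (rule Liminf_le)
    show "\<forall>\<^sub>F n in sequentially. (\<integral>\<^sup>+ x. ennreal (indicator {0..real (Suc n)} x * (cmod (A x))\<^sup>2) \<partial>lebesgue) \<le> ennreal C"
      using C by (intro always_eventually allI) (simp only: nn_integral_square_on[OF A] of_nat_0_less_iff zero_less_Suc ennreal_leI)
  qed simp
  also have "\<dots> < \<infinity>" by simp
  finally have "integrable lebesgue (\<lambda>x. indicator {0..} x *\<^sub>R (cmod (A x))\<^sup>2)"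
    using meas2 by (simp add: integrable_iff_bounded)
  then show ?thesis using meas by (simp add: L2_on_def set_borel_measurable_def set_integrable_def)
qed

text \<open>One bound, a multiple of pi * \<open>T\<close>, survives three uses of Fatou's lemma: y
  to infinity in the Poisson kernel, the truncation to infinity, and the height of the line to
  0.\<close>

lemma log_integral_finite_if_L2:
  assumes A: "L2_loc A" and f: "is_schur_function A f" and L2: "L2_on {0..} A"
  shows "log_integral f > - \<infinity>"
proof -
  obtain U where U: "\<And>n l. l \<in> upper_half_plane \<Longrightarrow> riccati A l (real (Suc n)) (U n l)"
    "\<And>n l. l \<in> upper_half_plane \<Longrightarrow> U n l (real (Suc n)) = 0"
    "\<And>l. l \<in> upper_half_plane \<Longrightarrow> (\<lambda>n. U n l 0) \<longlonglongrightarrow> f l"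
    by (rule schur_approximants[OF A f]) blast
  note fhol = schur_function_bounded_holomorphic[OF A f]
  define T where "T = integral {0..} (\<lambda>s. (cmod (A s))\<^sup>2)"
  have TI: "(\<lambda>s. (cmod (A s))\<^sup>2) integrable_on {0..}"
    using L2 by (auto simp: L2_on_def absolutely_integrable_on_def)
  have T: "L2_mass A R \<le> T" if "0 < R" for R
    unfolding T_def using L2_locD(3)[OF A that] TI by (intro integral_subset_le) auto
  have T0: "0 \<le> T" unfolding T_def using TI by (intro integral_nonneg) auto
  have upx: "Complex x e \<in> upper_half_plane" if "0 < e" for x e using that by (simp add: upper_half_plane_def)
  define L where "L = (\<lambda>n l. riccati_log A (U n l) (real (Suc n)))"
  have Lhol: "L n holomorphic_on upper_half_plane" for n
    unfolding L_def by (rule riccati_holomorphic(2)[OF _ L2_locD(2)[OF A], of "real (Suc n)"]) (use U in auto)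
  have Lbd: "cmod (L n l) \<le> L1_mass A (real (Suc n))" if "l \<in> upper_half_plane" for n l
    unfolding L_def using U(1)[OF that] L2_locD(2)[OF A, of "real (Suc n)"] by (intro riccati_log_bound) auto
  have en: "exp (2 * Re (L n l)) \<le> 1 - (cmod (U n l 0))\<^sup>2" if "l \<in> upper_half_plane" for n l
    using riccati_energy(1)[OF U(1)[OF that] L2_locD(2)[OF A]] that U(2)[OF that]
    by (simp add: L_def upper_half_plane_def)
  have L0: "0 \<le> - Re (L n l)" if "l \<in> upper_half_plane" for n l
  proof -
    have "exp (2 * Re (L n l)) \<le> 1" using en[OF that, of n] zero_le_power2[of "cmod (U n l 0)"] by linarith
    then show ?thesis by simp
  qed
  \<comment> \<open>Vanishing at the truncation point removes the factor 1 - |u(R)|^2 from the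
    energy inequality. The positive exponential also forces modulus below 1, so the finite branch of
    \<open>neg_log_defect\<close> applies.\<close>
  have nld: "neg_log_defect (U n l 0) \<le> 2 * ennreal (- Re (L n l))" if "l \<in> upper_half_plane" for n l
  proof -
    have pos: "0 < 1 - (cmod (U n l 0))\<^sup>2" using en[OF that, of n] by (rule less_le_trans[OF exp_gt_zero])
    then have lt: "cmod (U n l 0) < 1" by (simp add: power_less_one_iff abs_square_less_1)
    have "2 * Re (L n l) \<le> ln (1 - (cmod (U n l 0))\<^sup>2)" using en[OF that, of n] pos by (simp add: ln_ge_iff)
    then have "ennreal (- ln (1 - (cmod (U n l 0))\<^sup>2)) \<le> ennreal (2 * - Re (L n l))" by (intro ennreal_leI) simp
    also have "\<dots> = ennreal 2 * ennreal (- Re (L n l))" using L0[OF that] by (intro ennreal_mult) auto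
    also have "ennreal 2 = 2" by simp
    finally show ?thesis using lt by (simp add: neg_log_defect_def)
  qed
  have line: "continuous_on UNIV (\<lambda>x. g (Complex x e))" if "g holomorphic_on upper_half_plane" "0 < e" for g e
    by (rule continuous_on_compose2[OF holomorphic_on_imp_continuous_on[OF that(1)]])
      (use that(2) in \<open>auto simp: upper_half_plane_def Complex_eq intro!: continuous_intros\<close>)
  have intL: "(\<integral>\<^sup>+ x. ennreal (- Re (L n (Complex x e))) \<partial>lborel) \<le> ennreal (pi * T)" if e: "0 < e" for n e
  proof -
    have mL: "(\<lambda>x. L n (Complex x e)) \<in> borel_measurable borel"
      by (rule borel_measurable_continuous_onI[OF line[OF Lhol e]])
    have mk: "(\<lambda>x. ennreal (- Re (L n (Complex x e)) * ((real (Suc k))\<^sup>2 / (x\<^sup>2 + (real (Suc k))\<^sup>2)))) \<in> borel_measurable lborel" for k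
      using mL by measurable
    have k: "(\<integral>\<^sup>+ x. ennreal (- Re (L n (Complex x e)) * ((real (Suc k))\<^sup>2 / (x\<^sup>2 + (real (Suc k))\<^sup>2))) \<partial>lborel) \<le> ennreal (pi * T)" for k
    proof -
      define y where "y = real (Suc k)"
      have y: "0 < y" by (simp add: y_def)
      have l: "\<i> * of_real (y + e) \<in> upper_half_plane" using y e by (simp add: upper_half_plane_def)
      have P: "has_bochner_integral lborel (\<lambda>x. - Re (L n (Complex x e)) * (y\<^sup>2 / (x\<^sup>2 + y\<^sup>2)))
          (pi * y * - Re (L n (\<i> * of_real (y + e))))"
        by (rule Poisson_line_Re[OF Lhol _ e y]) (rule Lbd)
      have "(\<integral>\<^sup>+ x. ennreal (- Re (L n (Complex x e)) * (y\<^sup>2 / (x\<^sup>2 + y\<^sup>2))) \<partial>lborel) = ennreal (pi * y * - Re (L n (\<i> * of_real (y + e))))"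
        unfolding has_bochner_integral_integral_eq[OF P, symmetric]
      proof (rule nn_integral_eq_integral[OF integrable.intros[OF P]])
        show "AE x in lborel. 0 \<le> - Re (L n (Complex x e)) * (y\<^sup>2 / (x\<^sup>2 + y\<^sup>2))"
          by (intro AE_I2 mult_nonneg_nonneg L0[OF upx[OF e]]) simp
      qed
      also have "\<dots> \<le> ennreal (pi * T)"
      proof (rule ennreal_leI)
        \<comment> \<open>The mean square bound carries the factor Im l = y + e instead of y;
          enlarging y is harmless because - Re L is nonnegative here.\<close>
        have "y * - Re (L n (\<i> * of_real (y + e))) \<le> (y + e) * - Re (L n (\<i> * of_real (y + e)))"
          using e L0[OF l, of n] by (intro mult_right_mono) auto
        also have "\<dots> \<le> (y + e) * cmod (L n (\<i> * of_real (y + e)))"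
          using y e abs_Re_le_cmod[of "L n (\<i> * of_real (y + e))"] by (intro mult_left_mono) auto
        also have "\<dots> \<le> L2_mass A (real (Suc n))"
          using riccati_log_L2_bound[OF U(1)[OF l, of n] _ _ U(2)[OF l, of n] L2_locD(2,3)[OF A]] y e by (simp add: L_def)
        also have "\<dots> \<le> T" by (rule T) simp
        finally show "pi * y * - Re (L n (\<i> * of_real (y + e))) \<le> pi * T"
          unfolding mult.assoc by (intro mult_left_mono) auto
      qed
      finally show ?thesis by (simp add: y_def)
    qed
    have "(\<integral>\<^sup>+ x. ennreal (- Re (L n (Complex x e))) \<partial>lborel)
      = (\<integral>\<^sup>+ x. liminf (\<lambda>k. ennreal (- Re (L n (Complex x e)) * ((real (Suc k))\<^sup>2 / (x\<^sup>2 + (real (Suc k))\<^sup>2)))) \<partial>lborel)"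
    proof (intro nn_integral_cong)
      fix x :: real
      have "(\<lambda>k. (real (Suc k))\<^sup>2 / (x\<^sup>2 + (real (Suc k))\<^sup>2)) \<longlonglongrightarrow> 1"
      proof (rule LIMSEQ_Suc[of "\<lambda>k. (real k)\<^sup>2 / (x\<^sup>2 + (real k)\<^sup>2)"])
        have "(\<lambda>k. 1 / (x\<^sup>2 * (1 / real k)\<^sup>2 + 1)) \<longlonglongrightarrow> 1 / (x\<^sup>2 * 0\<^sup>2 + 1)"
          by (intro tendsto_intros lim_const_over_n[of 1, simplified]) auto
        moreover have "\<forall>\<^sub>F k in sequentially. 1 / (x\<^sup>2 * (1 / real k)\<^sup>2 + 1) = (real k)\<^sup>2 / (x\<^sup>2 + (real k)\<^sup>2)"
          using eventually_gt_at_top[of 0] by eventually_elim (simp add: field_simps)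
        ultimately show "(\<lambda>k. (real k)\<^sup>2 / (x\<^sup>2 + (real k)\<^sup>2)) \<longlonglongrightarrow> 1"
          using Lim_transform_eventually by fastforce
      qed
      then have "(\<lambda>k. ennreal (- Re (L n (Complex x e)) * ((real (Suc k))\<^sup>2 / (x\<^sup>2 + (real (Suc k))\<^sup>2)))) \<longlonglongrightarrow> ennreal (- Re (L n (Complex x e)) * 1)"
        by (intro tendsto_ennrealI tendsto_mult tendsto_const)
      from lim_imp_Liminf[OF _ this]
      show "ennreal (- Re (L n (Complex x e))) = liminf (\<lambda>k. ennreal (- Re (L n (Complex x e)) * ((real (Suc k))\<^sup>2 / (x\<^sup>2 + (real (Suc k))\<^sup>2))))"
        by simp
    qed
    also have "\<dots> \<le> liminf (\<lambda>k. \<integral>\<^sup>+ x. ennreal (- Re (L n (Complex x e)) * ((real (Suc k))\<^sup>2 / (x\<^sup>2 + (real (Suc k))\<^sup>2))) \<partial>lborel)"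
      by (rule nn_integral_liminf[OF mk])
    also have "\<dots> \<le> ennreal (pi * T)"
      by (rule Liminf_le) (use k in auto)
    finally show ?thesis .
  qed
  have intU: "(\<integral>\<^sup>+ x. neg_log_defect (U n (Complex x e) 0) \<partial>lborel) \<le> 2 * ennreal (pi * T)" if e: "0 < e" for n e
  proof -
    have mL: "(\<lambda>x. L n (Complex x e)) \<in> borel_measurable borel"
      by (rule borel_measurable_continuous_onI[OF line[OF Lhol e]])
    have "(\<integral>\<^sup>+ x. neg_log_defect (U n (Complex x e) 0) \<partial>lborel) \<le> (\<integral>\<^sup>+ x. 2 * ennreal (- Re (L n (Complex x e))) \<partial>lborel)"
      by (intro nn_integral_mono nld upx e)
    also have "\<dots> = 2 * (\<integral>\<^sup>+ x. ennreal (- Re (L n (Complex x e))) \<partial>lborel)"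
      using mL by (intro nn_integral_cmult) measurable
    also have "\<dots> \<le> 2 * ennreal (pi * T)" using intL[OF e] by (intro mult_left_mono) auto
    finally show ?thesis .
  qed
  \<comment> \<open>The truncation is removed at positive height, where convergence to
    \<open>f\<close> is known at every point; only afterwards is the real line approached.\<close>
  have intf: "(\<integral>\<^sup>+ x. neg_log_defect (f (Complex x e)) \<partial>lborel) \<le> 2 * ennreal (pi * T)" if e: "0 < e" for e
  proof -
    have Uhol: "(\<lambda>l. U n l 0) holomorphic_on upper_half_plane" for n
      by (rule riccati_holomorphic(1)[where R = "real (Suc n)" and r = 0 and A = A]) (use U L2_locD(2)[OF A, of "real (Suc n)"] in auto)
    have mU: "(\<lambda>x. U n (Complex x e) 0) \<in> borel_measurable borel" for n
      by (rule borel_measurable_continuous_onI[OF line[OF Uhol e]])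
    have "(\<integral>\<^sup>+ x. neg_log_defect (f (Complex x e)) \<partial>lborel) \<le> (\<integral>\<^sup>+ x. liminf (\<lambda>n. neg_log_defect (U n (Complex x e) 0)) \<partial>lborel)"
      by (intro nn_integral_mono neg_log_defect_lower_semicontinuous U(3) upx e)
    also have "\<dots> \<le> liminf (\<lambda>n. \<integral>\<^sup>+ x. neg_log_defect (U n (Complex x e) 0) \<partial>lborel)"
      using mU by (intro nn_integral_liminf) measurable
    also have "\<dots> \<le> 2 * ennreal (pi * T)"
      by (rule Liminf_le) (use intU[OF e] in auto)
    finally show ?thesis .
  qed
  have mf: "(\<lambda>x. f (Complex x e)) \<in> borel_measurable borel" if "0 < e" for e
    by (rule borel_measurable_continuous_onI[OF line[OF fhol(1) that]])
  have "(\<integral>\<^sup>+ x. neg_log_defect (boundary_value f x) \<partial>lborel) \<le> (\<integral>\<^sup>+ x. liminf (\<lambda>k. neg_log_defect (f (Complex x (1 / real (Suc k))))) \<partial>lborel)"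
  proof (rule nn_integral_mono_AE)
    have "AE x in lborel. (\<lambda>k. f (Complex x (1 / real (Suc k)))) \<longlonglongrightarrow> boundary_value f x"
      by (rule boundary_value_sequence[OF fhol(1)]) (rule fhol(2))
    then show "AE x in lborel. neg_log_defect (boundary_value f x) \<le> liminf (\<lambda>k. neg_log_defect (f (Complex x (1 / real (Suc k)))))"
      by (rule eventually_mono) (rule neg_log_defect_lower_semicontinuous)
  qed
  also have "\<dots> \<le> liminf (\<lambda>k. \<integral>\<^sup>+ x. neg_log_defect (f (Complex x (1 / real (Suc k)))) \<partial>lborel)"
    using mf[of "1 / real (Suc _)"] by (intro nn_integral_liminf measurable_compose[OF _ neg_log_defect_measurable]) simp
  also have "\<dots> \<le> 2 * ennreal (pi * T)"
    by (rule Liminf_le) (use intf[of "1 / real (Suc _)"] in auto)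
  also have "\<dots> < \<infinity>" by (simp add: ennreal_mult_less_top)
  finally show ?thesis unfolding log_integral_finite_iff .
qed

text \<open>In the converse implication the integrand - Re g has no known sign, so its integral is
  only dominated by that of the positive part.\<close>

lemma ennreal_integral_le_nn_integral:
  fixes F :: "'a \<Rightarrow> real"
  assumes "has_bochner_integral M F c"
  shows "ennreal c \<le> (\<integral>\<^sup>+ x. ennreal (F x) \<partial>M)"
proof -
  have F: "integrable M F" "c = integral\<^sup>L M F" using assms by (auto simp: has_bochner_integral_iff)
  have "ennreal c \<le> ennreal (integral\<^sup>L M (\<lambda>x. max 0 (F x)))"
    unfolding F(2) using F(1) by (intro ennreal_leI integral_mono) auto
  also have "\<dots> = (\<integral>\<^sup>+ x. ennreal (max 0 (F x)) \<partial>M)"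
    using F(1) by (intro nn_integral_eq_integral[symmetric]) auto
  also have "\<dots> = (\<integral>\<^sup>+ x. ennreal (F x) \<partial>M)"
    by (intro nn_integral_cong) (simp add: max_def ennreal_neg)
  finally show ?thesis .
qed

text \<open>The order of limits is forced. For fixed r the truncations go to infinity first, then
  for fixed y the line is lowered to the real axis, and only then does y tend to infinity. The
  resulting bound does not depend on r.\<close>

lemma L2_if_log_integral_finite:
  assumes A: "L2_loc A" and f: "is_schur_function A f" and fin: "log_integral f > - \<infinity>"
  shows "L2_on {0..} A"
proof -
  obtain U where U: "\<And>n l. l \<in> upper_half_plane \<Longrightarrow> riccati A l (real (Suc n)) (U n l)"
    "\<And>n l. l \<in> upper_half_plane \<Longrightarrow> U n l (real (Suc n)) = 0"
    "\<And>l. l \<in> upper_half_plane \<Longrightarrow> (\<lambda>n. U n l 0) \<longlonglongrightarrow> f l"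
    by (rule schur_approximants[OF A f]) blast
  note fhol = schur_function_bounded_holomorphic[OF A f]
  define I where "I = (\<integral>\<^sup>+ x. neg_log_defect (boundary_value f x) \<partial>lborel)"
  have "I < \<infinity>" using fin unfolding log_integral_finite_iff I_def .
  then obtain C where C: "I = ennreal C" "0 \<le> C" by (cases I) auto
  have "L2_mass A r \<le> C / pi" if r: "0 < r" for r
  proof -
    \<comment> \<open>The shift makes every truncation reach r + 1; the extra unit is the margin
      needed for the asymptotics on the imaginary axis.\<close>
    define n0 where "n0 = nat \<lceil>r\<rceil>"
    have n0: "r + 1 \<le> real (Suc (n + n0))" for n using r by (simp add: n0_def) linarith
    define V where "V = (\<lambda>n. U (n + n0))"
    have Vr1: "riccati A l (r + 1) (V n l)" if "l \<in> upper_half_plane" for n l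
      unfolding V_def using r n0 by (intro riccati_subinterval[OF U(1)[OF that]]) auto
    have V0: "(\<lambda>n. V n l 0) \<longlonglongrightarrow> f l" if "l \<in> upper_half_plane" for l
      unfolding V_def using LIMSEQ_ignore_initial_segment[OF U(3)[OF that]] .
    have A1: "A absolutely_integrable_on {0..r + 1}" using L2_locD(2)[OF A, of "r + 1"] r by simp
    have Ar: "A absolutely_integrable_on {0..r}" using L2_locD(2)[OF A r] .
    have conv: "convergent (\<lambda>n. V n l s)" if l: "l \<in> upper_half_plane" and s: "s \<in> {0..r + 1}" for l s
    proof (rule Cauchy_convergent, rule metric_CauchyI)
      define K where "K = exp (Im l * s + 2 * L1_mass A (r + 1))"
      fix e :: real assume "0 < e"
      then have "0 < e / K" by (simp add: K_def)
      then obtain M where M: "\<And>m n. m \<ge> M \<Longrightarrow> n \<ge> M \<Longrightarrow> dist (V m l 0) (V n l 0) < e / K"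
        using LIMSEQ_imp_Cauchy[OF V0[OF l]] by (meson metric_CauchyD)
      have "dist (V m l s) (V n l s) < e" if "m \<ge> M" "n \<ge> M" for m n
      proof -
        have "dist (V m l s) (V n l s) \<le> dist (V m l 0) (V n l 0) * K"
          using riccati_diff_bound[OF Vr1[OF l, of m] Vr1[OF l, of n] A1 s] by (simp add: dist_norm K_def)
        also have "\<dots> < e / K * K" using M[OF that] by (intro mult_strict_right_mono) (auto simp: K_def)
        finally show ?thesis by (simp add: K_def)
      qed
      then show "\<exists>M. \<forall>m\<ge>M. \<forall>n\<ge>M. dist (V m l s) (V n l s) < e" by blast
    qed
    define v where "v = (\<lambda>l s. lim (\<lambda>n. V n l s))"
    have Vlim: "(\<lambda>n. V n l s) \<longlonglongrightarrow> v l s" if "l \<in> upper_half_plane" "s \<in> {0..r + 1}" for l s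
      using conv[OF that] by (simp add: v_def convergent_LIMSEQ_iff)
    have v1: "riccati A l (r + 1) (v l)" if "l \<in> upper_half_plane" for l
      using r by (intro riccati_limit(1)[OF Vr1[OF that] Vlim[OF that] A1]) auto
    have vr: "riccati A l r (v l)" if "l \<in> upper_half_plane" for l
      using riccati_subinterval[OF v1[OF that]] r by simp
    have v0: "v l 0 = f l" if "l \<in> upper_half_plane" for l
      using LIMSEQ_unique[OF Vlim[OF that, of 0] V0[OF that]] r by simp
    define g where "g = (\<lambda>l. riccati_log A (v l) r)"
    define N where "N = L1_mass A r"
    have glim: "(\<lambda>n. riccati_log A (V n l) r) \<longlonglongrightarrow> g l" if "l \<in> upper_half_plane" for l
      unfolding g_def
    proof (rule riccati_limit(2)[OF _ _ Ar])
      show "riccati A l r (V n l)" for n using riccati_subinterval[OF Vr1[OF that]] r by simp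
    qed (use Vlim[OF that] r in auto)
    have Vbd: "cmod (riccati_log A (V n l) r) \<le> N" if "l \<in> upper_half_plane" for n l
      unfolding N_def using riccati_subinterval[OF Vr1[OF that], of r] r by (intro riccati_log_bound[OF _ Ar]) auto
    \<comment> \<open>Holomorphy is taken from the truncations, whose solutions vanish at their
      right end. The limit \<open>v\<close> has no terminal condition, so it inherits holomorphy
      through bounded pointwise convergence.\<close>
    have ghol: "g holomorphic_on upper_half_plane"
    proof (rule pointwise_limit_holomorphic[OF open_upper_half_plane _ Vbd glim])
      show "(\<lambda>l. riccati_log A (V n l) r) holomorphic_on upper_half_plane" for n
        unfolding V_def
        by (rule riccati_holomorphic(2)[where R = "real (Suc (n + n0))"])
          (use U L2_locD(2)[OF A, of "real (Suc (n + n0))"] r n0[of n] in \<open>auto simp del: of_nat_Suc of_nat_add\<close>)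
    qed
    have gbd: "cmod (g l) \<le> N" if "l \<in> upper_half_plane" for l
      unfolding g_def N_def using r by (intro riccati_log_bound[OF vr[OF that] Ar]) auto
    have N0: "0 \<le> N" using order_trans[OF norm_ge_zero gbd[of \<i>]] by (simp add: upper_half_plane_def)
    have energy: "1 - (cmod (f l))\<^sup>2 - 2 * Im l * r * exp (2 * N) \<le> exp (2 * Re (g l))" if "l \<in> upper_half_plane" for l
      using riccati_energy(2)[OF vr[OF that] Ar] that r by (simp add: g_def N_def v0[OF that] upper_half_plane_def)
    define \<epsilon> where "\<epsilon> = (\<lambda>k. 1 / real (Suc k))"
    have \<epsilon>: "0 < \<epsilon> k" for k by (simp add: \<epsilon>_def)
    have \<epsilon>0: "\<epsilon> \<longlonglongrightarrow> 0" unfolding \<epsilon>_def by (rule LIMSEQ_Suc[OF lim_const_over_n[of 1, simplified]])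
    have upx: "Complex x (\<epsilon> k) \<in> upper_half_plane" for x k using \<epsilon> by (simp add: upper_half_plane_def)
    \<comment> \<open>The energy error is proportional to the height and vanishes along
      \<open>\<epsilon>\<close>. At boundary values of modulus at least 1 the right side is
      infinite; elsewhere the limit even carries a factor 1/2, which is given away.\<close>
    have pw: "limsup (\<lambda>k. ennreal (- Re (g (Complex x (\<epsilon> k))))) \<le> neg_log_defect b"
      if lim: "(\<lambda>k. f (Complex x (\<epsilon> k))) \<longlonglongrightarrow> b" for x b
    proof (cases "cmod b < 1")
      case True
      define D where "D = (\<lambda>k. 1 - (cmod (f (Complex x (\<epsilon> k))))\<^sup>2 - 2 * \<epsilon> k * r * exp (2 * N))"
      have b: "0 < 1 - (cmod b)\<^sup>2" using True by (simp add: power_less_one_iff abs_square_less_1)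
      have "D \<longlonglongrightarrow> 1 - (cmod b)\<^sup>2 - 2 * 0 * r * exp (2 * N)"
        unfolding D_def by (intro tendsto_intros lim \<epsilon>0)
      then have D: "D \<longlonglongrightarrow> 1 - (cmod b)\<^sup>2" by simp
      have "limsup (\<lambda>k. ennreal (- Re (g (Complex x (\<epsilon> k))))) \<le> limsup (\<lambda>k. ennreal (- ln (D k) / 2))"
      proof (rule Limsup_mono)
        show "\<forall>\<^sub>F k in sequentially. ennreal (- Re (g (Complex x (\<epsilon> k)))) \<le> ennreal (- ln (D k) / 2)"
          using order_tendstoD(1)[OF D b]
        proof eventually_elim
          case (elim k)
          have "D k \<le> exp (2 * Re (g (Complex x (\<epsilon> k))))" using energy[OF upx, of x k] by (simp add: D_def)
          then have "ln (D k) \<le> 2 * Re (g (Complex x (\<epsilon> k)))"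
            using elim by (metis ln_exp ln_mono)
          then show ?case by (intro ennreal_leI) simp
        qed
      qed
      also have "\<dots> = ennreal (- ln (1 - (cmod b)\<^sup>2) / 2)"
        using b by (intro lim_imp_Limsup tendsto_intros D) auto
      also have "\<dots> \<le> ennreal (- ln (1 - (cmod b)\<^sup>2))"
        using b by (intro ennreal_leI) (simp add: ln_le_zero_iff)
      finally show ?thesis using True by (simp add: neg_log_defect_def)
    qed (simp add: neg_log_defect_def)
    have gcont: "continuous_on upper_half_plane g" by (rule holomorphic_on_imp_continuous_on[OF ghol])
    have key: "ennreal (pi * y * - Re (g (\<i> * of_real y))) \<le> I" if y: "0 < y" for y
    proof -
      define \<kappa> where "\<kappa> = (\<lambda>x. y\<^sup>2 / (x\<^sup>2 + y\<^sup>2))"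
      have \<kappa>: "0 \<le> \<kappa> x" "\<kappa> x \<le> 1" for x using y by (auto simp: \<kappa>_def divide_le_eq_1 add_nonneg_pos)
      define u where "u = (\<lambda>k x. ennreal (- Re (g (Complex x (\<epsilon> k))) * \<kappa> x))"
      have mg: "(\<lambda>x. g (Complex x (\<epsilon> k))) \<in> borel_measurable borel" for k
        by (rule borel_measurable_continuous_onI, rule continuous_on_compose2[OF gcont])
          (use upx in \<open>auto simp: Complex_eq intro!: continuous_intros\<close>)
      have mu: "u k \<in> borel_measurable lborel" for k
        unfolding u_def \<kappa>_def using mg[of k] by measurable
      have "ennreal (pi * y * - Re (g (\<i> * of_real (y + \<epsilon> k)))) \<le> (\<integral>\<^sup>+ x. u k x \<partial>lborel)" for k
        unfolding u_def \<kappa>_def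
        by (rule ennreal_integral_le_nn_integral, rule Poisson_line_Re[OF ghol _ \<epsilon> y], rule gbd)
      then have "limsup (\<lambda>k. ennreal (pi * y * - Re (g (\<i> * of_real (y + \<epsilon> k))))) \<le> limsup (\<lambda>k. \<integral>\<^sup>+ x. u k x \<partial>lborel)"
        by (intro Limsup_mono always_eventually allI)
      moreover have "(\<lambda>k. ennreal (pi * y * - Re (g (\<i> * of_real (y + \<epsilon> k))))) \<longlonglongrightarrow> ennreal (pi * y * - Re (g (\<i> * of_real y)))"
      proof (intro tendsto_intros)
        have "(\<lambda>k. \<i> * complex_of_real (y + \<epsilon> k)) \<longlonglongrightarrow> \<i> * of_real (y + 0)" by (intro tendsto_intros \<epsilon>0)
        then show "(\<lambda>k. g (\<i> * complex_of_real (y + \<epsilon> k))) \<longlonglongrightarrow> g (\<i> * of_real y)"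
          by (intro continuous_on_tendsto_compose[OF gcont])
            (use y \<epsilon> in \<open>auto simp: upper_half_plane_def add_pos_pos simp del: of_real_add\<close>)
      qed
      ultimately have "ennreal (pi * y * - Re (g (\<i> * of_real y))) \<le> limsup (\<lambda>k. \<integral>\<^sup>+ x. u k x \<partial>lborel)"
        using lim_imp_Limsup[OF sequentially_bot] by metis
      also have "\<dots> \<le> (\<integral>\<^sup>+ x. limsup (\<lambda>k. u k x) \<partial>lborel)"
      proof (rule nn_integral_limsup[OF mu])
        \<comment> \<open>The reverse Fatou inequality needs an integrable majorant. For fixed y it
          is \<open>N\<close> times the Poisson weight, of integral \<open>N\<close> * pi * y, which
          is why y cannot be sent to infinity earlier.\<close>
        have i: "integrable lborel (\<lambda>x. N * y\<^sup>2 * (Cauchy_kernel y x))"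
          by (rule integrable_mult_right[OF integrable_Cauchy_kernel(1)[OF y]])
        then show "(\<lambda>x. ennreal (N * y\<^sup>2 * (Cauchy_kernel y x))) \<in> borel_measurable lborel" by measurable
        show "(\<integral>\<^sup>+ x. ennreal (N * y\<^sup>2 * (Cauchy_kernel y x)) \<partial>lborel) < \<infinity>"
          using N0 by (subst nn_integral_eq_integral[OF i]) auto
        show "AE x in lborel. u k x \<le> ennreal (N * y\<^sup>2 * (Cauchy_kernel y x))" for k
        proof (rule AE_I2)
          fix x
          have "- Re (g (Complex x (\<epsilon> k))) \<le> N"
            using gbd[OF upx, of x k] abs_Re_le_cmod[of "g (Complex x (\<epsilon> k))"] by linarith
          then have "- Re (g (Complex x (\<epsilon> k))) * \<kappa> x \<le> N * \<kappa> x" using \<kappa> by (intro mult_right_mono) auto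
          then show "u k x \<le> ennreal (N * y\<^sup>2 * (Cauchy_kernel y x))"
            unfolding u_def by (intro ennreal_leI) (simp add: \<kappa>_def)
        qed
      qed
      also have "\<dots> \<le> I"
        unfolding I_def
      proof (rule nn_integral_mono_AE)
        have "AE x in lborel. (\<lambda>k. f (Complex x (\<epsilon> k))) \<longlonglongrightarrow> boundary_value f x"
          unfolding \<epsilon>_def by (rule boundary_value_sequence[OF fhol(1)]) (rule fhol(2))
        then show "AE x in lborel. limsup (\<lambda>k. u k x) \<le> neg_log_defect (boundary_value f x)"
        proof (rule eventually_mono)
          fix x assume lim: "(\<lambda>k. f (Complex x (\<epsilon> k))) \<longlonglongrightarrow> boundary_value f x"
          \<comment> \<open>Dropping the weight is monotone only for nonnegative values; for
            negative ones \<open>ennreal\<close> already truncates to 0.\<close>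
          have "u k x \<le> ennreal (- Re (g (Complex x (\<epsilon> k))))" for k
          proof (cases "0 \<le> - Re (g (Complex x (\<epsilon> k)))")
            case True
            then show ?thesis unfolding u_def using \<kappa>[of x] by (intro ennreal_leI mult_left_le) auto
          next
            case False
            then have "- Re (g (Complex x (\<epsilon> k))) * \<kappa> x \<le> 0" using \<kappa>[of x] by (intro mult_nonpos_nonneg) auto
            then show ?thesis unfolding u_def by (simp add: ennreal_neg)
          qed
          then have "limsup (\<lambda>k. u k x) \<le> limsup (\<lambda>k. ennreal (- Re (g (Complex x (\<epsilon> k)))))"
            by (intro Limsup_mono always_eventually allI)
          then show "limsup (\<lambda>k. u k x) \<le> neg_log_defect (boundary_value f x)"
            using pw[OF lim] order_trans by blast
        qed
      qed
      finally show ?thesis .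
    qed
    \<comment> \<open>As y grows, the bound on - y Re g(i y) becomes a bound on the mass of |A|^2
      over {0..r}.\<close>
    have "((\<lambda>y. of_real y * riccati_log A (v (\<i> * of_real y)) r) \<longlongrightarrow> - of_real (L2_mass A r)) at_top"
      by (rule riccati_log_asymptotics[OF v1 A r]) (simp add: upper_half_plane_def)
    from tendsto_Re[OF this]
    have "((\<lambda>y. y * Re (g (\<i> * of_real y))) \<longlongrightarrow> - L2_mass A r) at_top"
      by (simp add: g_def)
    then have lim: "((\<lambda>y. pi * - (y * Re (g (\<i> * of_real y)))) \<longlongrightarrow> pi * - (- L2_mass A r)) at_top"
      by (intro tendsto_mult tendsto_minus tendsto_const)
    have "\<forall>\<^sub>F y in at_top. pi * - (y * Re (g (\<i> * of_real y))) \<le> C"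
      using eventually_gt_at_top[of 0]
    proof eventually_elim
      case (elim y)
      have "pi * y * - Re (g (\<i> * of_real y)) \<le> C" using key[OF elim] C by (simp only: ennreal_le_iff)
      then show ?case by (simp only: mult.assoc mult_minus_right)
    qed
    then have "pi * L2_mass A r \<le> C"
      using tendsto_upperbound[OF lim _ trivial_limit_at_top_linorder] by simp
    then show ?thesis by (simp add: field_simps)
  qed
  then show ?thesis by (rule L2_on_half_line_of_bound[OF A])
qed

theorem theorem11p4:
  fixes A :: "real \<Rightarrow> complex" and f :: "complex \<Rightarrow> complex"
  assumes "L2_loc A" and "is_schur_function A f"
  shows "(L2_on {0..} A \<longleftrightarrow> f \<in> S0) \<and> (L2_on {0..} A \<longleftrightarrow> log_integral f > - \<infinity>)"
proof -
  have "L2_on {0..} A \<longleftrightarrow> log_integral f > - \<infinity>"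
    using log_integral_finite_if_L2[OF assms] L2_if_log_integral_finite[OF assms] by blast
  moreover have "f \<in> S0 \<longleftrightarrow> log_integral f > - \<infinity>"
    using schur_function_bounded_holomorphic[OF assms] by (auto simp: S0_def)
  ultimately show ?thesis by blast
qed

end
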